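(* Let $d\ge2$ and let $\Lambda\subset\mathbb Z^d$ be a finite symmetric set of frequencies satisfying the non-degeneracy condition: there exists $\lambda\in\Lambda$ with $\lambda_1\ne\pm\lambda_2$ and $\lambda_1,\lambda_2\neq0$. Let $f$ be the random Gaussian trigonometric polynomial associated with $\Lambda$ (defined in the context). Then the Leray measure $\mathcal L(f)$ is integrable with respect to the Gaussian measure, and $$\mathbb E(\mathcal L)=\frac1{\sqrt{2\pi}}.$$
   Context: $\mathbb T^d=\mathbb R^d/\mathbb Z^d$ carries Lebesgue (probability) measure $\operatorname{meas}$. A non-empty finite set $\Lambda\subset\mathbb Z^d$ is called symmetric if $0\notin\Lambda$ and $\Lambda$ is invariant under all permutations of coordinates and under changing the sign of any coordinate. Let $\mathcal N=\#\Lambda$, and let $\Lambda/\pm$ be a set of representatives of $\Lambda$ modulo $\lambda\mapsto-\lambda$. The random function is $$f(x)=\sqrt{\tfrac{2}{\mathcal N}}\sum_{\lambda\in\Lambda/\pm}\bigl(b_\lambda\cos 2\pi\langle\lambda,x\rangle-c_\lambda\sin2\pi\langle\lambda,x\rangle\bigr),$$ with $b_\lambda,c_\lambda$ ($\lambda\in\Lambda/\pm$) independent standard real Gaussians $N(0,1)$; $\mathbb E$ denotes the corresponding expectation. The Leray measure of the nodal set is $$\mathcal L(f)=\lim_{\epsilon\to0^+}\frac1{2\epsilon}\operatorname{meas}\{x\in\mathbb T^d:|f(x)|<\epsilon\},$$ defined whenever there is no $x$ with $f(x)=0$ and $\nabla f(x)=0$; this is the case for almost every $f$. *)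

theory Defs
  imports "HOL-Probability.Probability"
begin

definition symmetric_frequencies :: "(int ^ 'n::finite) set \<Rightarrow> bool" where
  "symmetric_frequencies \<Lambda> \<longleftrightarrow>
     finite \<Lambda> \<and> \<Lambda> \<noteq> {} \<and> 0 \<notin> \<Lambda> \<and>
     (\<forall>p v. p permutes UNIV \<longrightarrow> v \<in> \<Lambda> \<longrightarrow> (\<chi> i. v $ p i) \<in> \<Lambda>) \<and>
     (\<forall>k v. v \<in> \<Lambda> \<longrightarrow> (\<chi> i. if i = k then - (v $ i) else v $ i) \<in> \<Lambda>)"

text \<open>A set of representatives of \<open>\<Lambda>\<close> modulo sign: exactly one of \<open>v\<close>, \<open>- v\<close> for each \<open>v \<in> \<Lambda>\<close>.\<close>

definition sign_representatives :: "(int ^ 'n::finite) set \<Rightarrow> (int ^ 'n) set \<Rightarrow> bool" where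
  "sign_representatives \<Lambda> R \<longleftrightarrow> R \<subseteq> \<Lambda> \<and> (\<forall>v\<in>\<Lambda>. v \<in> R \<longleftrightarrow> - v \<notin> R)"

definition freq_inner :: "int ^ 'n::finite \<Rightarrow> real ^ 'n \<Rightarrow> real" where
  "freq_inner v x = (\<Sum>i\<in>UNIV. of_int (v $ i) * x $ i)"

text \<open>Functions on \<open>\<real>\<^sup>d/\<int>\<^sup>d\<close> are represented by their periodic lifts to \<open>\<real>\<^sup>d\<close>; the normalising
  factor uses the cardinality of the full set \<open>\<Lambda>\<close>, the sum ranges over the representatives \<open>R\<close>.\<close>

definition trig_poly ::
  "(int ^ 'n::finite) set \<Rightarrow> (int ^ 'n) set \<Rightarrow> (int ^ 'n \<Rightarrow> real) \<Rightarrow> (int ^ 'n \<Rightarrow> real) \<Rightarrow> real ^ 'n \<Rightarrow> real"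
where
  "trig_poly \<Lambda> R b c x =
     sqrt (2 / real (card \<Lambda>)) *
       (\<Sum>v\<in>R. b v * cos (2 * pi * freq_inner v x) - c v * sin (2 * pi * freq_inner v x))"

text \<open>Lebesgue probability measure on the torus, carried by the fundamental domain \<open>[0,1)\<^sup>d\<close>.\<close>

definition torus_measure :: "(real ^ 'n::finite) measure" where
  "torus_measure = restrict_space lborel {x. \<forall>i. 0 \<le> x $ i \<and> x $ i < 1}"

definition leray_quotient :: "(real ^ 'n::finite \<Rightarrow> real) \<Rightarrow> real \<Rightarrow> real" where
  "leray_quotient f \<epsilon> =
     1 / (2 * \<epsilon>) * measure torus_measure {x \<in> space torus_measure. \<bar>f x\<bar> < \<epsilon>}"

text \<open>\<open>Lim\<close> is total: the value is meaningful only if the limit exists.\<close>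

definition leray_measure :: "(real ^ 'n::finite \<Rightarrow> real) \<Rightarrow> real" where
  "leray_measure f = Lim (at_right 0) (leray_quotient f)"

definition nodal_nonsingular :: "(real ^ 'n::finite \<Rightarrow> real) \<Rightarrow> bool" where
  "nodal_nonsingular f \<longleftrightarrow> \<not> (\<exists>x. f x = 0 \<and> GDERIV f x :> 0)"

definition leray_defined :: "(real ^ 'n::finite \<Rightarrow> real) \<Rightarrow> bool" where
  "leray_defined f \<longleftrightarrow>
     nodal_nonsingular f \<and> (\<exists>l. (leray_quotient f \<longlongrightarrow> l) (at_right 0))"

text \<open>Joint independence of the whole family \<open>(b\<^sub>v)\<close>, \<open>(c\<^sub>v)\<close>, \<open>v \<in> R\<close>, is expressed by
  indexing it with the disjoint sum \<open>R <+> R\<close>.\<close>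

definition gaussian_coefficients ::
  "'a measure \<Rightarrow> (int ^ 'n::finite) set \<Rightarrow> (int ^ 'n \<Rightarrow> 'a \<Rightarrow> real) \<Rightarrow> (int ^ 'n \<Rightarrow> 'a \<Rightarrow> real) \<Rightarrow> bool"
where
  "gaussian_coefficients M R b c \<longleftrightarrow>
     prob_space.indep_vars M (\<lambda>_. borel) (case_sum b c) (R <+> R) \<and>
     (\<forall>v\<in>R. distributed M lborel (b v) std_normal_density \<and>
             distributed M lborel (c v) std_normal_density)"

end

theory Submission
  imports Defs "HOL-Real_Asymp.Real_Asymp"
begin

text \<open>Put \<open>q\<^sup>2 = f\<^sup>2 + |\<nabla>f|\<^sup>2\<close> and \<open>V = \<nabla>f / q\<^sup>2\<close>. If \<open>q > 0\<close> everywhere, integrating the divergence of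
  \<open>\<psi>(f) V\<close> over the torus, with \<open>\<psi>\<close> the primitive of \<open>1/(2\<epsilon>)\<close> on \<open>(-\<epsilon>, \<epsilon>)\<close>, expresses the Leray quotient as
  \<open>\<integral> 1\<^bsub>|f| < \<epsilon>\<^esub>/(2\<epsilon>) f\<^sup>2/q\<^sup>2 - \<psi>(f) div V\<close>. The integrand is dominated by \<open>C A / q\<^sup>2\<close>, where \<open>A\<close> bounds \<open>f\<close> and
  its second derivatives, so the limit exists (it is \<open>- \<integral> sgn(f)/2 div V\<close>) and the quotients are bounded
  uniformly in \<open>\<epsilon>\<close>. The vector \<open>(f(x), \<nabla>f(x))\<close> is a nondegenerate Gaussian in \<open>d + 1\<close> variables whose law does
  not depend on \<open>x\<close>; hence \<open>E \<integral> q\<^bsup>-s\<^esup>\<close> is finite for \<open>s = d + 1/2 < d + 1\<close>. Since \<open>s > d\<close> and \<open>q\<close> is Lipschitz,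
  finiteness of \<open>\<integral> q\<^bsup>-s\<^esup>\<close> excludes zeros of \<open>q\<close>; since \<open>s \<ge> 5/2\<close>, \<open>A / q\<^sup>2 \<le> A\<^sup>5 + 1 + q\<^bsup>-s\<^esup>\<close> makes the
  uniform bound integrable. Dominated convergence and \<open>f(x) \<sim> N(0, 1)\<close> give the expectation.\<close>

section \<open>Integration over the torus\<close>

text \<open>The first candidate for the field is grad f / |grad f|^2, but it blows up at every
  critical point of \<open>f\<close>, and a periodic function always has some. Adding f^2 to the
  denominator moves the singularity to the common zeros of \<open>f\<close> and its gradient, which
  almost surely do not exist. The price is the error term with f^2/q^2, harmless because f^2 is at
  most \<epsilon> |f| where |f| < \<epsilon>. The room for the exponent s is the open interval from
  d to d + 1. It is there only because the value f(x) adds one Gaussian dimension to the d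
  dimensions of the gradient; s is its midpoint. Integrability has an obstacle of its own:
  \<open>integrable\<close> demands that \<open>leray_measure\<close> be measurable on the whole
  sample space, including the null set where the limit may fail to exist, and \<open>M\<close> need
  not be complete. Hence the separate argument through rational \<epsilon>.\<close>

definition half_open_cube :: "(real ^ 'n::finite) set" where
  "half_open_cube = {x. \<forall>i. 0 \<le> x $ i \<and> x $ i < 1}"

lemma half_open_cube_sets [measurable]: "half_open_cube \<in> sets borel"
proof -
  have "half_open_cube = (\<Inter>i\<in>UNIV. {x::real^'n. 0 \<le> x $ i} \<inter> {x. x $ i < 1})"
    by (auto simp: half_open_cube_def)
  also have "\<dots> \<in> sets borel"
    by (intro sets.finite_INT sets.Int borel_closed borel_open closed_Collect_le open_Collect_less
        continuous_intros) auto
  finally show ?thesis .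
qed

lemma torus_measure_eq: "torus_measure = restrict_space lborel half_open_cube"
  by (simp add: torus_measure_def half_open_cube_def)

lemma space_torus_measure: "space torus_measure = half_open_cube"
  by (simp add: torus_measure_eq space_restrict_space)

lemma sets_torus_measure [measurable_cong]:
  "sets torus_measure = sets (restrict_space borel half_open_cube)"
  by (simp add: torus_measure_eq sets_restrict_space)

lemma borel_measurable_torus [measurable (raw)]:
  "g \<in> borel_measurable borel \<Longrightarrow> g \<in> borel_measurable torus_measure"
  by (simp add: torus_measure_eq measurable_restrict_space1)

text \<open>Squeezed between the open and the closed unit box, both of volume 1.\<close>

lemma emeasure_half_open_cube: "emeasure lborel (half_open_cube :: (real ^ 'n::finite) set) = 1"
proof (rule antisym)
  let ?o = "(\<chi> i. 1) :: real ^ 'n"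
  have b: "(?o - 0) \<bullet> i = 1" if "i \<in> Basis" for i :: "real ^ 'n"
    using that by (auto simp: Basis_vec_def inner_axis)
  have p: "(\<Prod>i\<in>Basis. (?o - 0) \<bullet> i) = 1"
    by (rule prod.neutral) (use b in blast)
  have le: "0 \<bullet> i \<le> ?o \<bullet> i" if "i \<in> Basis" for i :: "real ^ 'n"
    using b[OF that] by simp
  have e: "emeasure lborel (cbox 0 ?o) = 1" "emeasure lborel (box 0 ?o) = 1"
    using emeasure_lborel_cbox[OF le] emeasure_lborel_box[OF le] p by auto
  have "(half_open_cube :: (real ^ 'n) set) \<subseteq> cbox 0 ?o"
    by (auto simp: half_open_cube_def mem_box_cart less_imp_le)
  then show "emeasure lborel (half_open_cube :: (real ^ 'n) set) \<le> 1"
    by (metis e(1) emeasure_mono sets_lborel borel_closed closed_cbox)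
  have "box 0 ?o \<subseteq> (half_open_cube :: (real ^ 'n) set)"
    by (auto simp: half_open_cube_def mem_box_cart less_imp_le)
  then show "1 \<le> emeasure lborel (half_open_cube :: (real ^ 'n) set)"
    by (metis e(2) emeasure_mono sets_lborel half_open_cube_sets)
qed

lemma prob_space_torus_measure: "prob_space (torus_measure :: (real ^ 'n::finite) measure)"
  by standard
    (simp add: space_torus_measure, simp add: torus_measure_eq emeasure_restrict_space emeasure_half_open_cube)

lemma bounded_integrable_torus:
  fixes g :: "real ^ 'n::finite \<Rightarrow> real"
  assumes [measurable]: "g \<in> borel_measurable borel" and "\<And>x. \<bar>g x\<bar> \<le> B"
  shows "integrable torus_measure g"
proof -
  interpret prob_space "torus_measure :: (real ^ 'n) measure" by (rule prob_space_torus_measure)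
  show ?thesis
    by (rule integrable_const_bound[where B = B]) (use assms in auto)
qed

definition periodic :: "(real ^ 'n::finite \<Rightarrow> 'b) \<Rightarrow> bool" where
  "periodic g \<longleftrightarrow> (\<forall>x i. g (x + axis i 1) = g x)"

lemma integral_torus: "integral\<^sup>L torus_measure g = (\<integral>x. indicator half_open_cube x * g x \<partial>lborel)"
  for g :: "real ^ 'n::finite \<Rightarrow> real"
  by (simp add: torus_measure_eq integral_restrict_space)

lemma integral_shift: "(\<integral>x. g (c + x) \<partial>lborel) = (\<integral>x. g x \<partial>lborel)"
  if [measurable]: "g \<in> borel_measurable borel" for g :: "'a::euclidean_space \<Rightarrow> real"
proof -
  have "(\<integral>x. g x \<partial>lborel) = (\<integral>x. g x \<partial>distr lborel borel ((+) c))"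
    by (simp add: lborel_distr_plus)
  also have "\<dots> = (\<integral>x. g (c + x) \<partial>lborel)"
    by (rule integral_distr) auto
  finally show ?thesis by simp
qed

text \<open>Since \<open>t\<close> is at most one period, the translated cube sticks out across one
  face only; the overhang, moved back by one unit along the axis, fills the slab left empty.
  Boundedness makes the two pieces integrable separately.\<close>

lemma integral_torus_translate:
  fixes g :: "real ^ 'n::finite \<Rightarrow> real"
  assumes [measurable]: "g \<in> borel_measurable borel" and bd: "\<And>x. \<bar>g x\<bar> \<le> B"
    and per: "periodic g" and t: "0 \<le> t" "t \<le> 1"
  shows "(\<integral>x. g (x + t *\<^sub>R axis i 1) \<partial>torus_measure) = integral\<^sup>L torus_measure g"
proof -
  let ?Q = "half_open_cube :: (real ^ 'n) set"
  let ?e = "axis i 1 :: real ^ 'n"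
  let ?hi = "\<lambda>x. indicator ?Q x * indicator {x. t \<le> x $ i} x * g x"
  let ?lo = "\<lambda>x. indicator ?Q x * indicator {x. x $ i < t} x * g x"
  have m[measurable]: "{x::real^'n. t \<le> x $ i} \<in> sets borel" "{x::real^'n. x $ i < t} \<in> sets borel"
    by (auto intro!: borel_closed borel_open closed_Collect_le open_Collect_less continuous_intros)
  have int: "integrable lborel (\<lambda>x. indicator ?Q x * g x)"
  proof -
    have "integrable torus_measure g" using assms by (intro bounded_integrable_torus)
    then show ?thesis
      by (simp add: torus_measure_eq integrable_restrict_space)
  qed
  have hi: "integrable lborel ?hi"
    by (rule Bochner_Integration.integrable_bound[OF int]) (auto simp: indicator_def)
  have lo: "integrable lborel ?lo"
    by (rule Bochner_Integration.integrable_bound[OF int]) (auto simp: indicator_def)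
  have lo': "integrable lborel (\<lambda>x. ?lo (- ?e + x))"
    using lo
    by (subst integrable_distr_eq[of "(+) (- ?e)" lborel borel ?lo, symmetric])
       (auto simp: lborel_distr_plus)
  have per': "g (- ?e + x) = g x" for x
    using per[unfolded periodic_def, rule_format, of "- ?e + x" i] by simp
  \<comment> \<open>The half-open faces make this hold at every point, so no boundary null set has
    to be discarded.\<close>
  have split: "indicator ?Q (x - t *\<^sub>R ?e) * g x = ?hi x + ?lo (- ?e + x)" for x
  proof -
    have 1: "(x - t *\<^sub>R ?e) \<in> ?Q \<longleftrightarrow> (\<forall>j. j \<noteq> i \<longrightarrow> 0 \<le> x$j \<and> x$j < 1) \<and> t \<le> x$i \<and> x$i < 1 + t"
      by (auto simp: half_open_cube_def axis_def algebra_simps)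
    have 2: "x \<in> ?Q \<longleftrightarrow> (\<forall>j. j \<noteq> i \<longrightarrow> 0 \<le> x$j \<and> x$j < 1) \<and> 0 \<le> x$i \<and> x$i < 1"
      by (auto simp: half_open_cube_def)
    have 3: "- ?e + x \<in> ?Q \<longleftrightarrow> (\<forall>j. j \<noteq> i \<longrightarrow> 0 \<le> x$j \<and> x$j < 1) \<and> 1 \<le> x$i \<and> x$i < 2"
      by (auto simp: half_open_cube_def axis_def algebra_simps)
    show ?thesis
      unfolding indicator_def per' 1 2 3 mem_Collect_eq using t by (auto simp: axis_def)
  qed
  have "(\<integral>x. g (x + t *\<^sub>R ?e) \<partial>torus_measure) = (\<integral>x. indicator ?Q x * g (x + t *\<^sub>R ?e) \<partial>lborel)"
    by (rule integral_torus)
  also have "\<dots> = (\<integral>x. indicator ?Q (x - t *\<^sub>R ?e) * g x \<partial>lborel)"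
    using integral_shift[of "\<lambda>x. indicator ?Q (x - t *\<^sub>R ?e) * g x" "t *\<^sub>R ?e"]
    by (simp add: add.commute)
  also have "\<dots> = (\<integral>x. ?hi x \<partial>lborel) + (\<integral>x. ?lo (- ?e + x) \<partial>lborel)"
    unfolding split by (rule Bochner_Integration.integral_add[OF hi lo'])
  also have "\<dots> = (\<integral>x. ?hi x \<partial>lborel) + (\<integral>x. ?lo x \<partial>lborel)"
    by (subst integral_shift[of ?lo]) auto
  also have "\<dots> = (\<integral>x. ?hi x + ?lo x \<partial>lborel)"
    by (rule Bochner_Integration.integral_add[symmetric, OF hi lo])
  also have "\<dots> = (\<integral>x. indicator ?Q x * g x \<partial>lborel)"
    by (rule Bochner_Integration.integral_cong) (auto simp: indicator_def)
  finally show ?thesis by (simp add: integral_torus)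
qed

lemma periodic_int_translate:
  assumes "periodic g"
  shows "g (x + (\<chi> i. of_int (k i))) = g x"
proof -
  have nat: "g (x + real n *\<^sub>R axis i 1) = g x" for n x i
  proof (induction n)
    case (Suc n)
    have "g (x + real (Suc n) *\<^sub>R axis i 1) = g ((x + real n *\<^sub>R axis i 1) + axis i 1)"
      by (simp add: scaleR_left_distrib add_ac)
    also have "\<dots> = g (x + real n *\<^sub>R axis i 1)"
      using assms unfolding periodic_def by blast
    finally show ?case using Suc by simp
  qed simp
  have int: "g (x + of_int m *\<^sub>R axis i 1) = g x" for m x i
  proof (cases "m \<ge> 0")
    case True
    then show ?thesis using nat[of x "nat m" i] by simp
  next
    case False
    then have "x + of_int m *\<^sub>R axis i 1 + real (nat (- m)) *\<^sub>R axis i 1 = x"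
      by (simp add: scaleR_left_diff_distrib)
    then show ?thesis using nat[of "x + of_int m *\<^sub>R axis i 1" "nat (- m)" i]
      by (simp only:)
  qed
  have "g (x + (\<Sum>i\<in>S. of_int (k i) *\<^sub>R axis i 1)) = g x" if "finite S" for S
    using that
  proof (induction S)
    case (insert i S)
    then show ?case
      using int[of "x + (\<Sum>i\<in>S. of_int (k i) *\<^sub>R axis i 1)" "k i" i] by (simp add: algebra_simps)
  qed simp
  from this[of UNIV] show ?thesis
    using basis_expansion[of "\<chi> i. real_of_int (k i)"] by (simp add: scalar_mult_eq_scaleR)
qed

lemma periodic_reduce:
  fixes x :: "real ^ 'n::finite"
  obtains y where "y \<in> half_open_cube" "\<And>g :: real ^ 'n \<Rightarrow> 'b. periodic g \<Longrightarrow> g y = g x"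
proof
  let ?y = "x + (\<chi> i. real_of_int (- \<lfloor>x $ i\<rfloor>))"
  show "?y \<in> half_open_cube"
    by (auto simp: half_open_cube_def) (linarith)
  show "g ?y = g x" if "periodic g" for g :: "real ^ 'n \<Rightarrow> 'b"
    using periodic_int_translate[OF that, of x "\<lambda>i. - \<lfloor>x $ i\<rfloor>"] by simp
qed

text \<open>All values are attained on the closed unit box, which is compact, unlike
  \<open>half_open_cube\<close>.\<close>

lemma compact_range_periodic:
  fixes g :: "real ^ 'n::finite \<Rightarrow> real"
  assumes "continuous_on UNIV g" "periodic g"
  shows "compact (range g)"
proof -
  let ?K = "cbox 0 ((\<chi> i. 1) :: real ^ 'n)"
  have "range g = g ` ?K"
  proof safe
    fix x
    obtain y where "y \<in> half_open_cube" "g y = g x"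
      using periodic_reduce[where 'b = real, of x] assms(2) by metis
    then show "g x \<in> g ` ?K"
      by (intro image_eqI[of _ _ y]) (auto simp: half_open_cube_def mem_box_cart less_imp_le)
  qed auto
  then show ?thesis
    using assms(1) by (metis compact_cbox compact_continuous_image continuous_on_subset subset_UNIV)
qed

lemma periodic_bounded:
  fixes g :: "real ^ 'n::finite \<Rightarrow> real"
  assumes "continuous_on UNIV g" "periodic g"
  shows "\<exists>B>0. \<forall>x. \<bar>g x\<bar> \<le> B"
proof -
  obtain B where "B > 0" "\<forall>y\<in>range g. norm y \<le> B"
    using compact_imp_bounded[OF compact_range_periodic[OF assms]] unfolding bounded_pos by blast
  then show ?thesis by (intro exI[of _ B]) simp
qed

lemma integrable_torus_periodic:
  fixes g :: "real ^ 'n::finite \<Rightarrow> real"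
  assumes "continuous_on UNIV g" "periodic g"
  shows "integrable torus_measure g"
proof -
  obtain B where "\<forall>x. \<bar>g x\<bar> \<le> B" using periodic_bounded[OF assms] by blast
  then show ?thesis
    by (intro bounded_integrable_torus[of g B] borel_measurable_continuous_onI assms) simp
qed

text \<open>Integration by parts on the torus, where no boundary term arises: by translation
  invariance the difference quotients have integral zero, and the mean value theorem bounds them by
  the constant \<open>C\<close>, so dominated convergence passes this on to the derivative.\<close>

lemma integral_torus_directional_derivative:
  fixes g g' :: "real ^ 'n::finite \<Rightarrow> real"
  assumes cont: "continuous_on UNIV g" "continuous_on UNIV g'"
    and per: "periodic g" "periodic g'"
    and deriv: "\<And>x. ((\<lambda>t. g (x + t *\<^sub>R axis i 1)) has_real_derivative g' x) (at 0)"
  shows "integral\<^sup>L torus_measure g' = 0"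
proof -
  interpret T: prob_space "torus_measure :: (real ^ 'n) measure" by (rule prob_space_torus_measure)
  let ?e = "axis i 1 :: real ^ 'n"
  have meas[measurable]: "g \<in> borel_measurable borel" "g' \<in> borel_measurable borel"
    using cont by (auto intro: borel_measurable_continuous_onI)
  obtain B where B: "B > 0" "\<And>x. \<bar>g x\<bar> \<le> B"
    using periodic_bounded[OF cont(1) per(1)] by blast
  obtain C where C: "C > 0" "\<And>x. \<bar>g' x\<bar> \<le> C"
    using periodic_bounded[OF cont(2) per(2)] by blast
  \<comment> \<open>The increments stay in (0, 1], the range covered by
    \<open>integral_torus_translate\<close>.\<close>
  define h where "h n = inverse (real (Suc n))" for n
  have h: "0 < h n" "h n \<le> 1" for n by (auto simp: h_def field_simps)
  define D where "D n x = (g (x + h n *\<^sub>R ?e) - g x) / h n" for n x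
  have Dm[measurable]: "D n \<in> borel_measurable borel" for n unfolding D_def by measurable
  have deriv': "((\<lambda>t. g (x + t *\<^sub>R ?e)) has_real_derivative g' (x + s *\<^sub>R ?e)) (at s)" for x s
  proof -
    have "((\<lambda>t. g ((x + s *\<^sub>R ?e) + (t + - s) *\<^sub>R ?e)) has_real_derivative g' (x + s *\<^sub>R ?e)) (at s)"
      using DERIV_shift[of "\<lambda>t. g ((x + s *\<^sub>R ?e) + t *\<^sub>R ?e)" "g' (x + s *\<^sub>R ?e)" s "- s"]
        deriv[of "x + s *\<^sub>R ?e"] by simp
    then show ?thesis by (simp add: algebra_simps)
  qed
  have Dbd: "\<bar>D n x\<bar> \<le> C" for n x
  proof -
    have "\<exists>z>0. z < h n \<and> g (x + h n *\<^sub>R ?e) - g (x + 0 *\<^sub>R ?e) = (h n - 0) * g' (x + z *\<^sub>R ?e)"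
      by (rule MVT2[OF h(1)[of n]]) (rule deriv')
    then obtain z where "g (x + h n *\<^sub>R ?e) - g (x + 0 *\<^sub>R ?e) = (h n - 0) * g' (x + z *\<^sub>R ?e)"
      by blast
    then show ?thesis using C(2)[of "x + z *\<^sub>R ?e"] h(1)[of n] by (simp add: D_def)
  qed
  have h0: "filterlim h (at 0) sequentially"
    unfolding filterlim_at using h(1) LIMSEQ_inverse_real_of_nat
    by (auto simp: h_def[abs_def] simp del: of_nat_Suc)
  have Dlim: "(\<lambda>n. D n x) \<longlonglongrightarrow> g' x" for x
    using filterlim_compose[OF deriv[of x, unfolded DERIV_def] h0] by (simp add: D_def o_def)
  have "(\<lambda>n. integral\<^sup>L torus_measure (D n)) \<longlonglongrightarrow> integral\<^sup>L torus_measure g'"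
    by (rule integral_dominated_convergence[where w = "\<lambda>_. C"]) (use Dlim Dbd in auto)
  moreover have "integral\<^sup>L torus_measure (D n) = 0" for n
  proof -
    have i1: "integrable torus_measure (\<lambda>x. g (x + h n *\<^sub>R ?e))"
      by (rule bounded_integrable_torus) (use B in auto)
    have i2: "integrable torus_measure g"
      by (rule bounded_integrable_torus) (use B in auto)
    have "integral\<^sup>L torus_measure (D n)
        = ((\<integral>x. g (x + h n *\<^sub>R ?e) \<partial>torus_measure) - integral\<^sup>L torus_measure g) / h n"
      unfolding D_def using i1 i2 by simp
    also have "\<dots> = 0"
      using integral_torus_translate[OF meas(1) B(2) per(1) less_imp_le[OF h(1)] h(2)] by simp
    finally show ?thesis .
  qed
  ultimately show ?thesis by (simp add: LIMSEQ_const_iff)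
qed

section \<open>The divergence identity for the Leray quotient\<close>

text \<open>The shift by \<open>1 / (n + 1)\<close> makes the pointwise limit \<open>-1\<close> at \<open>0\<close> as well, so that combinations of two steps
  converge everywhere to the indicator of an open interval.\<close>

definition smooth_step :: "nat \<Rightarrow> real \<Rightarrow> real" where
  "smooth_step n w = (w - 1 / Suc n) / sqrt ((w - 1 / Suc n)\<^sup>2 + (1 / Suc n) ^ 4)"

text \<open>A primitive of \<open>smooth_step n\<close>. The fourth power makes the smoothing width
  (1/(n+1))^2 negligible against the shift 1/(n+1); with a square in its place the step at 0 would
  tend to -1/sqrt 2 instead of -1.\<close>

definition smooth_abs :: "nat \<Rightarrow> real \<Rightarrow> real" where
  "smooth_abs n w = sqrt ((w - 1 / Suc n)\<^sup>2 + (1 / Suc n) ^ 4)"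

lemma smooth_abs_arg_pos: "(w - 1 / Suc n)\<^sup>2 + (1 / Suc n) ^ 4 > (0 :: real)"
  by (rule add_nonneg_pos) auto

lemma smooth_abs_has_derivative:
  "(smooth_abs n has_real_derivative smooth_step n w) (at w)"
proof -
  have "((\<lambda>w. sqrt ((w - h)\<^sup>2 + c)) has_real_derivative (w - h) / sqrt ((w - h)\<^sup>2 + c)) (at w)"
    if "(w - h)\<^sup>2 + c > 0" for h c :: real
    using that by (auto intro!: derivative_eq_intros simp: field_simps)
  from this[OF smooth_abs_arg_pos] show ?thesis
    unfolding smooth_abs_def[abs_def] smooth_step_def .
qed

lemma continuous_smooth_step: "continuous_on UNIV (smooth_step n)"
  unfolding smooth_step_def[abs_def]
  by (intro continuous_intros ballI) (use smooth_abs_arg_pos in \<open>simp add: less_imp_neq[symmetric]\<close>)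

lemma smooth_step_bound: "\<bar>smooth_step n w\<bar> \<le> 1"
proof -
  have "\<bar>w - 1 / Suc n\<bar> \<le> sqrt ((w - 1 / Suc n)\<^sup>2 + (1 / Suc n) ^ 4)"
    by (rule real_le_rsqrt) simp
  then show ?thesis
    using smooth_abs_arg_pos[of w n] unfolding smooth_step_def
    by (simp add: abs_divide divide_le_eq_1 del: of_nat_Suc)
qed

lemma smooth_step_tendsto: "(\<lambda>n. smooth_step n w) \<longlonglongrightarrow> (if w > 0 then 1 else -1)"
proof (cases "w > 0")
  case True
  then have "(\<lambda>n. smooth_step n w) \<longlonglongrightarrow> 1" unfolding smooth_step_def by real_asymp
  with True show ?thesis by simp
next
  case False
  then have "(\<lambda>n. smooth_step n w) \<longlonglongrightarrow> -1"
  proof (cases "w = 0")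
    case True
    then show ?thesis unfolding smooth_step_def by real_asymp
  next
    case False
    with \<open>\<not> w > 0\<close> have "w < 0" by simp
    then show ?thesis unfolding smooth_step_def by real_asymp
  qed
  with False show ?thesis by simp
qed

lemma smooth_abs_tendsto: "(\<lambda>n. smooth_abs n w) \<longlonglongrightarrow> \<bar>w\<bar>"
proof -
  have "(\<lambda>n. smooth_abs n w) \<longlonglongrightarrow> sqrt ((w - 0)\<^sup>2 + 0 ^ 4)"
    unfolding smooth_abs_def
    by (intro tendsto_intros LIMSEQ_Suc[OF lim_1_over_n])
  then show ?thesis by simp
qed

lemma smooth_abs_bound: "\<bar>smooth_abs n w\<bar> \<le> \<bar>w\<bar> + 2"
proof -
  have 1: "(1 / real (Suc n)) \<le> 1" "0 \<le> 1 / real (Suc n)" by auto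
  have "(1 / real (Suc n)) ^ 4 \<le> 1" using power_le_one[OF 1(2,1)] .
  moreover have "(w - 1 / real (Suc n))\<^sup>2 \<le> (\<bar>w\<bar> + 1)\<^sup>2"
    by (rule abs_le_square_iff[THEN iffD1]) (use 1 in linarith)
  ultimately have "(w - 1 / real (Suc n))\<^sup>2 + (1 / real (Suc n)) ^ 4 \<le> (\<bar>w\<bar> + 2)\<^sup>2"
    by (simp add: power2_eq_square algebra_simps)
  then show ?thesis unfolding smooth_abs_def using smooth_abs_arg_pos[of w n]
    by (simp add: real_le_lsqrt)
qed

text \<open>The difference of absolute values is the clipped primitive: slope 1/(2\<epsilon>) on
  (-\<epsilon>, \<epsilon>), constant 1/2 to the right and -1/2 to the left. In this form
  \<open>smooth_abs\<close> approximates it by differentiable functions.\<close>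

definition truncated_step :: "real \<Rightarrow> real \<Rightarrow> real" where
  "truncated_step \<epsilon> t = (\<bar>t + \<epsilon>\<bar> - \<bar>t - \<epsilon>\<bar>) / (4 * \<epsilon>)"

lemma truncated_step_bound: "\<epsilon> > 0 \<Longrightarrow> \<bar>truncated_step \<epsilon> t\<bar> \<le> 1 / 2"
  unfolding truncated_step_def by (auto simp: divide_simps abs_if)

lemma truncated_step_eq_sgn: "\<bar>t\<bar> \<ge> \<epsilon> \<Longrightarrow> \<epsilon> > 0 \<Longrightarrow> truncated_step \<epsilon> t = sgn t / 2"
  unfolding truncated_step_def by (auto simp: divide_simps abs_if sgn_if split: if_splits)

text \<open>A C^2 function on the torus with its partial derivatives given as data:
  \<open>f2 i j\<close> is the derivative of \<open>f1 i\<close> along axis \<open>j\<close>.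
  Derivatives along the axes suffice, since a divergence involves no others.\<close>

locale smooth_periodic =
  fixes f :: "real ^ 'n::finite \<Rightarrow> real"
    and f1 :: "'n \<Rightarrow> real ^ 'n \<Rightarrow> real"
    and f2 :: "'n \<Rightarrow> 'n \<Rightarrow> real ^ 'n \<Rightarrow> real"
  assumes cont: "continuous_on UNIV f" "\<And>i. continuous_on UNIV (f1 i)"
      "\<And>i j. continuous_on UNIV (f2 i j)"
    and per: "periodic f" "\<And>i. periodic (f1 i)" "\<And>i j. periodic (f2 i j)"
    and deriv: "\<And>x i. ((\<lambda>t. f (x + t *\<^sub>R axis i 1)) has_real_derivative f1 i x) (at 0)"
      "\<And>x i j. ((\<lambda>t. f1 i (x + t *\<^sub>R axis j 1)) has_real_derivative f2 i j x) (at 0)"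
begin

text \<open>This is q^2; the singular weights are later applied to its square root.\<close>

definition jet :: "real ^ 'n \<Rightarrow> real" where
  "jet x = (f x)\<^sup>2 + (\<Sum>i\<in>UNIV. (f1 i x)\<^sup>2)"

text \<open>The quotient rule for the derivative of \<open>f1 i x / jet x\<close> along axis
  \<open>i\<close>; the bracket is the derivative of \<open>jet\<close> along that axis. Summing
  over \<open>i\<close> gives the divergence of V.\<close>

definition div_part :: "'n \<Rightarrow> real ^ 'n \<Rightarrow> real" where
  "div_part i x = f2 i i x / jet x
     - f1 i x * (2 * f x * f1 i x + 2 * (\<Sum>j\<in>UNIV. f1 j x * f2 j i x)) / (jet x)\<^sup>2"

definition div_field :: "real ^ 'n \<Rightarrow> real" where
  "div_field x = (\<Sum>i\<in>UNIV. div_part i x)"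

lemma continuous_jet: "continuous_on UNIV jet"
  unfolding jet_def[abs_def] by (intro continuous_intros cont)

lemma periodic_jet: "periodic jet"
  using per by (simp add: periodic_def jet_def)

lemma f_meas [measurable]: "f \<in> borel_measurable borel"
  by (intro borel_measurable_continuous_onI cont)

lemma periodic_div_part: "periodic (div_part i)"
  using per periodic_jet by (simp add: periodic_def div_part_def)

context
  assumes pos: "\<And>x. jet x > 0"
begin

lemma continuous_div_part: "continuous_on UNIV (div_part i)"
  unfolding div_part_def[abs_def]
  by (intro continuous_intros cont continuous_jet ballI) (use pos in \<open>simp_all add: less_imp_neq[symmetric]\<close>)

lemma continuous_div_field: "continuous_on UNIV div_field"
  unfolding div_field_def[abs_def] by (intro continuous_intros continuous_div_part)

lemma periodic_div_field: "periodic div_field"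
  using periodic_div_part by (simp add: periodic_def div_field_def)

lemma jet_meas [measurable]: "jet \<in> borel_measurable borel"
  by (intro borel_measurable_continuous_onI continuous_jet)

lemma div_field_meas [measurable]: "div_field \<in> borel_measurable borel"
  by (intro borel_measurable_continuous_onI continuous_div_field)

text \<open>Each partial derivative of \<psi>(f) times \<open>f1 i / jet\<close> along axis
  \<open>i\<close> has integral zero. In their sum |grad f|^2 / jet becomes 1 - f^2 / jet.\<close>

lemma integral_divergence:
  fixes \<psi> k :: "real \<Rightarrow> real"
  assumes d: "\<And>t. (\<psi> has_real_derivative k t) (at t)" and k: "continuous_on UNIV k"
  shows "(\<integral>x. k (f x) * (1 - (f x)\<^sup>2 / jet x) + \<psi> (f x) * div_field x \<partial>torus_measure) = 0"
proof -
  have psi: "continuous_on UNIV \<psi>"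
    by (intro continuous_at_imp_continuous_on ballI DERIV_isCont[OF d])
  define G where "G i x = \<psi> (f x) * (f1 i x / jet x)" for i x
  define G' where "G' i x = k (f x) * f1 i x * (f1 i x / jet x) + \<psi> (f x) * div_part i x" for i x
  have comp: "continuous_on UNIV (\<lambda>x. \<psi> (f x))" "continuous_on UNIV (\<lambda>x. k (f x))"
    by (auto intro!: continuous_on_compose2[OF psi] continuous_on_compose2[OF k] cont)
  have nz: "jet x \<noteq> 0" for x using pos[of x] by simp
  have cG: "continuous_on UNIV (G i)" for i
    unfolding G_def[abs_def] using nz by (intro continuous_intros comp cont continuous_jet) auto
  have cG': "continuous_on UNIV (G' i)" for i
    unfolding G'_def[abs_def]
    using nz by (intro continuous_intros comp cont continuous_jet continuous_div_part) auto
  have pG: "periodic (G i)" for i using per periodic_jet by (simp add: periodic_def G_def)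
  have pG': "periodic (G' i)" for i
    using per periodic_jet periodic_div_part by (simp add: periodic_def G'_def)
  have int: "integral\<^sup>L torus_measure (G' i) = 0" for i
  proof (rule integral_torus_directional_derivative[OF cG cG' pG pG'])
    fix x :: "real ^ 'n"
    let ?l = "\<lambda>t. x + t *\<^sub>R axis i 1"
    have jet': "((\<lambda>t. jet (?l t)) has_real_derivative
        2 * f x * f1 i x + 2 * (\<Sum>j\<in>UNIV. f1 j x * f2 j i x)) (at 0)"
    proof -
      have sq: "((\<lambda>t. (g t)\<^sup>2) has_real_derivative 2 * (g 0 * D)) (at 0)"
        if "(g has_real_derivative D) (at 0)" for g :: "real \<Rightarrow> real" and D
        using DERIV_mult[OF that that] by (simp add: power2_eq_square mult_ac)
      show ?thesis
        unfolding jet_def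
        by (rule DERIV_cong[OF DERIV_add[OF sq[OF deriv(1)] DERIV_sum[OF sq[OF deriv(2)]]]])
           (simp add: sum_distrib_left)
    qed
    have psi': "((\<lambda>t. \<psi> (f (?l t))) has_real_derivative k (f x) * f1 i x) (at 0)"
      using DERIV_chain2[OF d deriv(1)] by simp
    have j0: "jet (?l 0) \<noteq> 0" using nz by simp
    show "((\<lambda>t. G i (?l t)) has_real_derivative G' i x) (at 0)"
      unfolding G_def
      by (rule DERIV_cong[OF DERIV_mult[OF psi' DERIV_divide[OF deriv(2) jet' j0]]])
         (use nz[of x] in \<open>simp add: G'_def div_part_def diff_divide_distrib power2_eq_square right_diff_distrib mult_ac\<close>)
  qed
  have "0 = (\<Sum>i\<in>UNIV. integral\<^sup>L torus_measure (G' i))" using int by simp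
  also have "\<dots> = (\<integral>x. (\<Sum>i\<in>UNIV. G' i x) \<partial>torus_measure)"
    by (rule Bochner_Integration.integral_sum[symmetric]) (intro integrable_torus_periodic cG' pG')
  also have "(\<lambda>x. \<Sum>i\<in>UNIV. G' i x) = (\<lambda>x. k (f x) * (1 - (f x)\<^sup>2 / jet x) + \<psi> (f x) * div_field x)"
  proof
    fix x
    have "1 - (f x)\<^sup>2 / jet x = (\<Sum>i\<in>UNIV. (f1 i x)\<^sup>2) / jet x"
      using nz[of x] by (simp add: jet_def diff_divide_eq_iff)
    also have "\<dots> = (\<Sum>i\<in>UNIV. f1 i x * (f1 i x / jet x))"
      by (simp add: sum_divide_distrib power2_eq_square)
    finally show "(\<Sum>i\<in>UNIV. G' i x) = k (f x) * (1 - (f x)\<^sup>2 / jet x) + \<psi> (f x) * div_field x"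
      unfolding G'_def div_field_def sum.distrib by (simp only: sum_distrib_left mult.assoc)
  qed
  finally show ?thesis by simp
qed

text \<open>The kinks of \<open>truncated_step\<close> at the points \<epsilon> and -\<epsilon> rule
  out a direct use of \<open>integral_divergence\<close>. It is applied to smooth approximations,
  and the identity survives the limit because their derivatives converge everywhere to the indicator
  over 2\<epsilon>.\<close>

lemma leray_quotient_eq:
  assumes e: "\<epsilon> > 0"
  shows "leray_quotient f \<epsilon> = (\<integral>x. indicator {x. \<bar>f x\<bar> < \<epsilon>} x / (2 * \<epsilon>) * ((f x)\<^sup>2 / jet x)
            - truncated_step \<epsilon> (f x) * div_field x \<partial>torus_measure)"
proof -
  interpret T: prob_space "torus_measure :: (real ^ 'n) measure" by (rule prob_space_torus_measure)
  obtain F where F: "\<And>x. \<bar>f x\<bar> \<le> F" using periodic_bounded[OF cont(1) per(1)] by blast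
  obtain D where D: "\<And>x. \<bar>div_field x\<bar> \<le> D"
    using periodic_bounded[OF continuous_div_field periodic_div_field] by blast
  \<comment> \<open>The second term is reflected, with argument \<epsilon> - t: since
    \<open>smooth_step\<close> tends to -1 at 0, the two steps in \<open>k\<close> then cancel at
    both ends t = \<epsilon> and t = -\<epsilon>, which matches the strict inequality |f| <
    \<epsilon>.\<close>
  define \<psi> where "\<psi> n t = (smooth_abs n (t + \<epsilon>) - smooth_abs n (\<epsilon> - t)) / (4 * \<epsilon>)" for n t
  define k where "k n t = (smooth_step n (t + \<epsilon>) + smooth_step n (\<epsilon> - t)) / (4 * \<epsilon>)" for n t
  define H where "H n x = k n (f x) * (1 - (f x)\<^sup>2 / jet x) + \<psi> n (f x) * div_field x" for n x
  define H0 where "H0 x = indicator {x. \<bar>f x\<bar> < \<epsilon>} x / (2 * \<epsilon>) * (1 - (f x)\<^sup>2 / jet x)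
      + truncated_step \<epsilon> (f x) * div_field x" for x
  have d: "(\<psi> n has_real_derivative k n t) (at t)" for n t
    unfolding \<psi>_def[abs_def] k_def using e
    by (auto intro!: derivative_eq_intros DERIV_chain2[OF smooth_abs_has_derivative] simp: field_simps)
  have kc: "continuous_on UNIV (k n)" for n
    unfolding k_def[abs_def] using e
    by (intro continuous_intros continuous_on_compose2[OF continuous_smooth_step]) auto
  have pc: "continuous_on UNIV (\<psi> n)" for n
    by (intro continuous_at_imp_continuous_on ballI DERIV_isCont[OF d])
  have [measurable]: "k n \<in> borel_measurable borel" "\<psi> n \<in> borel_measurable borel" for n
    by (auto intro: borel_measurable_continuous_onI kc pc)
  have tm[measurable]: "truncated_step \<epsilon> \<in> borel_measurable borel"
    unfolding truncated_step_def[abs_def] by measurable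
  have ratio: "0 \<le> (f x)\<^sup>2 / jet x" "(f x)\<^sup>2 / jet x \<le> 1" for x
    using pos[of x] by (auto simp: jet_def sum_nonneg)
  have kb: "\<bar>k n t\<bar> \<le> 1 / (2 * \<epsilon>)" for n t
    using smooth_step_bound[of n "t + \<epsilon>"] smooth_step_bound[of n "\<epsilon> - t"] e
    by (simp add: k_def abs_divide field_simps)
  have pb: "\<bar>\<psi> n (f x)\<bar> \<le> (2 * F + 2 * \<epsilon> + 4) / (4 * \<epsilon>)" for n x
    unfolding \<psi>_def abs_divide
  proof (rule frac_le)
    show "\<bar>smooth_abs n (f x + \<epsilon>) - smooth_abs n (\<epsilon> - f x)\<bar> \<le> 2 * F + 2 * \<epsilon> + 4"
      using smooth_abs_bound[of n "f x + \<epsilon>"] smooth_abs_bound[of n "\<epsilon> - f x"] F[of x] e by linarith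
  qed (use F[of x] e in auto)
  have "(\<lambda>n. integral\<^sup>L torus_measure (H n)) \<longlonglongrightarrow> integral\<^sup>L torus_measure H0"
  proof (rule integral_dominated_convergence
      [where w = "\<lambda>_. 1 / (2 * \<epsilon>) + (2 * F + 2 * \<epsilon> + 4) / (4 * \<epsilon>) * D"])
    show "AE x in torus_measure. (\<lambda>n. H n x) \<longlonglongrightarrow> H0 x"
    proof (rule AE_I2)
      fix x
      have 1: "(\<lambda>n. k n (f x)) \<longlonglongrightarrow>
          ((if f x + \<epsilon> > 0 then 1 else -1) + (if \<epsilon> - f x > 0 then 1 else -1)) / (4 * \<epsilon>)"
        unfolding k_def using e by (intro tendsto_intros smooth_step_tendsto) auto
      have 2: "((if f x + \<epsilon> > 0 then 1 else -1) + (if \<epsilon> - f x > 0 then 1 else -1)) / (4 * \<epsilon>)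
          = (indicator {x. \<bar>f x\<bar> < \<epsilon>} x / (2 * \<epsilon>) :: real)"
        using e by (auto simp: indicator_def)
      have 3: "(\<lambda>n. \<psi> n (f x)) \<longlonglongrightarrow> truncated_step \<epsilon> (f x)"
        unfolding \<psi>_def truncated_step_def abs_minus_commute[of "f x" \<epsilon>] using e
        by (intro tendsto_intros smooth_abs_tendsto) auto
      show "(\<lambda>n. H n x) \<longlonglongrightarrow> H0 x"
        unfolding H_def H0_def by (intro tendsto_intros 1[unfolded 2] 3)
    qed
    show "AE x in torus_measure. norm (H n x) \<le> 1 / (2 * \<epsilon>) + (2 * F + 2 * \<epsilon> + 4) / (4 * \<epsilon>) * D" for n
    proof (rule AE_I2)
      fix x
      have "\<bar>k n (f x)\<bar> * \<bar>1 - (f x)\<^sup>2 / jet x\<bar> \<le> 1 / (2 * \<epsilon>) * 1"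
        by (rule mult_mono) (use kb ratio[of x] e in auto)
      moreover have "\<bar>\<psi> n (f x)\<bar> * \<bar>div_field x\<bar> \<le> (2 * F + 2 * \<epsilon> + 4) / (4 * \<epsilon>) * D"
        by (rule mult_mono) (use pb D F[of x] e in auto)
      ultimately show "norm (H n x) \<le> 1 / (2 * \<epsilon>) + (2 * F + 2 * \<epsilon> + 4) / (4 * \<epsilon>) * D"
        unfolding H_def real_norm_def by (intro order_trans[OF abs_triangle_ineq]) (simp add: abs_mult)
    qed
  qed (unfold H_def H0_def, auto)
  then have H0: "integral\<^sup>L torus_measure H0 = 0"
    using integral_divergence[OF d kc] LIMSEQ_unique[OF _ tendsto_const] unfolding H_def by simp
  have i1: "integrable torus_measure (\<lambda>x. indicator {x. \<bar>f x\<bar> < \<epsilon>} x / (2 * \<epsilon>) :: real)"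
    by (rule bounded_integrable_torus[where B = "1 / (2 * \<epsilon>)"]) (use e in \<open>auto simp: indicator_def\<close>)
  have i2: "integrable torus_measure H0"
    unfolding H0_def
  proof (rule bounded_integrable_torus[where B = "1 / (2 * \<epsilon>) * 1 + 1 / 2 * D"])
    fix x
    have "\<bar>indicator {x. \<bar>f x\<bar> < \<epsilon>} x / (2 * \<epsilon>)\<bar> * \<bar>1 - (f x)\<^sup>2 / jet x\<bar> \<le> 1 / (2 * \<epsilon>) * 1"
      by (rule mult_mono) (use ratio[of x] e in \<open>auto simp: indicator_def\<close>)
    moreover have "\<bar>truncated_step \<epsilon> (f x)\<bar> * \<bar>div_field x\<bar> \<le> 1 / 2 * D"
      by (rule mult_mono) (use truncated_step_bound[OF e] D in auto)
    ultimately show "\<bar>indicator {x. \<bar>f x\<bar> < \<epsilon>} x / (2 * \<epsilon>) * (1 - (f x)\<^sup>2 / jet x) +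
         truncated_step \<epsilon> (f x) * div_field x\<bar> \<le> 1 / (2 * \<epsilon>) * 1 + 1 / 2 * D"
      by (intro order_trans[OF abs_triangle_ineq]) (simp only: abs_mult)
  qed measurable
  have "leray_quotient f \<epsilon> = (\<integral>x. indicator {x. \<bar>f x\<bar> < \<epsilon>} x / (2 * \<epsilon>) \<partial>torus_measure)"
    by (simp add: leray_quotient_def Int_def conj_commute)
  also have "\<dots> = (\<integral>x. indicator {x. \<bar>f x\<bar> < \<epsilon>} x / (2 * \<epsilon>) - H0 x \<partial>torus_measure)"
    using i1 i2 H0 by simp
  also have "\<dots> = (\<integral>x. indicator {x. \<bar>f x\<bar> < \<epsilon>} x / (2 * \<epsilon>) * ((f x)\<^sup>2 / jet x)
            - truncated_step \<epsilon> (f x) * div_field x \<partial>torus_measure)"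
    by (rule Bochner_Integration.integral_cong) (simp_all add: H0_def right_diff_distrib)
  finally show ?thesis .
qed

text \<open>The factor f^2 pays for 1/\<epsilon>: where |f| < \<epsilon>, f^2/(2\<epsilon>) is at
  most |f|. The resulting dominator is free of \<epsilon>.\<close>

lemma leray_integrand_bound:
  assumes e: "\<epsilon> > 0"
  shows "\<bar>indicator {x. \<bar>f x\<bar> < \<epsilon>} x / (2 * \<epsilon>) * ((f x)\<^sup>2 / jet x)
            - truncated_step \<epsilon> (f x) * div_field x\<bar> \<le> \<bar>f x\<bar> / jet x + \<bar>div_field x\<bar>"
proof -
  have "\<bar>indicator {x. \<bar>f x\<bar> < \<epsilon>} x / (2 * \<epsilon>) * ((f x)\<^sup>2 / jet x)\<bar> \<le> \<bar>f x\<bar> / jet x"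
  proof (cases "\<bar>f x\<bar> < \<epsilon>")
    case True
    have "\<bar>f x\<bar> * \<bar>f x\<bar> \<le> (2 * \<epsilon>) * \<bar>f x\<bar>" by (rule mult_right_mono) (use True in auto)
    then show ?thesis using True e pos[of x]
      by (simp add: divide_simps power2_eq_square abs_mult) (simp add: mult_ac)
  qed (use pos[of x] in auto)
  moreover have "\<bar>truncated_step \<epsilon> (f x) * div_field x\<bar> \<le> 1 * \<bar>div_field x\<bar>"
    unfolding abs_mult by (rule mult_right_mono) (use truncated_step_bound[OF e, of "f x"] in auto)
  ultimately show ?thesis by linarith
qed

lemma dominator_integrable: "integrable torus_measure (\<lambda>x. \<bar>f x\<bar> / jet x + \<bar>div_field x\<bar>)"
proof (rule integrable_torus_periodic)
  show "continuous_on UNIV (\<lambda>x. \<bar>f x\<bar> / jet x + \<bar>div_field x\<bar>)"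
    by (intro continuous_intros cont continuous_jet continuous_div_field ballI)
       (use pos in \<open>simp add: less_imp_neq[symmetric]\<close>)
  show "periodic (\<lambda>x. \<bar>f x\<bar> / jet x + \<bar>div_field x\<bar>)"
    using per periodic_jet periodic_div_field by (simp add: periodic_def)
qed

lemma leray_quotient_bound:
  assumes e: "\<epsilon> > 0"
  shows "leray_quotient f \<epsilon> \<le> (\<integral>x. \<bar>f x\<bar> / jet x + \<bar>div_field x\<bar> \<partial>torus_measure)"
proof -
  have [measurable]: "truncated_step \<epsilon> \<in> borel_measurable borel"
    unfolding truncated_step_def[abs_def] by measurable
  show ?thesis
    unfolding leray_quotient_eq[OF e]
  proof (rule integral_mono[OF Bochner_Integration.integrable_bound[OF dominator_integrable] dominator_integrable])
    fix x
    show "indicator {x. \<bar>f x\<bar> < \<epsilon>} x / (2 * \<epsilon>) * ((f x)\<^sup>2 / jet x)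
            - truncated_step \<epsilon> (f x) * div_field x \<le> \<bar>f x\<bar> / jet x + \<bar>div_field x\<bar>"
      using leray_integrand_bound[OF e, of x] by linarith
  next
    show "AE x in torus_measure. norm (indicator {x. \<bar>f x\<bar> < \<epsilon>} x / (2 * \<epsilon>) * ((f x)\<^sup>2 / jet x)
            - truncated_step \<epsilon> (f x) * div_field x) \<le> norm (\<bar>f x\<bar> / jet x + \<bar>div_field x\<bar>)"
      unfolding real_norm_def
      by (intro AE_I2 order_trans[OF leray_integrand_bound[OF e] abs_ge_self])
  qed measurable
qed

text \<open>The integrand converges at every point. Where f is nonzero the indicator vanishes for
  small \<epsilon> and the step equals sgn(f)/2; where f is zero both terms are zero for every
  \<epsilon>, so the nodal set need not be known to be null.\<close>

lemma leray_quotient_tendsto: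
  "(leray_quotient f \<longlongrightarrow> - (\<integral>x. sgn (f x) / 2 * div_field x \<partial>torus_measure)) (at_right 0)"
proof (rule tendsto_at_right_sequentially[OF zero_less_one])
  fix S :: "nat \<Rightarrow> real"
  assume S: "\<And>n. 0 < S n" "S \<longlonglongrightarrow> 0"
  have [measurable]: "truncated_step \<epsilon> \<in> borel_measurable borel" for \<epsilon>
    unfolding truncated_step_def[abs_def] by measurable
  have "(\<lambda>n. (\<integral>x. indicator {x. \<bar>f x\<bar> < S n} x / (2 * S n) * ((f x)\<^sup>2 / jet x)
            - truncated_step (S n) (f x) * div_field x \<partial>torus_measure))
     \<longlonglongrightarrow> (\<integral>x. - (sgn (f x) / 2 * div_field x) \<partial>torus_measure)"
  proof (rule integral_dominated_convergence[OF _ _ dominator_integrable])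
    show "AE x in torus_measure. (\<lambda>n. indicator {x. \<bar>f x\<bar> < S n} x / (2 * S n) * ((f x)\<^sup>2 / jet x)
            - truncated_step (S n) (f x) * div_field x) \<longlonglongrightarrow> - (sgn (f x) / 2 * div_field x)"
    proof (rule AE_I2)
      fix x
      show "(\<lambda>n. indicator {x. \<bar>f x\<bar> < S n} x / (2 * S n) * ((f x)\<^sup>2 / jet x)
            - truncated_step (S n) (f x) * div_field x) \<longlonglongrightarrow> - (sgn (f x) / 2 * div_field x)"
      proof (cases "f x = 0")
        case True
        then show ?thesis by (simp add: truncated_step_def)
      next
        case False
        then have "eventually (\<lambda>n. S n < \<bar>f x\<bar>) sequentially"
          using order_tendstoD(2)[OF S(2)] by simp
        then have "eventually (\<lambda>n. indicator {x. \<bar>f x\<bar> < S n} x / (2 * S n) * ((f x)\<^sup>2 / jet x)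
            - truncated_step (S n) (f x) * div_field x = - (sgn (f x) / 2 * div_field x)) sequentially"
          by eventually_elim (simp add: truncated_step_eq_sgn S(1) less_imp_le)
        then show ?thesis by (rule tendsto_eventually)
      qed
    qed
    show "AE x in torus_measure. norm (indicator {x. \<bar>f x\<bar> < S n} x / (2 * S n) * ((f x)\<^sup>2 / jet x)
            - truncated_step (S n) (f x) * div_field x) \<le> \<bar>f x\<bar> / jet x + \<bar>div_field x\<bar>" for n
      using leray_integrand_bound[OF S(1)] by (intro AE_I2) (simp only: real_norm_def)
  qed measurable
  then show "(\<lambda>n. leray_quotient f (S n)) \<longlonglongrightarrow> - (\<integral>x. sgn (f x) / 2 * div_field x \<partial>torus_measure)"
    by (simp add: leray_quotient_eq[OF S(1)])
qed

text \<open>A product of two first derivatives is at most \<open>jet\<close>, which cancels one of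
  the two powers in the denominator. Per index the term f2/jet costs at most d and the quotient rule
  2 + 2d, at most 4d; summing 5d over d indices gives the constant, and the 1 comes from
  |f|/jet.\<close>

lemma abs_div_field_le:
  assumes bd: "\<And>x. \<bar>f x\<bar> \<le> A" "\<And>x i j. \<bar>f2 i j x\<bar> \<le> A"
  shows "\<bar>f x\<bar> / jet x + \<bar>div_field x\<bar> \<le> (1 + 5 * real CARD('n) ^ 2) * A / jet x"
proof -
  let ?d = "real CARD('n)"
  have A: "A \<ge> 0" using bd(1)[of x] by linarith
  have d1: "?d \<ge> 1" using zero_less_card_finite[where 'a = 'n] by linarith
  have jp: "jet x > 0" by (rule pos)
  have f1le: "(f1 i x)\<^sup>2 \<le> jet x" for i
    unfolding jet_def using member_le_sum[of i UNIV "\<lambda>i. (f1 i x)\<^sup>2"] by (simp add: add_increasing)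
  have ff: "\<bar>f1 i x\<bar> * \<bar>f1 j x\<bar> \<le> jet x" for i j
  proof -
    have "2 * (\<bar>f1 i x\<bar> * \<bar>f1 j x\<bar>) \<le> (f1 i x)\<^sup>2 + (f1 j x)\<^sup>2"
      using sum_squares_bound[of "\<bar>f1 i x\<bar>" "\<bar>f1 j x\<bar>"] by simp
    with f1le[of i] f1le[of j] show ?thesis by linarith
  qed
  have part: "\<bar>div_part i x\<bar> \<le> 5 * ?d * A / jet x" for i
  proof -
    have e1: "\<bar>f1 i x * (2 * f x * f1 i x)\<bar> \<le> 2 * A * jet x"
    proof -
      have "\<bar>f1 i x * (2 * f x * f1 i x)\<bar> = 2 * (\<bar>f x\<bar> * (\<bar>f1 i x\<bar> * \<bar>f1 i x\<bar>))"
        by (simp add: abs_mult)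
      also have "\<dots> \<le> 2 * (A * jet x)"
        by (intro mult_left_mono mult_mono) (use bd(1) ff[of i i] A in auto)
      finally show ?thesis by simp
    qed
    have e2: "\<bar>f1 i x * (f1 j x * f2 j i x)\<bar> \<le> A * jet x" for j
    proof -
      have "\<bar>f1 i x * (f1 j x * f2 j i x)\<bar> = \<bar>f2 j i x\<bar> * (\<bar>f1 i x\<bar> * \<bar>f1 j x\<bar>)"
        by (simp add: abs_mult)
      also have "\<dots> \<le> A * jet x"
        by (intro mult_mono) (use bd(2) ff[of i j] A in auto)
      finally show ?thesis .
    qed
    have e3: "\<bar>\<Sum>j\<in>UNIV. f1 i x * (f1 j x * f2 j i x)\<bar> \<le> ?d * (A * jet x)"
      using sum_norm_bound[of "UNIV :: 'n set" "\<lambda>j. f1 i x * (f1 j x * f2 j i x)"] e2 by simp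
    have "\<bar>f1 i x * (2 * f x * f1 i x + 2 * (\<Sum>j\<in>UNIV. f1 j x * f2 j i x))\<bar>
        \<le> 2 * A * jet x + 2 * (?d * (A * jet x))"
      using e1 e3 by (simp add: distrib_left sum_distrib_left[symmetric] mult.left_commute[of _ 2])
    also have "\<dots> \<le> 4 * ?d * A * jet x"
      using mult_right_mono[OF d1, of "A * jet x"] A jp by (simp add: mult_ac)
    finally have "\<bar>f1 i x * (2 * f x * f1 i x + 2 * (\<Sum>j\<in>UNIV. f1 j x * f2 j i x))\<bar> / (jet x)\<^sup>2
        \<le> 4 * ?d * A * jet x / (jet x)\<^sup>2"
      by (rule divide_right_mono) simp
    also have "\<dots> = 4 * ?d * A / jet x" using jp by (simp add: power2_eq_square)
    finally have "\<bar>f1 i x * (2 * f x * f1 i x + 2 * (\<Sum>j\<in>UNIV. f1 j x * f2 j i x)) / (jet x)\<^sup>2\<bar>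
        \<le> 4 * ?d * A / jet x" by simp
    moreover have "\<bar>f2 i i x / jet x\<bar> \<le> ?d * A / jet x"
      using bd(2)[of i i x] mult_right_mono[OF d1 A] jp by (simp add: abs_divide divide_right_mono)
    ultimately have "\<bar>div_part i x\<bar> \<le> ?d * A / jet x + 4 * ?d * A / jet x"
      unfolding div_part_def by (intro order_trans[OF abs_triangle_ineq4] add_mono)
    then show ?thesis by (simp add: add_divide_distrib[symmetric] mult_ac)
  qed
  have "\<bar>div_field x\<bar> \<le> ?d * (5 * ?d * A / jet x)"
    unfolding div_field_def
    using sum_norm_bound[of "UNIV :: 'n set" "\<lambda>i. div_part i x", OF part[folded real_norm_def]]
    by simp
  moreover have "\<bar>f x\<bar> / jet x \<le> A / jet x"
    using bd(1)[of x] jp by (simp add: divide_right_mono)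
  ultimately have "\<bar>f x\<bar> / jet x + \<bar>div_field x\<bar> \<le> A / jet x + ?d * (5 * ?d * A / jet x)"
    by linarith
  also have "\<dots> = (1 + 5 * ?d ^ 2) * A / jet x"
    using jp by (simp add: field_simps power2_eq_square)
  finally show ?thesis .
qed

end

end

section \<open>Rotation invariance of product Gaussians\<close>

abbreviation std_normal :: "real measure" where
  "std_normal \<equiv> density lborel (\<lambda>x. ennreal (std_normal_density x))"

lemma prob_space_std_normal: "prob_space std_normal"
  by (rule prob_space_normal_density) simp

text \<open>For nonzero \<open>C\<close> the rotation is a composition of two one-dimensional affine
  substitutions, first in \<open>y\<close> and, after Fubini, in \<open>z\<close>; their Jacobians
  1/|C| and |C| cancel. For \<open>C = 0\<close> it exchanges the coordinates up to sign.\<close>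

lemma nn_integral_rotate_lborel:
  fixes G :: "real \<Rightarrow> real \<Rightarrow> ennreal"
  assumes [measurable]: "case_prod G \<in> borel_measurable (borel \<Otimes>\<^sub>M borel)" and CS: "C\<^sup>2 + S\<^sup>2 = 1"
  shows "(\<integral>\<^sup>+z. \<integral>\<^sup>+y. G (y * C - z * S) (y * S + z * C) \<partial>lborel \<partial>lborel)
       = (\<integral>\<^sup>+z. \<integral>\<^sup>+y. G y z \<partial>lborel \<partial>lborel)"
proof (cases "C = 0")
  case False
  have e: "(d * S / C + 1 / C * y) * C - d * S = y"
    "(d * S / C + 1 / C * y) * S + d * C = y * S / C + 1 / C * d" for d y
  proof -
    show "(d * S / C + 1 / C * y) * C - d * S = y" using False by (simp add: field_simps)
    have "(d * S / C + 1 / C * y) * S + d * C = y * S / C + d * (C\<^sup>2 + S\<^sup>2) / C"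
      using False by (simp add: field_simps power2_eq_square)
    then show "(d * S / C + 1 / C * y) * S + d * C = y * S / C + 1 / C * d" by (simp add: CS)
  qed
  have "(\<integral>\<^sup>+z. \<integral>\<^sup>+y. G (y * C - z * S) (y * S + z * C) \<partial>lborel \<partial>lborel)
      = (\<integral>\<^sup>+z. ennreal \<bar>1 / C\<bar> * (\<integral>\<^sup>+y. G y (y * S / C + 1 / C * z) \<partial>lborel) \<partial>lborel)"
  proof (rule nn_integral_cong)
    fix z
    show "(\<integral>\<^sup>+y. G (y * C - z * S) (y * S + z * C) \<partial>lborel)
        = ennreal \<bar>1 / C\<bar> * (\<integral>\<^sup>+y. G y (y * S / C + 1 / C * z) \<partial>lborel)"
      using nn_integral_real_affine[of "\<lambda>y. G (y * C - z * S) (y * S + z * C)" "1 / C" "z * S / C"] False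
      unfolding e by simp
  qed
  also have "\<dots> = ennreal \<bar>1 / C\<bar> * (\<integral>\<^sup>+z. \<integral>\<^sup>+y. G y (y * S / C + 1 / C * z) \<partial>lborel \<partial>lborel)"
    by (rule nn_integral_cmult) measurable
  also have "(\<integral>\<^sup>+z. \<integral>\<^sup>+y. G y (y * S / C + 1 / C * z) \<partial>lborel \<partial>lborel)
      = (\<integral>\<^sup>+y. \<integral>\<^sup>+z. G y (y * S / C + 1 / C * z) \<partial>lborel \<partial>lborel)"
    by (rule lborel_pair.Fubini') measurable
  also have "ennreal \<bar>1 / C\<bar> * \<dots> = (\<integral>\<^sup>+y. ennreal \<bar>1 / C\<bar> * (\<integral>\<^sup>+z. G y (y * S / C + 1 / C * z) \<partial>lborel) \<partial>lborel)"
    by (rule nn_integral_cmult[symmetric]) measurable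
  also have "\<dots> = (\<integral>\<^sup>+y. \<integral>\<^sup>+z. G y z \<partial>lborel \<partial>lborel)"
    using False by (intro nn_integral_cong nn_integral_real_affine[symmetric]) auto
  also have "\<dots> = (\<integral>\<^sup>+z. \<integral>\<^sup>+y. G y z \<partial>lborel \<partial>lborel)"
    by (rule lborel_pair.Fubini') measurable
  finally show ?thesis .
next
  case True
  then have S: "\<bar>S\<bar> = 1" using CS by (auto simp: power2_eq_1_iff)
  then have S0: "S \<noteq> 0" by auto
  have "(\<integral>\<^sup>+z. \<integral>\<^sup>+y. G (y * C - z * S) (y * S + z * C) \<partial>lborel \<partial>lborel)
      = (\<integral>\<^sup>+z. \<integral>\<^sup>+y. G (- S * z) (S * y) \<partial>lborel \<partial>lborel)"
    by (simp add: True mult.commute)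
  also have "\<dots> = (\<integral>\<^sup>+z. \<integral>\<^sup>+y. G (- S * z) y \<partial>lborel \<partial>lborel)"
  proof (rule nn_integral_cong)
    fix z
    show "(\<integral>\<^sup>+y. G (- S * z) (S * y) \<partial>lborel) = (\<integral>\<^sup>+y. G (- S * z) y \<partial>lborel)"
      using nn_integral_real_affine[of "G (- S * z)" S 0] S S0 by simp
  qed
  also have "\<dots> = (\<integral>\<^sup>+y. \<integral>\<^sup>+z. G (- S * z) y \<partial>lborel \<partial>lborel)"
    by (rule lborel_pair.Fubini') measurable
  also have "\<dots> = (\<integral>\<^sup>+y. \<integral>\<^sup>+z. G z y \<partial>lborel \<partial>lborel)"
  proof (rule nn_integral_cong)
    fix y
    show "(\<integral>\<^sup>+z. G (- S * z) y \<partial>lborel) = (\<integral>\<^sup>+z. G z y \<partial>lborel)"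
      using nn_integral_real_affine[of "\<lambda>z. G z y" "- S" 0] S S0 by simp
  qed
  finally show ?thesis .
qed

text \<open>The product of the two densities depends on y^2 + z^2 only, which the rotation
  preserves.\<close>

lemma nn_integral_rotate:
  fixes F :: "real \<Rightarrow> real \<Rightarrow> ennreal"
  assumes [measurable]: "case_prod F \<in> borel_measurable (borel \<Otimes>\<^sub>M borel)" and CS: "C\<^sup>2 + S\<^sup>2 = 1"
  shows "(\<integral>\<^sup>+z. \<integral>\<^sup>+y. F (y * C - z * S) (y * S + z * C) \<partial>std_normal \<partial>std_normal)
       = (\<integral>\<^sup>+z. \<integral>\<^sup>+y. F y z \<partial>std_normal \<partial>std_normal)"
proof -
  let ?p = "\<lambda>y z. ennreal (std_normal_density z) * (ennreal (std_normal_density y))"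
  have dens: "(\<integral>\<^sup>+z. \<integral>\<^sup>+y. H y z \<partial>std_normal \<partial>std_normal)
      = (\<integral>\<^sup>+z. \<integral>\<^sup>+y. ?p y z * H y z \<partial>lborel \<partial>lborel)"
    if [measurable]: "case_prod H \<in> borel_measurable (borel \<Otimes>\<^sub>M borel)" for H :: "real \<Rightarrow> real \<Rightarrow> ennreal"
    by (simp add: nn_integral_density nn_integral_cmult mult.assoc)
  have inv: "?p (y * C - z * S) (y * S + z * C) = ?p y z" for y z
  proof -
    have "(y * C - z * S)\<^sup>2 + (y * S + z * C)\<^sup>2 = (y\<^sup>2 + z\<^sup>2) * (C\<^sup>2 + S\<^sup>2)"
      by (simp add: power2_eq_square algebra_simps)
    then have "exp (- (y * S + z * C)\<^sup>2 / 2) * exp (- (y * C - z * S)\<^sup>2 / 2)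
        = exp (- z\<^sup>2 / 2) * exp (- y\<^sup>2 / 2)"
      unfolding exp_add[symmetric] CS by (simp add: field_simps)
    then show ?thesis
      by (simp add: ennreal_mult[symmetric] std_normal_density_def)
  qed
  have "(\<integral>\<^sup>+z. \<integral>\<^sup>+y. F (y * C - z * S) (y * S + z * C) \<partial>std_normal \<partial>std_normal)
      = (\<integral>\<^sup>+z. \<integral>\<^sup>+y. ?p (y * C - z * S) (y * S + z * C) * F (y * C - z * S) (y * S + z * C) \<partial>lborel \<partial>lborel)"
    unfolding inv by (rule dens) measurable
  also have "\<dots> = (\<integral>\<^sup>+z. \<integral>\<^sup>+y. ?p y z * F y z \<partial>lborel \<partial>lborel)"
    by (rule nn_integral_rotate_lborel[where G = "\<lambda>y z. ?p y z * F y z", OF _ CS]) measurable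
  also have "\<dots> = (\<integral>\<^sup>+z. \<integral>\<^sup>+y. F y z \<partial>std_normal \<partial>std_normal)"
    by (rule dens[symmetric]) measurable
  finally show ?thesis .
qed

abbreviation gauss_space :: "'i set \<Rightarrow> ('i \<Rightarrow> real) measure" where
  "gauss_space I \<equiv> PiM I (\<lambda>_. std_normal)"

lemma sets_gauss_space [measurable_cong]: "sets (gauss_space I) = sets (PiM I (\<lambda>_. borel))"
  by (rule sets_PiM_cong) auto

interpretation std_normal_product: product_prob_space "\<lambda>_. std_normal" I for I
  by (intro product_prob_spaceI prob_space_std_normal)

text \<open>\<open>U\<close> lists the pairs that are turned, so that pairs can be treated one by
  one. With \<open>U = R\<close> and the angle of \<open>v\<close> equal to 2 pi times its inner
  product with x, this passes from the coefficients at 0 to those of the wave recentred at x.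
  Restriction keeps the result in the product space.\<close>

definition rotate_pairs ::
  "'v set \<Rightarrow> ('v \<Rightarrow> real) \<Rightarrow> 'v set \<Rightarrow> ('v + 'v \<Rightarrow> real) \<Rightarrow> 'v + 'v \<Rightarrow> real" where
  "rotate_pairs R \<theta> U g = (\<lambda>i\<in>R <+> R. case i of
       Inl v \<Rightarrow> if v \<in> U then g (Inl v) * cos (\<theta> v) - g (Inr v) * sin (\<theta> v) else g (Inl v)
     | Inr v \<Rightarrow> if v \<in> U then g (Inl v) * sin (\<theta> v) + g (Inr v) * cos (\<theta> v) else g (Inr v))"

lemma rotate_pairs_measurable [measurable]:
  "rotate_pairs R \<theta> U \<in> PiM (R <+> R) (\<lambda>_. borel) \<rightarrow>\<^sub>M PiM (R <+> R) (\<lambda>_. borel)"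
  unfolding rotate_pairs_def[abs_def]
proof (rule measurable_restrict)
  fix i assume i: "i \<in> R <+> R"
  have c: "(\<lambda>g. g (Inl v)) \<in> borel_measurable (PiM (R <+> R) (\<lambda>_. borel :: real measure))"
      "(\<lambda>g. g (Inr v)) \<in> borel_measurable (PiM (R <+> R) (\<lambda>_. borel :: real measure))" if "v \<in> R" for v
    using that by (auto intro!: measurable_component_singleton)
  have "(\<lambda>g. if v \<in> U then g (Inl v) * cos (\<theta> v) - g (Inr v) * sin (\<theta> v) else g (Inl v))
        \<in> borel_measurable (PiM (R <+> R) (\<lambda>_. borel))"
       "(\<lambda>g. if v \<in> U then g (Inl v) * sin (\<theta> v) + g (Inr v) * cos (\<theta> v) else g (Inr v))
        \<in> borel_measurable (PiM (R <+> R) (\<lambda>_. borel))" if "v \<in> R" for v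
    using c[OF that] by (cases "v \<in> U"; auto)+
  with i show "(\<lambda>g. case i of
       Inl v \<Rightarrow> if v \<in> U then g (Inl v) * cos (\<theta> v) - g (Inr v) * sin (\<theta> v) else g (Inl v)
     | Inr v \<Rightarrow> if v \<in> U then g (Inl v) * sin (\<theta> v) + g (Inr v) * cos (\<theta> v) else g (Inr v))
     \<in> borel_measurable (PiM (R <+> R) (\<lambda>_. borel))"
    by (cases i) auto
qed

text \<open>With all other coordinates frozen, the pair of \<open>v\<close> is integrated innermost,
  where the planar rotation invariance applies.\<close>

lemma nn_integral_rotate_single:
  assumes "finite R" "v \<in> R" and F: "F \<in> borel_measurable (PiM (R <+> R) (\<lambda>_. borel))"
  shows "(\<integral>\<^sup>+g. F (rotate_pairs R \<theta> {v} g) \<partial>gauss_space (R <+> R)) = (\<integral>\<^sup>+g. F g \<partial>gauss_space (R <+> R))"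
proof -
  define J where "J = (R <+> R) - {Inl v, Inr v}"
  have I: "R <+> R = insert (Inl v) (insert (Inr v) J)" and nJ: "Inl v \<notin> J" "Inr v \<notin> J"
    using assms(2) by (auto simp: J_def)
  have fJ: "finite J" using assms(1) by (simp add: J_def)
  have two: "(\<integral>\<^sup>+g. H g \<partial>gauss_space (R <+> R))
      = (\<integral>\<^sup>+x. \<integral>\<^sup>+z. \<integral>\<^sup>+y. H (x(Inr v := z, Inl v := y)) \<partial>std_normal \<partial>std_normal \<partial>gauss_space J)"
    if H: "H \<in> borel_measurable (PiM (R <+> R) (\<lambda>_. borel))" for H :: "_ \<Rightarrow> ennreal"
  proof -
    have H': "H \<in> borel_measurable (gauss_space (insert (Inl v) (insert (Inr v) J)))"
      using H unfolding I by (subst measurable_cong_sets[OF sets_gauss_space refl]) 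
    have m: "(\<lambda>x. \<integral>\<^sup>+y. H (x(Inl v := y)) \<partial>std_normal) \<in> borel_measurable (gauss_space (insert (Inr v) J))"
      by (rule sigma_finite_measure.borel_measurable_nn_integral
            [OF prob_space_imp_sigma_finite[OF prob_space_std_normal]])
         (use measurable_comp[OF measurable_add_dim H'] in \<open>simp add: case_prod_beta' o_def\<close>)
    show ?thesis
      unfolding I
      by (subst std_normal_product.product_nn_integral_insert[OF _ _ H'])
         (use fJ nJ in \<open>auto simp: std_normal_product.product_nn_integral_insert[OF fJ nJ(2) m]\<close>)
  qed
  \<comment> \<open>Equality of functions includes indices outside \<open>R <+> R\<close>: there the
    restriction returns \<open>undefined\<close>, and so does \<open>x\<close>, being a point of the
    product over \<open>J\<close>.\<close>
  have upd: "rotate_pairs R \<theta> {v} (x(Inr v := z, Inl v := y))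
      = x(Inr v := y * sin (\<theta> v) + z * cos (\<theta> v), Inl v := y * cos (\<theta> v) - z * sin (\<theta> v))"
    if x: "x \<in> space (gauss_space J)" for x y z
  proof
    fix i
    have out: "x i = undefined" if "i \<notin> J"
      using x that by (auto simp: space_PiM PiE_def extensional_def)
    show "rotate_pairs R \<theta> {v} (x(Inr v := z, Inl v := y)) i
      = (x(Inr v := y * sin (\<theta> v) + z * cos (\<theta> v), Inl v := y * cos (\<theta> v) - z * sin (\<theta> v))) i"
      using out assms(2) by (cases i) (auto simp: rotate_pairs_def J_def)
  qed
  have "(\<integral>\<^sup>+g. F (rotate_pairs R \<theta> {v} g) \<partial>gauss_space (R <+> R))
      = (\<integral>\<^sup>+x. \<integral>\<^sup>+z. \<integral>\<^sup>+y. F (rotate_pairs R \<theta> {v} (x(Inr v := z, Inl v := y)))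
            \<partial>std_normal \<partial>std_normal \<partial>gauss_space J)"
    by (rule two) (use F in measurable)
  also have "\<dots> = (\<integral>\<^sup>+x. \<integral>\<^sup>+z. \<integral>\<^sup>+y. F (x(Inr v := y * sin (\<theta> v) + z * cos (\<theta> v),
        Inl v := y * cos (\<theta> v) - z * sin (\<theta> v))) \<partial>std_normal \<partial>std_normal \<partial>gauss_space J)"
    by (rule nn_integral_cong) (simp add: upd)
  also have "\<dots> = (\<integral>\<^sup>+x. \<integral>\<^sup>+z. \<integral>\<^sup>+y. F (x(Inr v := z, Inl v := y)) \<partial>std_normal \<partial>std_normal \<partial>gauss_space J)"
  proof (rule nn_integral_cong)
    fix x assume x: "x \<in> space (gauss_space J)"
    have m: "(\<lambda>(y, z). F (x(Inr v := z, Inl v := y))) \<in> borel_measurable (borel \<Otimes>\<^sub>M borel)"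
    proof -
      have "(\<lambda>p. x(Inr v := snd p, Inl v := fst p)) \<in> borel \<Otimes>\<^sub>M borel \<rightarrow>\<^sub>M PiM (R <+> R) (\<lambda>_. borel)"
      proof (rule measurable_PiM_single')
        show "(\<lambda>p. x(Inr v := snd p, Inl v := fst p)) \<in> space (borel \<Otimes>\<^sub>M borel) \<rightarrow> (R <+> R) \<rightarrow>\<^sub>E space borel"
          using x I by (auto simp: space_PiM PiE_def extensional_def)
        show "(\<lambda>p. (x(Inr v := snd p, Inl v := fst p)) i) \<in> borel_measurable (borel \<Otimes>\<^sub>M borel)" for i
          by (cases "i = Inl v"; cases "i = Inr v") auto
      qed
      from measurable_comp[OF this F] show ?thesis by (simp add: o_def case_prod_beta')
    qed
    show "(\<integral>\<^sup>+z. \<integral>\<^sup>+y. F (x(Inr v := y * sin (\<theta> v) + z * cos (\<theta> v),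
        Inl v := y * cos (\<theta> v) - z * sin (\<theta> v))) \<partial>std_normal \<partial>std_normal)
        = (\<integral>\<^sup>+z. \<integral>\<^sup>+y. F (x(Inr v := z, Inl v := y)) \<partial>std_normal \<partial>std_normal)"
      using nn_integral_rotate[OF m, of "cos (\<theta> v)" "sin (\<theta> v)"] by simp
  qed
  also have "\<dots> = (\<integral>\<^sup>+g. F g \<partial>gauss_space (R <+> R))"
    by (rule two[symmetric, OF F])
  finally show ?thesis .
qed

text \<open>Turning \<open>insert v U\<close> is turning \<open>U\<close> and then \<open>v\<close>.
  The integrand has to vary in the induction, because the hypothesis is used for \<open>F\<close>
  composed with the rotation of \<open>v\<close>.\<close>

lemma nn_integral_rotate_pairs:
  assumes "finite R" "U \<subseteq> R" and F: "F \<in> borel_measurable (PiM (R <+> R) (\<lambda>_. borel))"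
  shows "(\<integral>\<^sup>+g. F (rotate_pairs R \<theta> U g) \<partial>gauss_space (R <+> R)) = (\<integral>\<^sup>+g. F g \<partial>gauss_space (R <+> R))"
proof -
  have "finite U" using assms finite_subset by blast
  then show ?thesis using assms(2,3)
  proof (induction U arbitrary: F rule: finite_induct)
    case empty
    have "rotate_pairs R \<theta> {} g = g" if "g \<in> space (gauss_space (R <+> R))" for g
    proof -
      have "rotate_pairs R \<theta> {} g = restrict g (R <+> R)"
        by (rule ext) (auto simp: rotate_pairs_def restrict_def split: sum.splits)
      with that show ?thesis by (simp add: space_PiM PiE_def extensional_restrict)
    qed
    then show ?case by (intro nn_integral_cong) simp
  next
    case (insert v U)
    have comp: "rotate_pairs R \<theta> (insert v U) g = rotate_pairs R \<theta> {v} (rotate_pairs R \<theta> U g)" for g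
      using insert by (intro ext) (auto simp: rotate_pairs_def restrict_def split: sum.splits)
    have "(\<integral>\<^sup>+g. F (rotate_pairs R \<theta> (insert v U) g) \<partial>gauss_space (R <+> R))
        = (\<integral>\<^sup>+g. F (rotate_pairs R \<theta> {v} g) \<partial>gauss_space (R <+> R))"
      unfolding comp
      by (rule insert.IH[where F = "\<lambda>g. F (rotate_pairs R \<theta> {v} g)"]) (use insert.prems in auto)
    also have "\<dots> = (\<integral>\<^sup>+g. F g \<partial>gauss_space (R <+> R))"
      by (rule nn_integral_rotate_single) (use insert.prems assms in auto)
    finally show ?case .
  qed
qed

section \<open>Negative moments and frequency bases\<close>

text \<open>Taking the inverse in \<open>ennreal\<close> gives the value \<open>\<infinity>\<close> at \<open>0\<close>, where \<open>0 powr - \<alpha>\<close> would be \<open>0\<close>.\<close>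

definition singular_weight :: "real \<Rightarrow> real \<Rightarrow> ennreal" where
  "singular_weight \<alpha> t = inverse (ennreal (\<bar>t\<bar> powr \<alpha>))"

lemma singular_weight_measurable [measurable]: "singular_weight \<alpha> \<in> borel_measurable borel"
  unfolding singular_weight_def[abs_def] by measurable

lemma singular_weight_nonzero: "t \<noteq> 0 \<Longrightarrow> singular_weight \<alpha> t = ennreal (\<bar>t\<bar> powr - \<alpha>)"
  by (simp add: singular_weight_def inverse_ennreal powr_minus)

lemma singular_weight_antimono:
  assumes "\<alpha> > 0" "\<bar>s\<bar> \<le> \<bar>t\<bar>"
  shows "singular_weight \<alpha> t \<le> singular_weight \<alpha> s"
proof (cases "s = 0")
  case True
  then show ?thesis by (simp add: singular_weight_def)
next
  case False
  with assms have "t \<noteq> 0" by auto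
  with False assms show ?thesis
    by (simp add: singular_weight_nonzero) (intro ennreal_leI powr_mono2'; simp)
qed

lemma nn_integral_powr_near_0:
  assumes "0 < \<alpha>" "\<alpha> < 1"
  shows "(\<integral>\<^sup>+s. ennreal (\<bar>s\<bar> powr - \<alpha>) * indicator {-1..1} s \<partial>lborel) < \<infinity>"
proof -
  let ?g = "\<lambda>s. ennreal (indicator {0..1} s * s powr - \<alpha>)"
  have "((\<lambda>s. s powr - \<alpha>) has_integral (1 powr (- \<alpha> + 1) / (- \<alpha> + 1))) {0..1}"
    by (rule has_integral_powr_from_0) (use assms in auto)
  then have "((\<lambda>s. indicator {0..1} s * s powr - \<alpha>) has_integral (1 / (1 - \<alpha>))) UNIV"
    by (subst (asm) has_integral_restrict_UNIV[symmetric])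
       (simp add: indicator_def of_bool_def if_distrib[of "\<lambda>x. x * _"] cong: if_cong)
  then have g: "integral\<^sup>N lborel ?g = ennreal (1 / (1 - \<alpha>))"
    by (intro nn_integral_has_integral_lborel) auto
  have g': "(\<integral>\<^sup>+s. ?g (- s) \<partial>lborel) = integral\<^sup>N lborel ?g"
    using nn_integral_real_affine[of ?g "-1" 0] by simp
  have "(\<integral>\<^sup>+s. ennreal (\<bar>s\<bar> powr - \<alpha>) * indicator {-1..1} s \<partial>lborel)
      \<le> (\<integral>\<^sup>+s. ?g s + ?g (- s) \<partial>lborel)"
    by (intro nn_integral_mono) (auto simp: indicator_def)
  also have "\<dots> = ennreal (1 / (1 - \<alpha>)) + ennreal (1 / (1 - \<alpha>))"
    by (subst nn_integral_add) (auto simp: g g')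
  also have "\<dots> < \<infinity>" by simp
  finally show ?thesis .
qed

lemma std_normal_density_le_1: "std_normal_density x \<le> 1"
proof -
  have "exp (- x\<^sup>2 / 2) \<le> 1" by simp
  moreover have "1 \<le> sqrt (2 * pi)"
    using pi_ge_two by simp
  ultimately have "exp (- x\<^sup>2 / 2) / sqrt (2 * pi) \<le> 1"
    by (subst divide_le_eq_1_pos) linarith+
  then show ?thesis
    unfolding std_normal_density_def by simp
qed

text \<open>Where |t + h| is at most 1 the density is at most 1 and the weight has a translation
  invariant integral; elsewhere the weight is at most its constant factor and the density has mass
  1. What matters is that \<open>K\<close> does not depend on the shift, since the shift will be a
  function of other coordinates.\<close>

lemma singular_weight_std_normal_bound:
  assumes a: "0 < \<alpha>" "\<alpha> < 1" and c: "0 < c"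
  obtains K where "K < \<infinity>" "\<And>h. (\<integral>\<^sup>+t. singular_weight \<alpha> (c * (t + h)) \<partial>std_normal) \<le> K"
proof
  let ?A = "ennreal (c powr - \<alpha>)"
  let ?I = "\<integral>\<^sup>+s. ennreal (\<bar>s\<bar> powr - \<alpha>) * indicator {-1..1} s \<partial>lborel"
  show "?A * (?I + 1) < \<infinity>"
    using nn_integral_powr_near_0[OF a] by (simp add: ennreal_mult_less_top less_top)
  fix h
  let ?u = "\<lambda>t. ennreal (\<bar>h + 1 * t\<bar> powr - \<alpha>) * indicator {-1..1} (h + 1 * t)"
  have "(\<integral>\<^sup>+t. singular_weight \<alpha> (c * (t + h)) \<partial>std_normal)
      = (\<integral>\<^sup>+t. ennreal (std_normal_density t) * singular_weight \<alpha> (c * (t + h)) \<partial>lborel)"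
    by (rule nn_integral_density) auto
  also have "\<dots> \<le> (\<integral>\<^sup>+t. ?A * (?u t + ennreal (std_normal_density t)) \<partial>lborel)"
  proof (rule nn_integral_mono_AE)
    \<comment> \<open>At \<open>t = - h\<close> the left side is infinite while
      \<open>0 powr - \<alpha>\<close> is 0, so the inequality holds only off this null
      point.\<close>
    have "AE t in lborel. t \<noteq> - h" by (rule AE_lborel_singleton)
    then show "AE t in lborel. ennreal (std_normal_density t) * singular_weight \<alpha> (c * (t + h))
        \<le> ?A * (?u t + ennreal (std_normal_density t))"
    proof eventually_elim
      case (elim t)
      then have nz: "t + h \<noteq> 0" by auto
      have w: "singular_weight \<alpha> (c * (t + h)) = ?A * ennreal (\<bar>t + h\<bar> powr - \<alpha>)"
        using c nz by (simp add: singular_weight_nonzero abs_mult powr_mult ennreal_mult)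
      have "ennreal (std_normal_density t) * ennreal (\<bar>t + h\<bar> powr - \<alpha>)
          \<le> ?u t + ennreal (std_normal_density t)"
      proof (cases "\<bar>t + h\<bar> \<le> 1")
        case True
        then have "?u t = ennreal (\<bar>t + h\<bar> powr - \<alpha>)"
          by (auto simp: indicator_def abs_le_iff add.commute)
        moreover have "ennreal (std_normal_density t) * ennreal (\<bar>t + h\<bar> powr - \<alpha>)
            \<le> 1 * ennreal (\<bar>t + h\<bar> powr - \<alpha>)"
          by (rule mult_right_mono) (use std_normal_density_le_1[of t] in \<open>auto simp: ennreal_le_1\<close>)
        ultimately show ?thesis by (simp add: add_increasing2)
      next
        case False
        then have "\<bar>t + h\<bar> powr - \<alpha> \<le> 1"
          using powr_mono[of "- \<alpha>" 0 "\<bar>t + h\<bar>"] a by (auto split: if_splits)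
        then have "ennreal (std_normal_density t) * ennreal (\<bar>t + h\<bar> powr - \<alpha>)
            \<le> ennreal (std_normal_density t) * 1"
          by (intro mult_left_mono) (auto simp: ennreal_le_1)
        then show ?thesis by (simp add: add_increasing)
      qed
      then show ?case
        unfolding w mult.left_commute[of _ ?A] by (rule mult_left_mono) simp
    qed
  qed
  also have "\<dots> = ?A * ((\<integral>\<^sup>+t. ?u t \<partial>lborel) + (\<integral>\<^sup>+t. ennreal (std_normal_density t) \<partial>lborel))"
    by (simp add: nn_integral_cmult nn_integral_add)
  also have "(\<integral>\<^sup>+t. ?u t \<partial>lborel) = ?I"
    using nn_integral_real_affine[of "\<lambda>s. ennreal (\<bar>s\<bar> powr - \<alpha>) * indicator {-1..1} s" 1 h] by simp
  also have "(\<integral>\<^sup>+t. ennreal (std_normal_density t) \<partial>lborel) = 1"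
    using prob_space.emeasure_space_1[OF prob_space_std_normal] by (simp add: emeasure_density)
  finally show "(\<integral>\<^sup>+t. singular_weight \<alpha> (c * (t + h)) \<partial>std_normal) \<le> ?A * (?I + 1)" .
qed

text \<open>Each shift \<open>h j\<close> depends only on the coordinates outside \<open>P\<close>; conditionally on these the factors are independent.\<close>

lemma nn_integral_prod_pivot:
  fixes \<rho> :: "real \<Rightarrow> ennreal" and h :: "'i \<Rightarrow> ('i \<Rightarrow> real) \<Rightarrow> real"
  assumes \<rho>[measurable]: "\<rho> \<in> borel_measurable borel"
    and bound: "\<And>s. (\<integral>\<^sup>+t. \<rho> (t + s) \<partial>std_normal) \<le> K"
    and I: "finite I" "P \<subseteq> I"
    and meas: "\<And>j. j \<in> P \<Longrightarrow> h j \<in> borel_measurable (PiM I (\<lambda>_. borel))"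
    and indep: "\<And>j x y. j \<in> P \<Longrightarrow> (\<And>i. i \<in> I - P \<Longrightarrow> x i = y i) \<Longrightarrow> h j x = h j y"
  shows "(\<integral>\<^sup>+g. (\<Prod>j\<in>P. \<rho> (g j + h j g)) \<partial>gauss_space I) \<le> K ^ card P"
proof -
  have "finite P" using I finite_subset by blast
  then show ?thesis using I meas indep
  proof (induction P arbitrary: I h rule: finite_induct)
    case empty
    have "emeasure (gauss_space I) (space (gauss_space I)) = 1"
      by (intro prob_space.emeasure_space_1 prob_space_PiM prob_space_std_normal)
    then show ?case by simp
  next
    case (insert p Q)
    define J where "J = I - {p}"
    have IJ: "I = insert p J" "p \<notin> J" "finite J" "Q \<subseteq> J"
      using insert.hyps insert.prems(1,2) by (auto simp: J_def)
    \<comment> \<open>No \<open>h j\<close> reads the coordinate \<open>p\<close>; freezing it at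
      the arbitrary value 0 makes \<open>h j\<close> a function on the smaller product over
      \<open>J\<close>.\<close>
    define h' where "h' j x = h j (x(p := 0))" for j x
    have upd: "h j (x(p := y)) = h' j x" if "j \<in> insert p Q" for j x y
      unfolding h'_def using that by (rule insert.prems(4)) auto
    have add: "(\<lambda>x. x(p := 0)) \<in> PiM J (\<lambda>_. borel) \<rightarrow>\<^sub>M PiM I (\<lambda>_. borel :: real measure)"
    proof (rule measurable_PiM_single')
      show "(\<lambda>x. x(p := 0)) \<in> space (PiM J (\<lambda>_. borel)) \<rightarrow> I \<rightarrow>\<^sub>E space (borel :: real measure)"
        using IJ by (auto simp: space_PiM PiE_def extensional_def)
      show "(\<lambda>x. (x(p := 0)) i) \<in> borel_measurable (PiM J (\<lambda>_. borel :: real measure))" if "i \<in> I" for i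
        using that IJ by (cases "i = p") auto
    qed
    have h'm: "h' j \<in> borel_measurable (PiM J (\<lambda>_. borel))" if "j \<in> insert p Q" for j
      unfolding h'_def by (rule measurable_compose[OF add insert.prems(3)[OF that]])
    have comp: "(\<lambda>g. g j) \<in> borel_measurable (PiM I (\<lambda>_. borel :: real measure))" if "j \<in> I" for j
      using that by (rule measurable_component_singleton)
    have compJ: "(\<lambda>g. g j) \<in> borel_measurable (PiM J (\<lambda>_. borel :: real measure))" if "j \<in> J" for j
      using that by (rule measurable_component_singleton)
    have fm: "(\<lambda>g. \<Prod>j\<in>insert p Q. \<rho> (g j + h j g)) \<in> borel_measurable (gauss_space (insert p J))"
      unfolding IJ(1)[symmetric]
    proof (subst measurable_cong_sets[OF sets_gauss_space refl], rule borel_measurable_prod_ennreal)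
      fix j assume j: "j \<in> insert p Q"
      then have [measurable]: "(\<lambda>g. g j) \<in> borel_measurable (PiM I (\<lambda>_. borel :: real measure))"
          "h j \<in> borel_measurable (PiM I (\<lambda>_. borel))"
        using insert.prems(2) by (auto intro: comp insert.prems(3))
      show "(\<lambda>g. \<rho> (g j + h j g)) \<in> borel_measurable (PiM I (\<lambda>_. borel))" by measurable
    qed
    have "(\<integral>\<^sup>+g. (\<Prod>j\<in>insert p Q. \<rho> (g j + h j g)) \<partial>gauss_space I)
        = (\<integral>\<^sup>+x. \<integral>\<^sup>+y. (\<Prod>j\<in>insert p Q. \<rho> ((x(p := y)) j + h j (x(p := y)))) \<partial>std_normal \<partial>gauss_space J)"
      unfolding IJ(1) by (rule std_normal_product.product_nn_integral_insert[OF IJ(3,2) fm])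
    also have "\<dots> = (\<integral>\<^sup>+x. (\<integral>\<^sup>+y. \<rho> (y + h' p x) * (\<Prod>j\<in>Q. \<rho> (x j + h' j x)) \<partial>std_normal) \<partial>gauss_space J)"
    proof (intro nn_integral_cong)
      fix x y
      have "(\<Prod>j\<in>Q. \<rho> ((x(p := y)) j + h j (x(p := y)))) = (\<Prod>j\<in>Q. \<rho> (x j + h' j x))"
        by (rule prod.cong) (use insert.hyps in \<open>auto simp: upd\<close>)
      then show "(\<Prod>j\<in>insert p Q. \<rho> ((x(p := y)) j + h j (x(p := y))))
          = \<rho> (y + h' p x) * (\<Prod>j\<in>Q. \<rho> (x j + h' j x))"
        using insert.hyps by (simp add: upd)
    qed
    also have "\<dots> = (\<integral>\<^sup>+x. (\<integral>\<^sup>+y. \<rho> (y + h' p x) \<partial>std_normal) * (\<Prod>j\<in>Q. \<rho> (x j + h' j x)) \<partial>gauss_space J)"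
      by (intro nn_integral_cong nn_integral_multc) measurable
    also have "\<dots> \<le> (\<integral>\<^sup>+x. K * (\<Prod>j\<in>Q. \<rho> (x j + h' j x)) \<partial>gauss_space J)"
      by (intro nn_integral_mono mult_right_mono bound) auto
    also have "\<dots> = K * (\<integral>\<^sup>+x. (\<Prod>j\<in>Q. \<rho> (x j + h' j x)) \<partial>gauss_space J)"
    proof (rule nn_integral_cmult)
      show "(\<lambda>x. \<Prod>j\<in>Q. \<rho> (x j + h' j x)) \<in> borel_measurable (gauss_space J)"
      proof (subst measurable_cong_sets[OF sets_gauss_space refl], rule borel_measurable_prod_ennreal)
        fix j assume j: "j \<in> Q"
        then have [measurable]: "(\<lambda>g. g j) \<in> borel_measurable (PiM J (\<lambda>_. borel :: real measure))"
            "h' j \<in> borel_measurable (PiM J (\<lambda>_. borel))"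
          using IJ by (auto intro: compJ h'm)
        show "(\<lambda>g. \<rho> (g j + h' j g)) \<in> borel_measurable (PiM J (\<lambda>_. borel))" by measurable
      qed
    qed
    also have "\<dots> \<le> K * K ^ card Q"
    proof (rule mult_left_mono[OF insert.IH])
      show "finite J" "Q \<subseteq> J" using IJ by auto
      show "h' j \<in> borel_measurable (PiM J (\<lambda>_. borel))" if "j \<in> Q" for j
        by (rule h'm) (use that in simp)
      show "h' j x = h' j y" if "j \<in> Q" "\<And>i. i \<in> J - Q \<Longrightarrow> x i = y i" for j x y
        unfolding h'_def by (rule insert.prems(4)) (use that in \<open>auto simp: J_def\<close>)
    qed simp
    also have "\<dots> = K ^ card (insert p Q)" using insert.hyps by simp
    finally show ?case .
  qed
qed

section \<open>Frequencies: representatives, spanning and dual functionals\<close>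

definition freq_vec :: "int ^ 'n \<Rightarrow> real ^ 'n::finite" where
  "freq_vec v = (\<chi> i. of_int (v $ i))"

lemma inj_freq_vec: "inj freq_vec"
  by (rule injI) (auto simp: freq_vec_def vec_eq_iff)

lemma symmetric_flip:
  assumes "symmetric_frequencies \<Lambda>" "v \<in> \<Lambda>"
  shows "(\<chi> i. if i = k then - (v $ i) else v $ i) \<in> \<Lambda>"
  using assms unfolding symmetric_frequencies_def by blast

text \<open>Symmetry flips a single coordinate at a time; induction over the set of flipped
  coordinates reaches all of them.\<close>

lemma symmetric_uminus:
  fixes \<Lambda> :: "(int ^ 'n::finite) set"
  assumes "symmetric_frequencies \<Lambda>" "v \<in> \<Lambda>"
  shows "- v \<in> \<Lambda>"
proof -
  have "(\<chi> i. if i \<in> S then - (v $ i) else v $ i) \<in> \<Lambda>" if "finite S" for S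
    using that
  proof (induction S)
    case empty
    then show ?case using assms by (simp add: vec_nth_inverse)
  next
    case (insert k S)
    have "(\<chi> i. if i \<in> insert k S then - (v $ i) else v $ i)
        = (\<chi> i. if i = k then - ((\<chi> i. if i \<in> S then - (v $ i) else v $ i) $ i)
             else (\<chi> i. if i \<in> S then - (v $ i) else v $ i) $ i)"
      using insert(2) by (auto simp: vec_eq_iff)
    then show ?case using symmetric_flip[OF assms(1) insert.IH, of k] by simp
  qed
  from this[of UNIV] show ?thesis by (simp add: uminus_vec_def)
qed

text \<open>\<open>R\<close> and its negative partition the frequencies. This identifies the squared
  normalising factor 2 / card \<Lambda> with 1 / card R, so the wave has variance 1.\<close>

lemma card_sign_representatives:
  assumes sym: "symmetric_frequencies \<Lambda>" and rep: "sign_representatives \<Lambda> R"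
  shows "finite R" "card R > 0" "card \<Lambda> = 2 * card R"
proof -
  have fin: "finite \<Lambda>" "\<Lambda> \<noteq> {}" using sym by (auto simp: symmetric_frequencies_def)
  have sub: "R \<subseteq> \<Lambda>" and iff: "\<And>v. v \<in> \<Lambda> \<Longrightarrow> v \<in> R \<longleftrightarrow> - v \<notin> R"
    using rep by (auto simp: sign_representatives_def)
  show fR: "finite R" using sub fin finite_subset by blast
  have un: "\<Lambda> = R \<union> uminus ` R"
  proof (intro equalityI subsetI)
    fix v assume "v \<in> \<Lambda>"
    then show "v \<in> R \<union> uminus ` R" using iff[of v] by (cases "v \<in> R") (auto intro: image_eqI[of _ _ "- v"])
  qed (use sub symmetric_uminus[OF sym] in auto)
  have "R \<inter> uminus ` R = {}" using iff sub by auto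
  then have "card \<Lambda> = card R + card (uminus ` R)"
    unfolding un by (intro card_Un_disjoint fR) (use fR in auto)
  then show c: "card \<Lambda> = 2 * card R" by (simp add: card_image)
  show "card R > 0" using c fin by (intro Nat.gr0I) simp
qed

text \<open>A transposition moves the nonzero coordinate to position \<open>i\<close>; flipping its
  sign and subtracting leaves a nonzero multiple of the \<open>i\<close>-th unit vector. Passing
  from all frequencies to representatives changes signs only.\<close>

lemma span_freq_vec:
  fixes \<Lambda> R :: "(int ^ 'n::finite) set"
  assumes sym: "symmetric_frequencies \<Lambda>" and rep: "sign_representatives \<Lambda> R"
    and v: "v \<in> \<Lambda>" "v $ k \<noteq> 0"
  shows "span (freq_vec ` R) = UNIV"
proof -
  have Lam: "freq_vec u \<in> span (freq_vec ` R)" if "u \<in> \<Lambda>" for u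
  proof (cases "u \<in> R")
    case False
    then have "- u \<in> R" using rep that by (auto simp: sign_representatives_def)
    then have "- freq_vec (- u) \<in> span (freq_vec ` R)"
      by (intro span_neg span_base) auto
    moreover have "- freq_vec (- u) = freq_vec u" by (simp add: freq_vec_def vec_eq_iff)
    ultimately show ?thesis by simp
  qed (auto intro: span_base)
  have ax: "axis i 1 \<in> span (freq_vec ` R)" for i
  proof -
    define u where "u = (\<chi> j. v $ (Transposition.transpose i k) j)"
    have "Transposition.transpose i k permutes UNIV" by (simp add: permutes_swap_id)
    then have u: "u \<in> \<Lambda>"
      using sym v(1) unfolding u_def symmetric_frequencies_def by blast
    have ui: "u $ i \<noteq> 0" using v(2) by (simp add: u_def)
    define w where "w = (\<chi> j. if j = i then - (u $ j) else u $ j)"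
    have w: "w \<in> \<Lambda>" unfolding w_def by (rule symmetric_flip[OF sym u])
    have "(1 / (2 * of_int (u $ i))) *\<^sub>R (freq_vec u - freq_vec w) \<in> span (freq_vec ` R)"
      by (intro span_scale span_diff Lam u w)
    also have "(1 / (2 * of_int (u $ i))) *\<^sub>R (freq_vec u - freq_vec w) = axis i 1"
      using ui by (auto simp: vec_eq_iff freq_vec_def w_def axis_def)
    finally show ?thesis .
  qed
  have "x \<in> span (freq_vec ` R)" for x
  proof -
    have "(\<Sum>i\<in>UNIV. x $ i *\<^sub>R axis i 1) \<in> span (freq_vec ` R)"
      by (intro span_sum span_scale ax)
    then show ?thesis using basis_expansion[of x] by (simp add: scalar_mult_eq_scaleR)
  qed
  then show ?thesis by auto
qed

text \<open>The frequencies in \<open>B\<close> form a basis, and \<open>l u\<close> is the dual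
  functional that reads off the coefficient of \<open>u\<close>. Applied to the gradient it isolates
  one Gaussian coefficient, up to coefficients outside \<open>B\<close>.\<close>

lemma pivot_frequencies:
  fixes R :: "(int ^ 'n::finite) set"
  assumes "span (freq_vec ` R) = UNIV"
  obtains B l where "B \<subseteq> R" "card B = CARD('n)" "\<And>u. u \<in> B \<Longrightarrow> linear (l u)"
    "\<And>u w. u \<in> B \<Longrightarrow> w \<in> B \<Longrightarrow> l u (freq_vec w) = (if u = w then 1 else (0::real))"
proof -
  obtain B0 where B0: "B0 \<subseteq> freq_vec ` R" "independent B0" "freq_vec ` R \<subseteq> span B0"
    using maximal_independent_subset[of "freq_vec ` R"] by blast
  have sp: "span B0 = UNIV"
    using assms span_mono[OF B0(3)] unfolding span_span by auto
  have card0: "card B0 = CARD('n)"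
    using basis_card_eq_dim[of B0 UNIV] B0(2) sp by (simp add: dim_UNIV)
  obtain B where B: "B \<subseteq> R" "B0 = freq_vec ` B" using B0(1) by (auto simp: subset_image_iff)
  have inj: "inj_on freq_vec B" using inj_freq_vec by (rule inj_on_subset) auto
  have "\<forall>u. \<exists>l. linear l \<and> (\<forall>x\<in>B0. l x = (if x = freq_vec u then 1 else (0::real)))"
    using linear_independent_extend[OF B0(2), of "\<lambda>x. if x = freq_vec _ then 1 else (0::real)"] by blast
  from choice[OF this] obtain l' where l: "\<And>u. linear (l' u)"
      "\<And>u x. x \<in> B0 \<Longrightarrow> l' u x = (if x = freq_vec u then 1 else (0::real))"
    by blast
  show ?thesis
  proof (rule that)
    show "B \<subseteq> R" by (rule B)
    show "card B = CARD('n)" using card0 B(2) card_image[OF inj] by simp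
    show "linear (l' u)" for u by (rule l)
    show "l' u (freq_vec w) = (if u = w then 1 else 0)" if "u \<in> B" "w \<in> B" for u w
      using l(2)[of "freq_vec w" u] that B(2) inj_onD[OF inj, of w u] by auto
  qed
qed

section \<open>Trigonometric polynomials\<close>

lemma freq_inner_eq: "freq_inner v x = freq_vec v \<bullet> x"
  by (simp add: freq_inner_def freq_vec_def inner_vec_def)

lemma continuous_freq_inner [continuous_intros]:
  "continuous_on S g \<Longrightarrow> continuous_on S (\<lambda>x. freq_inner v (g x))"
  unfolding freq_inner_eq by (intro continuous_intros)

lemma freq_inner_add_axis: "freq_inner v (x + t *\<^sub>R axis i 1) = freq_inner v x + t * of_int (v $ i)"
  by (simp add: freq_inner_eq inner_add_right inner_axis) (simp add: freq_vec_def)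

lemma continuous_trig_poly: "continuous_on UNIV (trig_poly \<Lambda> R b c)"
  unfolding trig_poly_def[abs_def] by (intro continuous_intros)

lemma periodic_trig_poly:
  fixes R :: "(int ^ 'n::finite) set"
  shows "periodic (trig_poly \<Lambda> R b c)"
proof -
  have "cos (2 * pi * freq_inner v (x + axis i 1)) = cos (2 * pi * freq_inner v x)"
       "sin (2 * pi * freq_inner v (x + axis i 1)) = sin (2 * pi * freq_inner v x)"
    for v :: "int ^ 'n" and x i
  proof -
    have e: "2 * pi * freq_inner v (x + axis i 1) = 2 * pi * freq_inner v x + 2 * pi * of_int (v $ i)"
      using freq_inner_add_axis[of v x 1 i] by (simp add: distrib_left)
    have i: "cos (2 * pi * of_int (v $ i)) = 1" "sin (2 * pi * of_int (v $ i)) = 0"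
      by (simp_all add: cos_int_2pin sin_int_2pin)
    show "cos (2 * pi * freq_inner v (x + axis i 1)) = cos (2 * pi * freq_inner v x)"
       "sin (2 * pi * freq_inner v (x + axis i 1)) = sin (2 * pi * freq_inner v x)"
      unfolding e cos_add sin_add i by simp_all
  qed
  then show ?thesis by (simp add: periodic_def trig_poly_def)
qed

text \<open>Differentiation stays within the class and only changes the coefficients, so continuity,
  periodicity, bounds and Lipschitz estimates for derivatives come from those for
  \<open>trig_poly\<close>.\<close>

lemma trig_poly_directional_derivative:
  "((\<lambda>t. trig_poly \<Lambda> R b c (x + t *\<^sub>R axis i 1)) has_real_derivative
     trig_poly \<Lambda> R (\<lambda>v. - (2 * pi * of_int (v $ i)) * c v) (\<lambda>v. 2 * pi * of_int (v $ i) * b v) x) (at 0)"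
proof -
  have d: "((\<lambda>t. b v * cos (2 * pi * (freq_inner v x + t * of_int (v $ i)))
            - c v * sin (2 * pi * (freq_inner v x + t * of_int (v $ i)))) has_real_derivative
      - (2 * pi * of_int (v $ i)) * c v * cos (2 * pi * freq_inner v x)
        - 2 * pi * of_int (v $ i) * b v * sin (2 * pi * freq_inner v x)) (at 0)" for v
  proof -
    have lin: "((\<lambda>t. 2 * pi * (freq_inner v x + t * of_int (v $ i))) has_real_derivative
        2 * pi * of_int (v $ i)) (at 0)"
      by (rule DERIV_cong[OF DERIV_cmult[OF DERIV_add[OF DERIV_const DERIV_cmult_right[OF DERIV_ident]]]]) simp
    show ?thesis
      by (rule DERIV_cong[OF DERIV_diff[OF DERIV_cmult[OF DERIV_fun_cos[OF lin]]
              DERIV_cmult[OF DERIV_fun_sin[OF lin]]]])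
         (simp add: mult.commute mult.left_commute)
  qed
  show ?thesis
    unfolding trig_poly_def freq_inner_add_axis by (rule DERIV_cmult[OF DERIV_sum[OF d]])
qed

lemma trig_poly_bound:
  "\<bar>trig_poly \<Lambda> R b c x\<bar> \<le> sqrt (2 / real (card \<Lambda>)) * (\<Sum>v\<in>R. \<bar>b v\<bar> + \<bar>c v\<bar>)"
proof -
  let ?t = "\<lambda>v. b v * cos (2 * pi * freq_inner v x) - c v * sin (2 * pi * freq_inner v x)"
  have "\<bar>?t v\<bar> \<le> \<bar>b v\<bar> + \<bar>c v\<bar>" for v
  proof -
    have "\<bar>b v\<bar> * \<bar>cos (2 * pi * freq_inner v x)\<bar> \<le> \<bar>b v\<bar> * 1"
      by (rule mult_left_mono) simp_all
    moreover have "\<bar>c v\<bar> * \<bar>sin (2 * pi * freq_inner v x)\<bar> \<le> \<bar>c v\<bar> * 1"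
      by (rule mult_left_mono) simp_all
    ultimately show ?thesis
      using abs_triangle_ineq4[of "b v * cos (2 * pi * freq_inner v x)" "c v * sin (2 * pi * freq_inner v x)"]
      unfolding abs_mult by linarith
  qed
  then have "\<bar>sum ?t R\<bar> \<le> (\<Sum>v\<in>R. \<bar>b v\<bar> + \<bar>c v\<bar>)"
    by (rule order_trans[OF sum_abs sum_mono])
  then have "sqrt (2 / real (card \<Lambda>)) * \<bar>sum ?t R\<bar>
      \<le> sqrt (2 / real (card \<Lambda>)) * (\<Sum>v\<in>R. \<bar>b v\<bar> + \<bar>c v\<bar>)"
    by (rule mult_left_mono) simp
  moreover have "\<bar>sqrt (2 / real (card \<Lambda>))\<bar> = sqrt (2 / real (card \<Lambda>))" by simp
  ultimately show ?thesis by (simp only: trig_poly_def abs_mult)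
qed

lemma abs_trig_diff_le: "\<bar>cos x - cos y\<bar> \<le> \<bar>x - y\<bar>" "\<bar>sin x - sin y\<bar> \<le> \<bar>x - y\<bar>" for x y :: real
proof -
  have "\<bar>sin ((x + y) / 2)\<bar> * \<bar>sin ((y - x) / 2)\<bar> \<le> 1 * \<bar>(y - x) / 2\<bar>"
    by (intro mult_mono abs_sin_x_le_abs_x) auto
  then show "\<bar>cos x - cos y\<bar> \<le> \<bar>x - y\<bar>"
    unfolding cos_diff_cos abs_mult by simp
  have "\<bar>sin ((x - y) / 2)\<bar> * \<bar>cos ((x + y) / 2)\<bar> \<le> \<bar>(x - y) / 2\<bar> * 1"
    by (intro mult_mono abs_sin_x_le_abs_x) auto
  then show "\<bar>sin x - sin y\<bar> \<le> \<bar>x - y\<bar>"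
    unfolding sin_diff_sin abs_mult by simp
qed

lemma trig_poly_lipschitz:
  obtains K where "K > 0" "\<And>x y. \<bar>trig_poly \<Lambda> R b c x - trig_poly \<Lambda> R b c y\<bar> \<le> K * norm (x - y)"
proof
  let ?k = "sqrt (2 / real (card \<Lambda>))"
  let ?L = "\<lambda>v. (\<bar>b v\<bar> + \<bar>c v\<bar>) * (2 * pi * norm (freq_vec v))"
  \<comment> \<open>The added 1 keeps the constant positive when all coefficients vanish.\<close>
  show "?k * (\<Sum>v\<in>R. ?L v) + 1 > 0"
    by (intro add_nonneg_pos mult_nonneg_nonneg sum_nonneg) auto
  fix x y :: "real ^ 'a"
  let ?a = "\<lambda>v x. 2 * pi * freq_inner v x"
  have arg: "\<bar>?a v x - ?a v y\<bar> \<le> 2 * pi * norm (freq_vec v) * norm (x - y)" for v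
  proof -
    have "?a v x - ?a v y = 2 * pi * (freq_vec v \<bullet> (x - y))"
      by (simp add: freq_inner_eq inner_diff_right right_diff_distrib)
    then show ?thesis
      using Cauchy_Schwarz_ineq2[of "freq_vec v" "x - y"] by (simp add: abs_mult mult.assoc)
  qed
  let ?t = "\<lambda>v. b v * (cos (?a v x) - cos (?a v y)) - c v * (sin (?a v x) - sin (?a v y))"
  have t: "\<bar>?t v\<bar> \<le> ?L v * norm (x - y)" for v
  proof -
    let ?B = "2 * pi * norm (freq_vec v) * norm (x - y)"
    have "\<bar>b v\<bar> * \<bar>cos (?a v x) - cos (?a v y)\<bar> \<le> \<bar>b v\<bar> * ?B"
      by (rule mult_left_mono[OF order_trans[OF abs_trig_diff_le(1) arg]]) simp
    moreover have "\<bar>c v\<bar> * \<bar>sin (?a v x) - sin (?a v y)\<bar> \<le> \<bar>c v\<bar> * ?B"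
      by (rule mult_left_mono[OF order_trans[OF abs_trig_diff_le(2) arg]]) simp
    moreover have "\<bar>?t v\<bar> \<le> \<bar>b v\<bar> * \<bar>cos (?a v x) - cos (?a v y)\<bar> + \<bar>c v\<bar> * \<bar>sin (?a v x) - sin (?a v y)\<bar>"
      unfolding abs_mult[symmetric] by (rule abs_triangle_ineq4)
    moreover have "?L v * norm (x - y) = \<bar>b v\<bar> * ?B + \<bar>c v\<bar> * ?B"
      by (simp only: distrib_right mult.assoc)
    ultimately show ?thesis by linarith
  qed
  have "trig_poly \<Lambda> R b c x - trig_poly \<Lambda> R b c y = ?k * (\<Sum>v\<in>R. ?t v)"
    unfolding trig_poly_def right_diff_distrib[of ?k, symmetric] sum_subtractf[symmetric]
    by (rule arg_cong[of _ _ "(*) ?k"], rule sum.cong[OF refl], unfold right_diff_distrib, linarith)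
  then have "\<bar>trig_poly \<Lambda> R b c x - trig_poly \<Lambda> R b c y\<bar> = ?k * \<bar>\<Sum>v\<in>R. ?t v\<bar>"
    by (simp only: abs_mult) simp
  also have "\<dots> \<le> ?k * (\<Sum>v\<in>R. ?L v * norm (x - y))"
    by (rule mult_left_mono[OF order_trans[OF sum_abs sum_mono[OF t]]]) simp
  also have "\<dots> = (?k * (\<Sum>v\<in>R. ?L v)) * norm (x - y)"
    by (simp only: sum_distrib_right mult.assoc)
  also have "\<dots> \<le> (?k * (\<Sum>v\<in>R. ?L v) + 1) * norm (x - y)"
    by (rule mult_right_mono) simp_all
  finally show "\<bar>trig_poly \<Lambda> R b c x - trig_poly \<Lambda> R b c y\<bar> \<le> (?k * (\<Sum>v\<in>R. ?L v) + 1) * norm (x - y)" .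
qed

section \<open>First and second derivatives as trigonometric polynomials\<close>

definition trig_grad ::
  "(int ^ 'n::finite) set \<Rightarrow> (int ^ 'n) set \<Rightarrow> (int ^ 'n \<Rightarrow> real) \<Rightarrow> (int ^ 'n \<Rightarrow> real) \<Rightarrow> 'n \<Rightarrow> real ^ 'n \<Rightarrow> real" where
  "trig_grad \<Lambda> R b c i = trig_poly \<Lambda> R (\<lambda>v. - (2 * pi * of_int (v $ i)) * c v) (\<lambda>v. 2 * pi * of_int (v $ i) * b v)"

definition trig_hess ::
  "(int ^ 'n::finite) set \<Rightarrow> (int ^ 'n) set \<Rightarrow> (int ^ 'n \<Rightarrow> real) \<Rightarrow> (int ^ 'n \<Rightarrow> real) \<Rightarrow> 'n \<Rightarrow> 'n \<Rightarrow> real ^ 'n \<Rightarrow> real" where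
  "trig_hess \<Lambda> R b c i j = trig_poly \<Lambda> R
     (\<lambda>v. - (2 * pi * of_int (v $ j)) * (2 * pi * of_int (v $ i) * b v))
     (\<lambda>v. 2 * pi * of_int (v $ j) * (- (2 * pi * of_int (v $ i)) * c v))"

interpretation trig: smooth_periodic "trig_poly \<Lambda> R b c" "trig_grad \<Lambda> R b c" "trig_hess \<Lambda> R b c"
  for \<Lambda> R :: "(int ^ 'n::finite) set" and b c
  by standard
    (simp_all only: trig_grad_def trig_hess_def continuous_trig_poly periodic_trig_poly
       trig_poly_directional_derivative)

text \<open>One deterministic \<open>H\<close> serves all coefficients, points and indices. The
  bound A of the overview thereby becomes a random variable, a multiple of the sum of absolute
  coefficients.\<close>

lemma trig_hess_bound:
  fixes \<Lambda> R :: "(int ^ 'n::finite) set"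
  assumes "finite R"
  obtains H where "H > 0" "\<And>b c x. \<bar>trig_poly \<Lambda> R b c x\<bar> \<le> H * (\<Sum>v\<in>R. \<bar>b v\<bar> + \<bar>c v\<bar>)"
    "\<And>b c i j x. \<bar>trig_hess \<Lambda> R b c i j x\<bar> \<le> H * (\<Sum>v\<in>R. \<bar>b v\<bar> + \<bar>c v\<bar>)"
proof
  let ?k = "sqrt (2 / real (card \<Lambda>))"
  define S where "S = (\<Sum>v\<in>R. \<Sum>i\<in>UNIV. \<Sum>j\<in>UNIV. \<bar>2 * pi * real_of_int (v $ j)\<bar> * \<bar>2 * pi * real_of_int (v $ i)\<bar>)"
  have S0: "S \<ge> 0" unfolding S_def by (intro sum_nonneg mult_nonneg_nonneg) auto
  let ?H = "(?k + 1) * (S + 1)"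
  show "?H > 0" using S0 by (intro mult_pos_pos add_nonneg_pos) auto
  fix b c :: "int ^ 'n \<Rightarrow> real" and x :: "real ^ 'n"
  let ?s = "\<Sum>v\<in>R. \<bar>b v\<bar> + \<bar>c v\<bar>"
  have s0: "?s \<ge> 0" by (intro sum_nonneg) auto
  have k1: "?k * 1 \<le> ?H" "?k * S \<le> ?H" by (intro mult_mono; use S0 in simp)+
  show "\<bar>trig_poly \<Lambda> R b c x\<bar> \<le> ?H * ?s"
    using order_trans[OF trig_poly_bound mult_right_mono[OF k1(1) s0, simplified]] by simp
  fix i j
  have le: "\<bar>2 * pi * real_of_int (v $ j)\<bar> * \<bar>2 * pi * real_of_int (v $ i)\<bar> \<le> S" if "v \<in> R" for v
  proof -
    let ?t = "\<lambda>v i j. \<bar>2 * pi * real_of_int (v $ j)\<bar> * \<bar>2 * pi * real_of_int (v $ i)\<bar>"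
    have "?t v i j \<le> (\<Sum>j\<in>UNIV. ?t v i j)"
      by (rule member_le_sum) auto
    also have "\<dots> \<le> (\<Sum>i\<in>UNIV. \<Sum>j\<in>UNIV. ?t v i j)"
      by (rule member_le_sum) (auto intro!: sum_nonneg)
    also have "\<dots> \<le> S"
      unfolding S_def by (rule member_le_sum) (use that assms in \<open>auto intro!: sum_nonneg\<close>)
    finally show ?thesis .
  qed
  have "\<bar>trig_hess \<Lambda> R b c i j x\<bar> \<le> ?k * (\<Sum>v\<in>R. \<bar>- (2 * pi * of_int (v $ j)) * (2 * pi * of_int (v $ i) * b v)\<bar>
      + \<bar>2 * pi * of_int (v $ j) * (- (2 * pi * of_int (v $ i)) * c v)\<bar>)"
    unfolding trig_hess_def by (rule trig_poly_bound)
  also have "\<dots> = ?k * (\<Sum>v\<in>R. (\<bar>2 * pi * real_of_int (v $ j)\<bar> * \<bar>2 * pi * real_of_int (v $ i)\<bar>) * (\<bar>b v\<bar> + \<bar>c v\<bar>))"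
    by (simp add: abs_mult algebra_simps)
  also have "\<dots> \<le> ?k * (\<Sum>v\<in>R. S * (\<bar>b v\<bar> + \<bar>c v\<bar>))"
    by (intro mult_left_mono sum_mono mult_right_mono le) auto
  also have "\<dots> = (?k * S) * ?s" by (simp add: sum_distrib_left mult.assoc)
  also have "\<dots> \<le> ?H * ?s" by (rule mult_right_mono[OF k1(2) s0])
  finally show "\<bar>trig_hess \<Lambda> R b c i j x\<bar> \<le> ?H * ?s" .
qed

lemma prod_mono_ennreal:
  fixes f g :: "'i \<Rightarrow> ennreal"
  shows "(\<And>i. i \<in> I \<Longrightarrow> f i \<le> g i) \<Longrightarrow> prod f I \<le> prod g I"
  by (induction I rule: infinite_finite_induct) (auto intro!: mult_mono)

text \<open>The squared norm of \<open>(f(0), \<nabla>f(0))\<close>; at another point \<open>x\<close> the coefficient pairs are rotated by \<open>2\<pi>\<langle>v, x\<rangle>\<close>.\<close>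

definition gauss_jet :: "real \<Rightarrow> (int ^ 'n::finite) set \<Rightarrow> (int ^ 'n + int ^ 'n \<Rightarrow> real) \<Rightarrow> real" where
  "gauss_jet k R g = (k * (\<Sum>v\<in>R. g (Inl v)))\<^sup>2
     + (\<Sum>i\<in>UNIV. (k * (\<Sum>v\<in>R. 2 * pi * of_int (v $ i) * g (Inr v)))\<^sup>2)"

lemma gauss_jet_measurable [measurable]:
  "gauss_jet k R \<in> borel_measurable (PiM (R <+> R) (\<lambda>_. borel))"
proof -
  have [measurable]: "(\<lambda>g. \<Sum>v\<in>R. g (Inl v)) \<in> borel_measurable (PiM (R <+> R) (\<lambda>_. borel :: real measure))"
    "(\<lambda>g. \<Sum>v\<in>R. 2 * pi * of_int (v $ i) * g (Inr v)) \<in> borel_measurable (PiM (R <+> R) (\<lambda>_. borel :: real measure))" for i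
    by (intro borel_measurable_sum borel_measurable_times borel_measurable_const measurable_component_singleton; auto)+
  show ?thesis unfolding gauss_jet_def[abs_def] by measurable
qed

text \<open>The angle addition formulas absorb the point x into the coefficients. The gradient comes
  out with a minus sign, which the squares remove.\<close>

lemma trig_jet_eq:
  assumes "\<And>v. v \<in> R \<Longrightarrow> g (Inl v) = b v" "\<And>v. v \<in> R \<Longrightarrow> g (Inr v) = c v"
  shows "trig.jet \<Lambda> R b c x = gauss_jet (sqrt (2 / real (card \<Lambda>))) R
     (rotate_pairs R (\<lambda>v. 2 * pi * freq_inner v x) R g)"
proof -
  let ?r = "rotate_pairs R (\<lambda>v. 2 * pi * freq_inner v x) R g"
  let ?k = "sqrt (2 / real (card \<Lambda>))"
  have r: "?r (Inl v) = b v * cos (2 * pi * freq_inner v x) - c v * sin (2 * pi * freq_inner v x)"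
    "?r (Inr v) = b v * sin (2 * pi * freq_inner v x) + c v * cos (2 * pi * freq_inner v x)" if "v \<in> R" for v
    using that assms by (auto simp: rotate_pairs_def)
  have "trig_poly \<Lambda> R b c x = ?k * (\<Sum>v\<in>R. ?r (Inl v))"
    unfolding trig_poly_def by (simp add: r)
  moreover have "trig_grad \<Lambda> R b c i x = - (?k * (\<Sum>v\<in>R. 2 * pi * of_int (v $ i) * ?r (Inr v)))" for i
  proof -
    have "(\<Sum>v\<in>R. - (2 * pi * of_int (v $ i)) * c v * cos (2 * pi * freq_inner v x)
        - 2 * pi * of_int (v $ i) * b v * sin (2 * pi * freq_inner v x))
        = (\<Sum>v\<in>R. - (2 * pi * of_int (v $ i) * ?r (Inr v)))"
    proof (rule sum.cong)
      fix v assume v: "v \<in> R"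
      show "- (2 * pi * of_int (v $ i)) * c v * cos (2 * pi * freq_inner v x)
          - 2 * pi * of_int (v $ i) * b v * sin (2 * pi * freq_inner v x)
          = - (2 * pi * of_int (v $ i) * ?r (Inr v))"
        unfolding r(2)[OF v] by (simp add: algebra_simps)
    qed simp
    then show ?thesis unfolding trig_grad_def trig_poly_def by (simp add: sum_negf)
  qed
  ultimately show ?thesis by (simp add: trig.jet_def gauss_jet_def)
qed

text \<open>The square root of the jet dominates d + 1 linear forms, each equal, up to a constant,
  to one pivot coefficient plus a combination of non-pivot ones. Sharing the d + 1 factors of the
  weight among these forms leaves one factor of exponent \<alpha> < 1 for each pivot, integrable
  conditionally on the rest.\<close>

lemma gauss_jet_weight_bound:
  fixes R :: "(int ^ 'n::finite) set"
  assumes R: "finite R" "card R > 0" "span (freq_vec ` R) = UNIV" and a: "0 < \<alpha>" "\<alpha> < 1" and k: "k > 0"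
  obtains K where "K < \<infinity>"
    "(\<integral>\<^sup>+g. singular_weight \<alpha> (sqrt (gauss_jet k R g)) ^ (CARD('n) + 1) \<partial>gauss_space (R <+> R)) \<le> K"
proof -
  obtain v0 where v0: "v0 \<in> R" using R(2) by fastforce
  obtain B l where B: "B \<subseteq> R" "card B = CARD('n)" and lin: "\<And>u. u \<in> B \<Longrightarrow> linear (l u)"
    and dual: "\<And>u w. u \<in> B \<Longrightarrow> w \<in> B \<Longrightarrow> l u (freq_vec w) = (if u = w then 1 else (0::real))"
    using pivot_frequencies[OF R(3)] by blast
  have fB: "finite B" using B R finite_subset by blast
  \<comment> \<open>One cosine coefficient is the pivot for the value of the wave, d sine
    coefficients are the pivots for its gradient.\<close>
  define P where "P = insert (Inl v0) (Inr ` B :: (int ^ 'n + int ^ 'n) set)"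
  have fP: "finite P" and subP: "P \<subseteq> R <+> R" using fB v0 B by (auto simp: P_def)
  have cP: "card P = CARD('n) + 1"
  proof -
    have "card (Inr ` B :: (int ^ 'n + int ^ 'n) set) = CARD('n)"
      using card_image[OF inj_Inr, of B] B(2) by simp
    then show ?thesis unfolding P_def using fB by (subst card_insert_disjoint) auto
  qed
  define h :: "int ^ 'n + int ^ 'n \<Rightarrow> _ \<Rightarrow> real" where
    "h j g = (case j of Inl _ \<Rightarrow> (\<Sum>v\<in>R - {v0}. g (Inl v))
       | Inr u \<Rightarrow> (\<Sum>v\<in>R - B. g (Inr v) * l u (freq_vec v)))" for j g
  have ex: "\<exists>c>0. \<forall>g. \<bar>c * (g j + h j g)\<bar> \<le> sqrt (gauss_jet k R g)" if "j \<in> P" for j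
  proof (cases j)
    case (Inl v)
    with that have j: "j = Inl v0" by (auto simp: P_def)
    have "\<bar>k * (g j + h j g)\<bar> \<le> sqrt (gauss_jet k R g)" for g
    proof (rule real_le_rsqrt)
      have "g j + h j g = (\<Sum>v\<in>R. g (Inl v))"
        using sum.remove[OF R(1) v0, of "\<lambda>v. g (Inl v)"] by (simp add: j h_def)
      then show "\<bar>k * (g j + h j g)\<bar>\<^sup>2 \<le> gauss_jet k R g"
        by (simp add: gauss_jet_def sum_nonneg)
    qed
    with k show ?thesis by blast
  next
    case (Inr u)
    with that have u: "u \<in> B" by (auto simp: P_def)
    \<comment> \<open>The functional \<open>l u\<close> applied to the gradient vector costs its
      operator bound, which explains the constant 2 pi k / M for this pivot.\<close>
    obtain M where M: "M > 0" "\<And>z. norm (l u z) \<le> M * norm z"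
      using linear_bounded_pos[OF lin[OF u]] by blast
    have "\<bar>(k * (2 * pi) / M) * (g j + h j g)\<bar> \<le> sqrt (gauss_jet k R g)" for g
    proof -
      define z where "z = (\<Sum>v\<in>R. g (Inr v) *\<^sub>R freq_vec v)"
      have "l u z = (\<Sum>v\<in>R. g (Inr v) * l u (freq_vec v))"
        unfolding z_def by (simp add: linear_sum[OF lin[OF u]] linear_cmul[OF lin[OF u]])
      also have "\<dots> = (\<Sum>v\<in>R - B. g (Inr v) * l u (freq_vec v)) + (\<Sum>v\<in>B. g (Inr v) * l u (freq_vec v))"
        by (rule sum.subset_diff[OF B(1) R(1)])
      also have "(\<Sum>v\<in>B. g (Inr v) * l u (freq_vec v)) = (\<Sum>v\<in>B. if v = u then g (Inr v) else 0)"
        by (rule sum.cong) (auto simp: dual u)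
      also have "\<dots> = g (Inr u)" using u fB by simp
      finally have lz: "l u z = g j + h j g" by (simp add: Inr h_def)
      have zi: "z $ i = (\<Sum>v\<in>R. of_int (v $ i) * g (Inr v))" for i
        by (simp add: z_def freq_vec_def mult.commute)
      have "(k * (2 * pi) * norm z)\<^sup>2 = (\<Sum>i\<in>UNIV. (k * (2 * pi) * z $ i)\<^sup>2)"
        by (simp add: norm_vec_def L2_set_def power_mult_distrib sum_nonneg sum_distrib_left)
      also have "\<dots> = (\<Sum>i\<in>UNIV. (k * (\<Sum>v\<in>R. 2 * pi * of_int (v $ i) * g (Inr v)))\<^sup>2)"
        by (simp add: zi sum_distrib_left mult.assoc)
      also have "\<dots> \<le> gauss_jet k R g" by (simp add: gauss_jet_def)
      finally have nz: "k * (2 * pi) * norm z \<le> sqrt (gauss_jet k R g)" by (rule real_le_rsqrt)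
      have "\<bar>(k * (2 * pi) / M) * (g j + h j g)\<bar> = (k * (2 * pi) / M) * \<bar>l u z\<bar>"
        using k M(1) by (simp add: lz abs_mult)
      also have "\<dots> \<le> (k * (2 * pi) / M) * (M * norm z)"
        by (rule mult_left_mono) (use M k in auto)
      also have "\<dots> = k * (2 * pi) * norm z" using M(1) by simp
      finally show ?thesis using nz by linarith
    qed
    moreover have "k * (2 * pi) / M > 0" using k M(1) by simp
    ultimately show ?thesis by blast
  qed
  have "\<forall>j\<in>P. \<exists>c. c > 0 \<and> (\<forall>g. \<bar>c * (g j + h j g)\<bar> \<le> sqrt (gauss_jet k R g))"
    using ex by blast
  from bchoice[OF this] obtain cc where cc: "\<And>j. j \<in> P \<Longrightarrow> cc j > 0"
    "\<And>j g. j \<in> P \<Longrightarrow> \<bar>cc j * (g j + h j g)\<bar> \<le> sqrt (gauss_jet k R g)"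
    by blast
  \<comment> \<open>A common scale for all pivots, because \<open>nn_integral_prod_pivot\<close>
    works with one function \<rho>.\<close>
  define c where "c = Min (cc ` P)"
  have Pne: "P \<noteq> {}" by (auto simp: P_def)
  have c0: "c > 0" unfolding c_def using fP Pne cc(1) by simp
  have cle: "\<bar>c * (g j + h j g)\<bar> \<le> \<bar>sqrt (gauss_jet k R g)\<bar>" if "j \<in> P" for j g
  proof -
    have "c \<le> cc j" unfolding c_def using fP that by simp
    then have "\<bar>c * (g j + h j g)\<bar> \<le> \<bar>cc j * (g j + h j g)\<bar>"
      using c0 by (simp add: abs_mult mult_right_mono)
    with cc(2)[OF that, of g] show ?thesis by linarith
  qed
  obtain K where K: "K < \<infinity>" "\<And>s. (\<integral>\<^sup>+t. singular_weight \<alpha> (c * (t + s)) \<partial>std_normal) \<le> K"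
    using singular_weight_std_normal_bound[OF a c0] by blast
  have "(\<integral>\<^sup>+g. singular_weight \<alpha> (sqrt (gauss_jet k R g)) ^ (CARD('n) + 1) \<partial>gauss_space (R <+> R))
      \<le> (\<integral>\<^sup>+g. (\<Prod>j\<in>P. singular_weight \<alpha> (c * (g j + h j g))) \<partial>gauss_space (R <+> R))"
  proof (rule nn_integral_mono)
    fix g
    have "singular_weight \<alpha> (sqrt (gauss_jet k R g)) ^ (CARD('n) + 1)
        = (\<Prod>j\<in>P. singular_weight \<alpha> (sqrt (gauss_jet k R g)))" by (simp add: cP)
    also have "\<dots> \<le> (\<Prod>j\<in>P. singular_weight \<alpha> (c * (g j + h j g)))"
      by (intro prod_mono_ennreal singular_weight_antimono a cle)
    finally show "singular_weight \<alpha> (sqrt (gauss_jet k R g)) ^ (CARD('n) + 1)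
        \<le> (\<Prod>j\<in>P. singular_weight \<alpha> (c * (g j + h j g)))" .
  qed
  also have "\<dots> \<le> K ^ card P"
  proof (rule nn_integral_prod_pivot[of "\<lambda>t. singular_weight \<alpha> (c * t)"])
    show "h j \<in> borel_measurable (PiM (R <+> R) (\<lambda>_. borel))" if "j \<in> P" for j
    proof (cases j)
      case (Inl v)
      have "(\<lambda>g. \<Sum>v\<in>R - {v0}. g (Inl v)) \<in> borel_measurable (PiM (R <+> R) (\<lambda>_. borel :: real measure))"
        by (intro borel_measurable_sum measurable_component_singleton) auto
      then show ?thesis by (simp add: Inl h_def[abs_def])
    next
      case (Inr u)
      have "(\<lambda>g. \<Sum>v\<in>R - B. g (Inr v) * l u (freq_vec v)) \<in> borel_measurable (PiM (R <+> R) (\<lambda>_. borel :: real measure))"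
        by (intro borel_measurable_sum borel_measurable_times borel_measurable_const measurable_component_singleton) auto
      then show ?thesis by (simp add: Inr h_def[abs_def])
    qed
    show "h j x = h j y" if "j \<in> P" and eq: "\<And>i. i \<in> R <+> R - P \<Longrightarrow> x i = y i" for j x y
    proof (cases j)
      case (Inl v)
      have "(\<Sum>v\<in>R - {v0}. x (Inl v)) = (\<Sum>v\<in>R - {v0}. y (Inl v))"
        by (rule sum.cong) (auto intro!: eq simp: P_def)
      then show ?thesis by (simp add: Inl h_def)
    next
      case (Inr u)
      have "(\<Sum>v\<in>R - B. x (Inr v) * l u (freq_vec v)) = (\<Sum>v\<in>R - B. y (Inr v) * l u (freq_vec v))"
        by (rule sum.cong) (auto intro!: eq arg_cong2[of _ _ _ _ "(*)"] simp: P_def)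
      then show ?thesis by (simp add: Inr h_def)
    qed
  qed (use K(2) R subP in auto)
  finally have "(\<integral>\<^sup>+g. singular_weight \<alpha> (sqrt (gauss_jet k R g)) ^ (CARD('n) + 1) \<partial>gauss_space (R <+> R)) \<le> K ^ card P" .
  moreover have "K ^ card P < \<infinity>" using K(1) by (simp add: power_less_top_ennreal)
  ultimately show ?thesis using that by blast
qed

section \<open>Existence of the Leray measure\<close>

text \<open>The exponent is below \<open>1\<close>, hence integrable against each Gaussian factor, while its \<open>(d + 1)\<close>-fold multiple
  exceeds \<open>d\<close>, hence is not integrable near a zero of a Lipschitz function on \<open>\<real>\<^sup>d\<close>.\<close>

definition sing_exp :: "nat \<Rightarrow> real" where
  "sing_exp d = (real d + 1 / 2) / (real d + 1)"

lemma sing_exp: "0 < sing_exp d" "sing_exp d < 1" "sing_exp d * real (d + 1) = real d + 1 / 2"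
  by (auto simp: sing_exp_def field_simps)

lemma singular_weight_power:
  assumes "t > 0"
  shows "singular_weight (sing_exp d) t ^ (d + 1) = ennreal (t powr - (real d + 1 / 2))"
proof -
  have "singular_weight (sing_exp d) t ^ (d + 1) = ennreal ((t powr - sing_exp d) ^ (d + 1))"
    using assms singular_weight_nonzero[of t "sing_exp d"] by (simp only: abs_of_pos ennreal_power powr_ge_zero)
  also have "(t powr - sing_exp d) ^ (d + 1) = (t powr - sing_exp d) powr real (d + 1)"
    by (rule powr_realpow[symmetric]) (use assms in simp)
  also have "\<dots> = t powr (- sing_exp d * real (d + 1))" by (rule powr_powr)
  also have "- sing_exp d * real (d + 1) = - (real d + 1 / 2)"
    using sing_exp(3)[of d] by simp
  finally show ?thesis .
qed

text \<open>On a box of side r with corner \<open>x0\<close>, |q| is at most K d r, so the integral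
  is at least (K d r)^-(d + 1/2) r^d, a constant times r^(-1/2). This is unbounded as r tends to
  0.\<close>

lemma singular_integral_infinite:
  fixes q :: "real ^ 'n::finite \<Rightarrow> real"
  assumes [measurable]: "q \<in> borel_measurable borel" and x0: "x0 \<in> half_open_cube"
    and K: "K > 0" "\<And>x. \<bar>q x\<bar> \<le> K * norm (x - x0)"
  shows "(\<integral>\<^sup>+x. singular_weight (sing_exp CARD('n)) (q x) ^ (CARD('n) + 1) \<partial>torus_measure) = \<infinity>"
proof (rule ccontr)
  let ?d = "CARD('n)" let ?a = "sing_exp CARD('n)"
  let ?F = "\<lambda>x. singular_weight ?a (q x) ^ (?d + 1)"
  assume "integral\<^sup>N torus_measure ?F \<noteq> \<infinity>"
  then obtain J where J: "J \<ge> 0" "integral\<^sup>N torus_measure ?F = ennreal J"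
    by (cases "integral\<^sup>N torus_measure ?F" rule: ennreal_cases) simp_all
  \<comment> \<open>The distance to the upper faces. The boxes grow only in the direction of
    increasing coordinates, so \<open>x0\<close> may lie on a lower face.\<close>
  define r0 where "r0 = Min (range (\<lambda>i. 1 - x0 $ i))"
  have r0: "r0 > 0" using x0 by (auto simp: r0_def half_open_cube_def)
  have r0le: "r0 \<le> 1 - x0 $ i" for i unfolding r0_def by (rule Min_le) auto
  have le: "(K * real ?d * r) powr - (real ?d + 1 / 2) * r powr (real ?d) \<le> J" if r: "0 < r" "r \<le> r0" for r
  proof -
    let ?b = "x0 + (\<chi> i. r)"
    have comp: "(?b - x0) \<bullet> i = r" if "i \<in> Basis" for i :: "real ^ 'n"
      using that by (auto simp: Basis_vec_def inner_axis)
    have le': "x0 \<bullet> i \<le> ?b \<bullet> i" if "i \<in> Basis" for i :: "real ^ 'n"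
      using comp[OF that] r by (simp add: inner_add_left)
    have "(\<Prod>i\<in>Basis. (?b - x0) \<bullet> i) = (\<Prod>i\<in>(Basis :: (real ^ 'n) set). r)"
      by (rule prod.cong[OF refl comp])
    also have "\<dots> = r ^ ?d" by simp
    finally have em: "emeasure lborel (box x0 ?b) = ennreal (r ^ ?d)"
      using emeasure_lborel_box[OF le'] by simp
    have sub: "box x0 ?b \<subseteq> half_open_cube"
    proof
      fix x assume "x \<in> box x0 ?b"
      then have bd: "x0 $ i < x $ i \<and> x $ i < x0 $ i + r" for i by (simp add: mem_box_cart)
      then have "0 \<le> x $ i \<and> x $ i < 1" for i
        using bd[of i] r0le[of i] r(2) x0[unfolded half_open_cube_def mem_Collect_eq, rule_format, of i] by linarith
      then show "x \<in> half_open_cube" by (simp add: half_open_cube_def)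
    qed
    let ?c = "singular_weight ?a (K * real ?d * r) ^ (?d + 1)"
    have "?c * ennreal (r ^ ?d) = (\<integral>\<^sup>+x. ?c * indicator (box x0 ?b) x \<partial>lborel)"
      by (simp add: nn_integral_cmult_indicator em)
    also have "\<dots> \<le> (\<integral>\<^sup>+x. ?F x * indicator half_open_cube x \<partial>lborel)"
    proof (rule nn_integral_mono)
      fix x
      show "?c * indicator (box x0 ?b) x \<le> ?F x * indicator half_open_cube x"
      proof (cases "x \<in> box x0 ?b")
        case True
        have "norm (x - x0) \<le> (\<Sum>i\<in>UNIV. \<bar>(x - x0) $ i\<bar>)" by (rule norm_le_l1_cart)
        also have "\<dots> \<le> (\<Sum>i\<in>(UNIV :: 'n set). r)"
          by (rule sum_mono) (use True in \<open>auto simp: mem_box_cart abs_le_iff less_imp_le algebra_simps\<close>)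
        also have "\<dots> = real ?d * r" by simp
        finally have "K * norm (x - x0) \<le> K * (real ?d * r)"
          using K(1) by (intro mult_left_mono) auto
        with K(2)[of x] have "\<bar>q x\<bar> \<le> \<bar>K * real ?d * r\<bar>" by (simp add: mult.assoc)
        then have "?c \<le> ?F x"
          by (intro power_mono singular_weight_antimono sing_exp) auto
        then show ?thesis using True sub by (auto simp: indicator_def)
      qed simp
    qed
    also have "\<dots> = integral\<^sup>N torus_measure ?F"
      unfolding torus_measure_eq
      by (subst nn_integral_restrict_space) (auto simp: half_open_cube_sets)
    finally have "?c * ennreal (r ^ ?d) \<le> ennreal J" using J by simp
    moreover have "?c = ennreal ((K * real ?d * r) powr - (real ?d + 1 / 2))"
      by (rule singular_weight_power) (use K r in auto)
    moreover have "ennreal ((K * real ?d * r) powr - (real ?d + 1 / 2) * r ^ ?d)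
        = ennreal ((K * real ?d * r) powr - (real ?d + 1 / 2)) * ennreal (r ^ ?d)"
      by (rule ennreal_mult) (use r in auto)
    ultimately have "ennreal ((K * real ?d * r) powr - (real ?d + 1 / 2) * r ^ ?d) \<le> ennreal J"
      by (simp only:)
    then have "(K * real ?d * r) powr - (real ?d + 1 / 2) * r ^ ?d \<le> J"
      using J(1) by (simp only: ennreal_le_iff)
    then show ?thesis using r by (simp add: powr_realpow)
  qed
  define C where "C = (K * real ?d) powr - (real ?d + 1 / 2)"
  have C: "C > 0" using K(1) by (simp add: C_def)
  have le2: "C * r powr - (1 / 2) \<le> J" if r: "0 < r" "r \<le> r0" for r
  proof -
    have "(K * real ?d * r) powr - (real ?d + 1 / 2) * r powr (real ?d)
        = C * (r powr - (real ?d + 1 / 2) * r powr (real ?d))"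
      using K(1) r by (subst powr_mult) (auto simp: C_def)
    also have "r powr - (real ?d + 1 / 2) * r powr (real ?d) = r powr - (1 / 2)"
      by (subst powr_add[symmetric]) simp
    finally show ?thesis using le[OF r] by simp
  qed
  \<comment> \<open>Small enough for C r^(-1/2) to reach J + 1, which contradicts the bound
    \<open>J\<close>.\<close>
  define r where "r = min r0 ((C / (J + 1))\<^sup>2)"
  have r: "0 < r" "r \<le> r0" using r0 C J(1) by (auto simp: r_def)
  have "sqrt r \<le> sqrt ((C / (J + 1))\<^sup>2)" by (rule real_sqrt_le_mono) (simp add: r_def)
  also have "\<dots> = C / (J + 1)" using C J(1) by (intro real_sqrt_unique) auto
  finally have "sqrt r * (J + 1) \<le> C" using J(1) by (subst (asm) pos_le_divide_eq) auto
  then have "J + 1 \<le> C / sqrt r" using r(1) by (subst pos_le_divide_eq) (auto simp: mult.commute)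
  also have "\<dots> = C * r powr - (1 / 2)"
    unfolding powr_minus_divide[of r] powr_half_sqrt[OF less_imp_le[OF r(1)]] by simp
  finally show False using le2[OF r] by simp
qed

text \<open>The integral of q^(-s) for one sample, with values in \<open>ennreal\<close> so that
  divergence is visible. Its finiteness is the almost sure event behind all the statements for
  individual samples.\<close>

definition jet_energy ::
  "(int ^ 'n::finite) set \<Rightarrow> (int ^ 'n) set \<Rightarrow> (int ^ 'n \<Rightarrow> real) \<Rightarrow> (int ^ 'n \<Rightarrow> real) \<Rightarrow> ennreal" where
  "jet_energy \<Lambda> R b c = (\<integral>\<^sup>+x. singular_weight (sing_exp CARD('n)) (sqrt (trig.jet \<Lambda> R b c x)) ^ (CARD('n) + 1) \<partial>torus_measure)"

text \<open>A zero of the jet can be moved into the cube by periodicity. There \<open>f\<close> and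
  its partial derivatives vanish and are Lipschitz, so q is at most a multiple of the distance and
  the energy diverges.\<close>

lemma trig_jet_positive:
  fixes \<Lambda> R :: "(int ^ 'n::finite) set"
  assumes fin: "jet_energy \<Lambda> R b c < \<infinity>"
  shows "trig.jet \<Lambda> R b c x > 0"
proof (rule ccontr)
  let ?j = "trig.jet \<Lambda> R b c"
  assume "\<not> ?j x > 0"
  moreover have "?j x \<ge> 0" by (auto simp: trig.jet_def intro!: add_nonneg_nonneg sum_nonneg)
  ultimately have j0: "?j x = 0" by simp
  obtain y where yc: "y \<in> half_open_cube" and yg: "\<And>g :: real ^ 'n \<Rightarrow> real. periodic g \<Longrightarrow> g y = g x"
    using periodic_reduce[where 'b = real, of x] by blast
  have y: "y \<in> half_open_cube" "?j y = 0" using yc yg[OF trig.periodic_jet] j0 by simp_all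
  have y0: "trig_poly \<Lambda> R b c y = 0" "\<And>i. trig_grad \<Lambda> R b c i y = 0"
  proof -
    have s: "(\<Sum>i\<in>UNIV. (trig_grad \<Lambda> R b c i y)\<^sup>2) \<ge> 0" by (intro sum_nonneg) simp
    have f0: "(trig_poly \<Lambda> R b c y)\<^sup>2 \<ge> 0" by simp
    have "(trig_poly \<Lambda> R b c y)\<^sup>2 = 0" "(\<Sum>i\<in>UNIV. (trig_grad \<Lambda> R b c i y)\<^sup>2) = 0"
      using y(2) s f0 unfolding trig.jet_def by linarith+
    then show "trig_poly \<Lambda> R b c y = 0" "\<And>i. trig_grad \<Lambda> R b c i y = 0"
      by (simp_all add: sum_nonneg_eq_0_iff)
  qed
  obtain K where K: "K > 0" "\<And>x. \<bar>trig_poly \<Lambda> R b c x - trig_poly \<Lambda> R b c y\<bar> \<le> K * norm (x - y)"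
  proof -
    obtain K where "K > 0" "\<And>x y. \<bar>trig_poly \<Lambda> R b c x - trig_poly \<Lambda> R b c y\<bar> \<le> K * norm (x - y)"
      by (rule trig_poly_lipschitz[of \<Lambda> R b c]) blast
    then show ?thesis using that by simp
  qed
  have "\<exists>L>0. \<forall>x. \<bar>trig_grad \<Lambda> R b c i x - trig_grad \<Lambda> R b c i y\<bar> \<le> L * norm (x - y)" for i
  proof -
    obtain L where "L > 0" "\<And>x y. \<bar>trig_grad \<Lambda> R b c i x - trig_grad \<Lambda> R b c i y\<bar> \<le> L * norm (x - y)"
      unfolding trig_grad_def
      by (rule trig_poly_lipschitz[of \<Lambda> R "\<lambda>v. - (2 * pi * of_int (v $ i)) * c v"
            "\<lambda>v. 2 * pi * of_int (v $ i) * b v"]) blast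
    then show ?thesis by (intro exI[of _ L]) simp
  qed
  then have "\<forall>i. \<exists>L. L > 0 \<and> (\<forall>x. \<bar>trig_grad \<Lambda> R b c i x - trig_grad \<Lambda> R b c i y\<bar> \<le> L * norm (x - y))"
    by simp
  from choice[OF this] obtain L where L': "\<And>i. L i > 0"
    "\<And>i x. \<bar>trig_grad \<Lambda> R b c i x - trig_grad \<Lambda> R b c i y\<bar> \<le> L i * norm (x - y)"
    by blast
  have L: "L i > 0" "\<bar>trig_grad \<Lambda> R b c i x\<bar> \<le> L i * norm (x - y)" for i x
    using L'(1)[of i] L'(2)[of i x] unfolding y0(2) by simp_all
  let ?K = "K + (\<Sum>i\<in>UNIV. L i)"
  have bound: "\<bar>sqrt (?j x)\<bar> \<le> ?K * norm (x - y)" for x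
  proof -
    have "sqrt (?j x) \<le> sqrt ((trig_poly \<Lambda> R b c x)\<^sup>2) + sqrt (\<Sum>i\<in>UNIV. (trig_grad \<Lambda> R b c i x)\<^sup>2)"
      unfolding trig.jet_def by (intro sqrt_add_le_add_sqrt sum_nonneg) auto
    also have "sqrt (\<Sum>i\<in>UNIV. (trig_grad \<Lambda> R b c i x)\<^sup>2) \<le> (\<Sum>i\<in>UNIV. \<bar>trig_grad \<Lambda> R b c i x\<bar>)"
      using L2_set_le_sum_abs[of "\<lambda>i. trig_grad \<Lambda> R b c i x" UNIV] by (simp add: L2_set_def)
    also have "\<dots> \<le> (\<Sum>i\<in>UNIV. L i * norm (x - y))" by (intro sum_mono L(2))
    also have "\<dots> = (\<Sum>i\<in>UNIV. L i) * norm (x - y)" by (simp add: sum_distrib_right)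
    finally have "sqrt (?j x) \<le> K * norm (x - y) + (\<Sum>i\<in>UNIV. L i) * norm (x - y)"
      using K(2)[of x] y0(1) by simp
    moreover have "sqrt (?j x) \<ge> 0"
      by (auto simp: trig.jet_def intro!: add_nonneg_nonneg sum_nonneg)
    ultimately show ?thesis by (simp add: distrib_right)
  qed
  have Kpos: "?K > 0" using K(1) L(1) by (intro add_pos_nonneg sum_nonneg) (auto simp: less_imp_le)
  have meas: "(\<lambda>x. sqrt (?j x)) \<in> borel_measurable borel"
    by (intro borel_measurable_continuous_onI continuous_intros trig.continuous_jet)
  have "jet_energy \<Lambda> R b c = \<infinity>"
    unfolding jet_energy_def by (rule singular_integral_infinite[OF meas y(1) Kpos bound])
  with fin show False by simp
qed

text \<open>\<open>GDERIV\<close> is a full derivative; along each axis it must agree with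
  \<open>trig_grad\<close>, so a singular zero would be a zero of the jet.\<close>

lemma trig_nodal_nonsingular:
  fixes \<Lambda> R :: "(int ^ 'n::finite) set"
  assumes pos: "\<And>x. trig.jet \<Lambda> R b c x > 0"
  shows "nodal_nonsingular (trig_poly \<Lambda> R b c)"
  unfolding nodal_nonsingular_def
proof
  assume "\<exists>x. trig_poly \<Lambda> R b c x = 0 \<and> GDERIV (trig_poly \<Lambda> R b c) x :> 0"
  then obtain x where x: "trig_poly \<Lambda> R b c x = 0"
    and d: "(trig_poly \<Lambda> R b c has_derivative (\<lambda>h. 0)) (at x)"
    unfolding gderiv_def by auto
  have "trig_grad \<Lambda> R b c i x = 0" for i
  proof -
    have l: "((\<lambda>t. x + t *\<^sub>R axis i 1) has_derivative (\<lambda>t. t *\<^sub>R axis i 1)) (at 0)"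
      using has_derivative_add[OF has_derivative_const has_derivative_scaleR_left[OF has_derivative_ident]]
      by simp
    have "((\<lambda>t. trig_poly \<Lambda> R b c (x + t *\<^sub>R axis i 1)) has_derivative (\<lambda>t. 0)) (at 0)"
    proof (rule has_derivative_compose[OF l])
      show "(trig_poly \<Lambda> R b c has_derivative (\<lambda>h. 0)) (at (x + 0 *\<^sub>R axis i 1))" using d by simp
    qed
    moreover have "(\<lambda>t. 0) = (*) (0 :: real)" by (rule ext) simp
    ultimately have "((\<lambda>t. trig_poly \<Lambda> R b c (x + t *\<^sub>R axis i 1)) has_real_derivative 0) (at 0)"
      unfolding has_field_derivative_def by simp
    then show ?thesis by (rule DERIV_unique[OF trig.deriv(1)])
  qed
  with x have "trig.jet \<Lambda> R b c x = 0" by (simp add: trig.jet_def)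
  with pos[of x] show False by simp
qed

text \<open>The exponent 5 is conjugate to 5/4, and (q^-2)^(5/4) = q^(-5/2). For q < 1 the two cases
  meet at A = q^(-1/2), where A/q^2, A^5 and q^(-5/2) coincide.\<close>

lemma young_bound:
  assumes "q > 0" "A \<ge> 0" "d \<ge> 2"
  shows "A / q\<^sup>2 \<le> A ^ 5 + 1 + q powr - (real d + 1 / 2)"
proof (cases "q \<ge> 1")
  case True
  then have "A * 1 \<le> A * q\<^sup>2" using assms(2) by (intro mult_left_mono one_le_power)
  then have "A / q\<^sup>2 \<le> A" using assms(1) by (simp add: divide_le_eq)
  also have "A \<le> A ^ 5 + 1"
  proof (cases "A \<le> 1")
    case False
    then have "A ^ 1 \<le> A ^ 5" by (intro power_increasing) auto
    then show ?thesis by simp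
  qed (use zero_le_power[OF assms(2), of 5] in linarith)
  finally show ?thesis by (simp add: add_increasing2)
next
  case False
  show ?thesis
  proof (cases "A \<le> q powr - (1 / 2)")
    case True
    have "A / q\<^sup>2 \<le> q powr - (1 / 2) / q\<^sup>2" using True by (rule divide_right_mono) simp
    also have "\<dots> = q powr - (5 / 2)"
    proof -
      have "q powr - (1 / 2) / q powr 2 = q powr (- (1 / 2) - 2)" by (rule powr_diff[symmetric])
      then show ?thesis using assms(1) by simp
    qed
    \<comment> \<open>Here d >= 2 enters, through 5/2 <= d + 1/2, together with q < 1.\<close>
    also have "\<dots> \<le> q powr - (real d + 1 / 2)"
      by (rule powr_mono') (use assms False in auto)
    finally show ?thesis using assms by (simp add: add_increasing)
  next
    case False
    then have "(q powr - (1 / 2)) ^ 4 \<le> A ^ 4" by (intro power_mono) auto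
    moreover have "(q powr - (1 / 2)) ^ 4 = 1 / q\<^sup>2"
    proof -
      have "(q powr - (1 / 2)) ^ 4 = (q powr - (1 / 2)) powr real 4"
        using assms(1) by (intro powr_realpow[symmetric]) simp
      also have "\<dots> = q powr (- (1 / 2) * real 4)" by (rule powr_powr)
      also have "- (1 / 2) * real 4 = - 2" by simp
      finally show ?thesis using assms(1) by (simp add: powr_minus_divide)
    qed
    ultimately have "A * (1 / q\<^sup>2) \<le> A * A ^ 4" using assms(2) by (intro mult_left_mono) auto
    also have "\<dots> = A ^ 5" by (simp add: eval_nat_numeral)
    finally show ?thesis by (simp add: add_increasing2)
  qed
qed

text \<open>The right side is free of \<epsilon> and involves the sample only through A^5 and the
  energy, two quantities with finite expectation.\<close>

lemma trig_leray_bound: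
  fixes \<Lambda> R :: "(int ^ 'n::finite) set"
  assumes fin: "jet_energy \<Lambda> R b c < \<infinity>" and d: "CARD('n) \<ge> 2" and A: "A \<ge> 0"
    and bd: "\<And>x. \<bar>trig_poly \<Lambda> R b c x\<bar> \<le> A" "\<And>x i j. \<bar>trig_hess \<Lambda> R b c i j x\<bar> \<le> A"
    and e: "\<epsilon> > 0"
  shows "leray_quotient (trig_poly \<Lambda> R b c) \<epsilon>
    \<le> (1 + 5 * real CARD('n) ^ 2) * (A ^ 5 + 1 + enn2real (jet_energy \<Lambda> R b c))"
proof -
  interpret T: prob_space "torus_measure :: (real ^ 'n) measure" by (rule prob_space_torus_measure)
  let ?j = "trig.jet \<Lambda> R b c" let ?C = "1 + 5 * real CARD('n) ^ 2"
  let ?w = "\<lambda>x. sqrt (?j x) powr - (real CARD('n) + 1 / 2)"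
  have pos: "?j x > 0" for x by (rule trig_jet_positive[OF fin])
  have pos': "sqrt (?j x) > 0" for x using pos by simp
  have wc: "continuous_on UNIV ?w"
    by (intro continuous_intros trig.continuous_jet) (use pos in \<open>auto simp: less_imp_neq[symmetric]\<close>)
  have wm[measurable]: "?w \<in> borel_measurable borel" by (rule borel_measurable_continuous_onI[OF wc])
  have wp: "periodic ?w" using trig.periodic_jet[of \<Lambda> R b c] by (simp add: periodic_def)
  have wi: "integrable torus_measure ?w" by (rule integrable_torus_periodic[OF wc wp])
  have "jet_energy \<Lambda> R b c = (\<integral>\<^sup>+x. ennreal (?w x) \<partial>torus_measure)"
    unfolding jet_energy_def singular_weight_power[OF pos'] ..
  moreover have "integral\<^sup>L torus_measure ?w = enn2real (\<integral>\<^sup>+x. ennreal (?w x) \<partial>torus_measure)"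
    by (rule integral_eq_nn_integral) (use wm in auto)
  ultimately have wint: "integral\<^sup>L torus_measure ?w = enn2real (jet_energy \<Lambda> R b c)"
    by (simp only:)
  have "leray_quotient (trig_poly \<Lambda> R b c) \<epsilon>
      \<le> (\<integral>x. \<bar>trig_poly \<Lambda> R b c x\<bar> / ?j x + \<bar>trig.div_field \<Lambda> R b c x\<bar> \<partial>torus_measure)"
    by (rule trig.leray_quotient_bound[OF pos e])
  also have "\<dots> \<le> (\<integral>x. ?C * (A ^ 5 + 1 + ?w x) \<partial>torus_measure)"
  proof (rule integral_mono[OF trig.dominator_integrable[OF pos]])
    show "integrable torus_measure (\<lambda>x. ?C * (A ^ 5 + 1 + ?w x))" using wi by simp
    fix x
    have "\<bar>trig_poly \<Lambda> R b c x\<bar> / ?j x + \<bar>trig.div_field \<Lambda> R b c x\<bar> \<le> ?C * (A / ?j x)"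
      using trig.abs_div_field_le[OF pos bd, of x] by simp
    also have "A / ?j x = A / (sqrt (?j x))\<^sup>2" using pos[of x] by simp
    also have "?C * \<dots> \<le> ?C * (A ^ 5 + 1 + ?w x)"
      by (rule mult_left_mono[OF young_bound[OF pos' A d]]) simp
    finally show "\<bar>trig_poly \<Lambda> R b c x\<bar> / ?j x + \<bar>trig.div_field \<Lambda> R b c x\<bar> \<le> ?C * (A ^ 5 + 1 + ?w x)" .
  qed
  also have "\<dots> = ?C * (A ^ 5 + 1 + enn2real (jet_energy \<Lambda> R b c))"
    using wi by (simp add: wint[symmetric] T.prob_space)
  finally show ?thesis .
qed

lemma trig_leray_defined:
  fixes \<Lambda> R :: "(int ^ 'n::finite) set"
  assumes "jet_energy \<Lambda> R b c < \<infinity>"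
  shows "leray_defined (trig_poly \<Lambda> R b c)"
  unfolding leray_defined_def
  using trig_nodal_nonsingular[OF trig_jet_positive[OF assms]]
    trig.leray_quotient_tendsto[OF trig_jet_positive[OF assms]] by blast

section \<open>Reducing the existence of the limit to rational parameters\<close>

lemma leray_quotient_left_continuous:
  fixes f :: "real ^ 'n::finite \<Rightarrow> real"
  assumes [measurable]: "f \<in> borel_measurable borel" and e: "\<epsilon> > 0"
  shows "(leray_quotient f \<longlongrightarrow> leray_quotient f \<epsilon>) (at_left \<epsilon>)"
proof (rule tendsto_at_left_sequentially[OF e])
  interpret T: prob_space "torus_measure :: (real ^ 'n) measure" by (rule prob_space_torus_measure)
  fix S :: "nat \<Rightarrow> real"
  assume S: "\<And>n. S n < \<epsilon>" "\<And>n. 0 < S n" "S \<longlonglongrightarrow> \<epsilon>"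
  have eq: "measure torus_measure {x \<in> space torus_measure. \<bar>f x\<bar> < \<delta>}
      = (\<integral>x. indicator {x. \<bar>f x\<bar> < \<delta>} x \<partial>torus_measure)" for \<delta>
    by (simp add: Int_def conj_commute)
  \<comment> \<open>The strict inequality makes the left limit exact: |f| < \<epsilon> implies |f| <
    S n eventually. From the right, the level set |f| = \<epsilon> could contribute.\<close>
  have "(\<lambda>n. (\<integral>x. indicator {x. \<bar>f x\<bar> < S n} x \<partial>torus_measure) :: real)
      \<longlonglongrightarrow> (\<integral>x. indicator {x. \<bar>f x\<bar> < \<epsilon>} x \<partial>torus_measure)"
  proof (rule integral_dominated_convergence[where w = "\<lambda>_. 1"])
    show "AE x in torus_measure. (\<lambda>n. indicator {x. \<bar>f x\<bar> < S n} x :: real) \<longlonglongrightarrow> indicator {x. \<bar>f x\<bar> < \<epsilon>} x"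
    proof (rule AE_I2)
      fix x
      show "(\<lambda>n. indicator {x. \<bar>f x\<bar> < S n} x :: real) \<longlonglongrightarrow> indicator {x. \<bar>f x\<bar> < \<epsilon>} x"
      proof (cases "\<bar>f x\<bar> < \<epsilon>")
        case True
        then have "eventually (\<lambda>n. \<bar>f x\<bar> < S n) sequentially"
          using order_tendstoD(1)[OF S(3)] by simp
        then have "eventually (\<lambda>n. indicator {x. \<bar>f x\<bar> < S n} x = (1 :: real)) sequentially"
          by eventually_elim simp
        with True show ?thesis by (simp add: tendsto_eventually)
      next
        case False
        then have "\<not> \<bar>f x\<bar> < S n" for n using S(1)[of n] by linarith
        with False show ?thesis by simp
      qed
    qed
  qed (auto simp: indicator_def)
  then show "(\<lambda>n. leray_quotient f (S n)) \<longlonglongrightarrow> leray_quotient f \<epsilon>"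
    unfolding leray_quotient_def eq using e S(3) by (intro tendsto_intros) auto
qed

text \<open>The Cauchy criterion at 0, tested at rational points only. Left continuity extends it to
  all real points, and countably many conditions define a measurable event.\<close>

lemma left_continuous_limit_iff:
  fixes h :: "real \<Rightarrow> real"
  assumes left: "\<And>t. t > 0 \<Longrightarrow> (h \<longlongrightarrow> h t) (at_left t)"
  shows "(\<exists>l. (h \<longlongrightarrow> l) (at_right 0)) \<longleftrightarrow>
    (\<forall>k::nat. \<exists>m::nat. \<forall>p q :: rat. 0 < p \<and> of_rat p < 1 / real (Suc m) \<and> 0 < q \<and> of_rat q < 1 / real (Suc m)
       \<longrightarrow> \<bar>h (of_rat p) - h (of_rat q)\<bar> \<le> 1 / real (Suc k))" (is "?L \<longleftrightarrow> ?R")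
proof
  assume ?L
  then obtain l where l: "(h \<longlongrightarrow> l) (at_right 0)" by blast
  show ?R
  proof
    fix k :: nat
    define \<eta> where "\<eta> = 1 / (2 * real (Suc k))"
    have \<eta>: "\<eta> + \<eta> = 1 / real (Suc k)" by (simp add: \<eta>_def field_simps)
    have "eventually (\<lambda>t. dist (h t) l < \<eta>) (at_right 0)"
      by (rule tendstoD[OF l]) (simp add: \<eta>_def)
    then obtain d where d: "d > 0" "\<And>t. 0 < t \<Longrightarrow> t < d \<Longrightarrow> dist (h t) l < \<eta>"
      unfolding eventually_at_right_field by auto
    obtain m where m: "1 / real (Suc m) < d" using d(1) nat_approx_posE by blast
    show "\<exists>m::nat. \<forall>p q :: rat. 0 < p \<and> of_rat p < 1 / real (Suc m) \<and> 0 < q \<and> of_rat q < 1 / real (Suc m)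
       \<longrightarrow> \<bar>h (of_rat p) - h (of_rat q)\<bar> \<le> 1 / real (Suc k)"
    proof (intro exI[of _ m] allI impI)
      fix p q :: rat
      assume pq: "0 < p \<and> of_rat p < 1 / real (Suc m) \<and> 0 < q \<and> of_rat q < 1 / real (Suc m)"
      have "dist (h (of_rat p)) l < \<eta>" "dist (h (of_rat q)) l < \<eta>"
        using pq m by (intro d(2); simp del: of_nat_Suc)+
      then show "\<bar>h (of_rat p) - h (of_rat q)\<bar> \<le> 1 / real (Suc k)"
        unfolding dist_real_def \<eta>[symmetric] by linarith
    qed
  qed
next
  assume R: ?R
  have cauchy: "\<exists>m::nat. \<forall>s t. 0 < s \<and> s < 1 / real (Suc m) \<and> 0 < t \<and> t < 1 / real (Suc m)
      \<longrightarrow> \<bar>h s - h t\<bar> \<le> 1 / real (Suc k)" for k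
  proof -
    obtain m where m: "\<And>p q :: rat. 0 < p \<Longrightarrow> of_rat p < 1 / real (Suc m) \<Longrightarrow> 0 < q \<Longrightarrow> of_rat q < 1 / real (Suc m)
       \<Longrightarrow> \<bar>h (of_rat p) - h (of_rat q)\<bar> \<le> 1 / real (Suc k)"
      using R[rule_format, of k] by blast
    \<comment> \<open>The rational lies below \<open>t\<close>, where left continuity applies, and
      therefore also stays below the bound 1/(m + 1).\<close>
    have rat: "\<exists>p :: rat. 0 < p \<and> of_rat p < t \<and> \<bar>h (of_rat p) - h t\<bar> < \<eta>" if "t > 0" "\<eta> > 0" for t \<eta>
    proof -
      have "eventually (\<lambda>s. dist (h s) (h t) < \<eta>) (at_left t)" by (rule tendstoD[OF left[OF that(1)] that(2)])
      then obtain b where b: "b < t" "\<And>s. b < s \<Longrightarrow> s < t \<Longrightarrow> dist (h s) (h t) < \<eta>"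
        unfolding eventually_at_left_field by auto
      have "max b 0 < t" using b(1) that(1) by simp
      then obtain p :: rat where p: "max b 0 < of_rat p" "of_rat p < t"
        using of_rat_dense by blast
      then show ?thesis using b(2)[of "of_rat p"] by (intro exI[of _ p]) (auto simp: dist_real_def)
    qed
    show ?thesis
    proof (intro exI[of _ m] allI impI)
      fix s t assume st: "0 < s \<and> s < 1 / real (Suc m) \<and> 0 < t \<and> t < 1 / real (Suc m)"
      show "\<bar>h s - h t\<bar> \<le> 1 / real (Suc k)"
      proof (rule field_le_epsilon)
        fix \<eta> :: real assume "\<eta> > 0"
        then obtain p q where p: "0 < p" "of_rat p < s" "\<bar>h (of_rat p) - h s\<bar> < \<eta> / 2"
          and q: "0 < q" "of_rat q < t" "\<bar>h (of_rat q) - h t\<bar> < \<eta> / 2"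
          using rat[of s "\<eta> / 2"] rat[of t "\<eta> / 2"] st by auto
        have "\<bar>h (of_rat p) - h (of_rat q)\<bar> \<le> 1 / real (Suc k)"
          by (rule m) (use p q st in linarith)+
        with p(3) q(3) show "\<bar>h s - h t\<bar> \<le> 1 / real (Suc k) + \<eta>" by linarith
      qed
    qed
  qed
  have inv0: "(\<lambda>n. 1 / real (Suc n)) \<longlonglongrightarrow> 0" by (rule LIMSEQ_Suc[OF lim_1_over_n])
  have ev: "eventually (\<lambda>n. 1 / real (Suc n) < 1 / real (Suc m)) sequentially" for m
    using order_tendstoD(2)[OF inv0, of "1 / real (Suc m)"] by simp
  have "Cauchy (\<lambda>n. h (1 / real (Suc n)))"
  proof (rule metric_CauchyI)
    fix e :: real assume "e > 0"
    then obtain k where k: "1 / real (Suc k) < e" using nat_approx_posE by blast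
    obtain m where m: "\<And>s t. 0 < s \<Longrightarrow> s < 1 / real (Suc m) \<Longrightarrow> 0 < t \<Longrightarrow> t < 1 / real (Suc m)
      \<Longrightarrow> \<bar>h s - h t\<bar> \<le> 1 / real (Suc k)" using cauchy[of k] by blast
    obtain N where N: "\<And>n. n \<ge> N \<Longrightarrow> 1 / real (Suc n) < 1 / real (Suc m)"
      using ev[of m] unfolding eventually_sequentially by blast
    show "\<exists>M. \<forall>m\<ge>M. \<forall>n\<ge>M. dist (h (1 / real (Suc m))) (h (1 / real (Suc n))) < e"
    proof (intro exI[of _ N] allI impI)
      fix a b assume "N \<le> a" "N \<le> b"
      then have "\<bar>h (1 / real (Suc a)) - h (1 / real (Suc b))\<bar> \<le> 1 / real (Suc k)"
        by (intro m N) auto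
      with k show "dist (h (1 / real (Suc a))) (h (1 / real (Suc b))) < e"
        unfolding dist_real_def by linarith
    qed
  qed
  then obtain l where l: "(\<lambda>n. h (1 / real (Suc n))) \<longlonglongrightarrow> l"
    using Cauchy_convergent convergent_def by blast
  have "(h \<longlongrightarrow> l) (at_right 0)"
  proof (rule tendstoI)
    fix e :: real assume "e > 0"
    then obtain k where k: "1 / real (Suc k) < e" using nat_approx_posE by blast
    obtain m where m: "\<And>s t. 0 < s \<Longrightarrow> s < 1 / real (Suc m) \<Longrightarrow> 0 < t \<Longrightarrow> t < 1 / real (Suc m)
      \<Longrightarrow> \<bar>h s - h t\<bar> \<le> 1 / real (Suc k)" using cauchy[of k] by blast
    have bd: "\<bar>h t - l\<bar> \<le> 1 / real (Suc k)" if t: "0 < t" "t < 1 / real (Suc m)" for t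
    proof (rule tendsto_upperbound)
      show "(\<lambda>n. \<bar>h t - h (1 / real (Suc n))\<bar>) \<longlonglongrightarrow> \<bar>h t - l\<bar>" by (intro tendsto_intros l)
      show "eventually (\<lambda>n. \<bar>h t - h (1 / real (Suc n))\<bar> \<le> 1 / real (Suc k)) sequentially"
        using ev[of m] by eventually_elim (rule m[OF t], auto)
    qed simp
    show "eventually (\<lambda>t. dist (h t) l < e) (at_right 0)"
      unfolding eventually_at_right_field
    proof (intro exI[of _ "1 / real (Suc m)"] conjI allI impI)
      fix t assume "0 < t" "t < 1 / real (Suc m)"
      then show "dist (h t) l < e" using bd[of t] k unfolding dist_real_def by linarith
    qed simp
  qed
  then show ?L by blast
qed

section \<open>Expectation over Gaussian coefficients\<close>

lemma freq_inner_measurable [measurable]: "freq_inner v \<in> borel_measurable borel"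
  by (intro borel_measurable_continuous_onI continuous_freq_inner continuous_on_id)

lemma trig_poly_measurable:
  assumes "\<And>v. v \<in> R \<Longrightarrow> (\<lambda>z. \<beta> z v) \<in> borel_measurable N" "\<And>v. v \<in> R \<Longrightarrow> (\<lambda>z. \<gamma> z v) \<in> borel_measurable N"
    and [measurable]: "w \<in> N \<rightarrow>\<^sub>M borel"
  shows "(\<lambda>z. trig_poly \<Lambda> R (\<beta> z) (\<gamma> z) (w z)) \<in> borel_measurable N"
proof -
  have "(\<lambda>z. \<beta> z v * cos (2 * pi * freq_inner v (w z)) - \<gamma> z v * sin (2 * pi * freq_inner v (w z)))
      \<in> borel_measurable N" if "v \<in> R" for v
  proof -
    note assms(1)[OF that, measurable] assms(2)[OF that, measurable]
    show ?thesis by measurable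
  qed
  then show ?thesis
    unfolding trig_poly_def by (intro borel_measurable_times borel_measurable_const borel_measurable_sum)
qed

lemma trig_poly_rotate:
  assumes "\<And>v. v \<in> R \<Longrightarrow> g (Inl v) = b v" "\<And>v. v \<in> R \<Longrightarrow> g (Inr v) = c v"
  shows "trig_poly \<Lambda> R b c x = sqrt (2 / real (card \<Lambda>)) *
     (\<Sum>v\<in>R. rotate_pairs R (\<lambda>v. 2 * pi * freq_inner v x) R g (Inl v))"
  unfolding trig_poly_def
  by (rule arg_cong[of _ _ "(*) (sqrt (2 / real (card \<Lambda>)))"], rule sum.cong) (auto simp: rotate_pairs_def assms)

lemma power5_add_le: "(a + b) ^ 5 \<le> 32 * (a ^ 5 + b ^ 5)" if "a \<ge> 0" "b \<ge> 0" for a b :: real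
proof -
  have "(a + b) ^ 5 \<le> (2 * max a b) ^ 5" by (rule power_mono) (use that in auto)
  also have "\<dots> = 32 * max a b ^ 5" by (simp add: power_mult_distrib)
  also have "max a b ^ 5 \<le> a ^ 5 + b ^ 5" using that by (auto simp: max_def)
  finally show ?thesis by simp
qed

text \<open>The fifth power is the one produced by \<open>young_bound\<close>;
  \<open>power5_add_le\<close> reduces it to the fifth moments of single coefficients.\<close>

lemma integrable_sum_power5:
  fixes Z :: "'i \<Rightarrow> 'a \<Rightarrow> real"
  assumes "finite I" "\<And>i. i \<in> I \<Longrightarrow> Z i \<in> borel_measurable M" "\<And>i \<omega>. Z i \<omega> \<ge> 0"
    "\<And>i. i \<in> I \<Longrightarrow> integrable M (\<lambda>\<omega>. Z i \<omega> ^ 5)"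
  shows "integrable M (\<lambda>\<omega>. (\<Sum>i\<in>I. Z i \<omega>) ^ 5)"
  using assms(1,2,4)
proof (induction I rule: finite_induct)
  case (insert i I)
  have [measurable]: "Z i \<in> borel_measurable M" "(\<lambda>\<omega>. \<Sum>i\<in>I. Z i \<omega>) \<in> borel_measurable M"
    using insert.prems(1) by (auto intro!: borel_measurable_sum)
  have int: "integrable M (\<lambda>\<omega>. 32 * (Z i \<omega> ^ 5 + (\<Sum>i\<in>I. Z i \<omega>) ^ 5))"
    by (intro integrable_mult_right Bochner_Integration.integrable_add insert.IH insert.prems) auto
  have "integrable M (\<lambda>\<omega>. (Z i \<omega> + (\<Sum>i\<in>I. Z i \<omega>)) ^ 5)"
  proof (rule Bochner_Integration.integrable_bound[OF int])
    have s: "(\<Sum>i\<in>I. Z i \<omega>) \<ge> 0" for \<omega> by (intro sum_nonneg assms(3))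
    show "AE \<omega> in M. norm ((Z i \<omega> + (\<Sum>i\<in>I. Z i \<omega>)) ^ 5) \<le> norm (32 * (Z i \<omega> ^ 5 + (\<Sum>i\<in>I. Z i \<omega>) ^ 5))"
    proof (rule AE_I2)
      fix \<omega>
      have "norm ((Z i \<omega> + (\<Sum>i\<in>I. Z i \<omega>)) ^ 5) = (Z i \<omega> + (\<Sum>i\<in>I. Z i \<omega>)) ^ 5"
        using s[of \<omega>] assms(3)[of i \<omega>] by simp
      also have "\<dots> \<le> 32 * (Z i \<omega> ^ 5 + (\<Sum>i\<in>I. Z i \<omega>) ^ 5)"
        by (rule power5_add_le[OF assms(3) s])
      also have "\<dots> \<le> norm \<dots>" by simp
      finally show "norm ((Z i \<omega> + (\<Sum>i\<in>I. Z i \<omega>)) ^ 5) \<le> norm (32 * (Z i \<omega> ^ 5 + (\<Sum>i\<in>I. Z i \<omega>) ^ 5))" .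
    qed
  qed measurable
  then show ?case using insert.hyps by simp
qed simp

text \<open>The argument is q^2, hence the square root; for positive arguments the value is q^-(d +
  1/2).\<close>

abbreviation weight :: "nat \<Rightarrow> real \<Rightarrow> ennreal" where
  "weight d t \<equiv> singular_weight (sing_exp d) (sqrt t) ^ (d + 1)"

text \<open>The symmetry of the frequency set enters through two consequences only: the cardinality,
  which fixes the variance, and the spanning property, which makes the gradient
  nondegenerate.\<close>

locale gaussian_wave = prob_space M for M :: "'a measure" +
  fixes \<Lambda> R :: "(int ^ 'n::finite) set" and b c :: "int ^ 'n \<Rightarrow> 'a \<Rightarrow> real"
  assumes finite_R: "finite R" and card_R: "card R > 0" and card_freq: "card \<Lambda> = 2 * card R"
    and span_R: "span (freq_vec ` R) = UNIV" and dim: "CARD('n) \<ge> 2"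
    and gauss: "gaussian_coefficients M R b c"
begin

abbreviation wave :: "'a \<Rightarrow> real ^ 'n \<Rightarrow> real" where
  "wave \<omega> \<equiv> trig_poly \<Lambda> R (\<lambda>v. b v \<omega>) (\<lambda>v. c v \<omega>)"

abbreviation energy :: "'a \<Rightarrow> ennreal" where
  "energy \<omega> \<equiv> jet_energy \<Lambda> R (\<lambda>v. b v \<omega>) (\<lambda>v. c v \<omega>)"

abbreviation scale :: real where
  "scale \<equiv> sqrt (2 / real (card \<Lambda>))"

definition coeffs :: "'a \<Rightarrow> int ^ 'n + int ^ 'n \<Rightarrow> real" where
  "coeffs \<omega> = (\<lambda>i\<in>R <+> R. case_sum b c i \<omega>)"

lemma coeffs_simps: "v \<in> R \<Longrightarrow> coeffs \<omega> (Inl v) = b v \<omega>" "v \<in> R \<Longrightarrow> coeffs \<omega> (Inr v) = c v \<omega>"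
  by (auto simp: coeffs_def)

lemma scale_pos: "scale > 0" and scale_sq: "scale\<^sup>2 * real (card R) = 1"
  using card_R by (simp_all add: card_freq)

lemma distributed_coeff:
  assumes "i \<in> R <+> R"
  shows "distributed M lborel (case_sum b c i) (\<lambda>x. ennreal (std_normal_density x))"
  using assms gauss unfolding gaussian_coefficients_def by auto

lemma coeff_measurable: "i \<in> R <+> R \<Longrightarrow> case_sum b c i \<in> borel_measurable M"
  using distributed_measurable[OF distributed_coeff] by simp

lemma b_measurable: "v \<in> R \<Longrightarrow> b v \<in> borel_measurable M"
  and c_measurable: "v \<in> R \<Longrightarrow> c v \<in> borel_measurable M"
  using coeff_measurable[of "Inl v"] coeff_measurable[of "Inr v"] by auto

lemma coeffs_measurable: "coeffs \<in> M \<rightarrow>\<^sub>M PiM (R <+> R) (\<lambda>_. borel)"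
  unfolding coeffs_def[abs_def] by (rule measurable_restrict) (rule coeff_measurable)

text \<open>Independence says that the joint law is the product of the marginal laws. This carries
  expectations over \<open>M\<close> to \<open>gauss_space\<close>, where rotation invariance is
  available.\<close>

lemma distr_coeffs: "distr M (PiM (R <+> R) (\<lambda>_. borel)) coeffs = gauss_space (R <+> R)"
proof -
  have ne: "R <+> R \<noteq> {}" using card_R by (auto simp: card_gt_0_iff)
  have "indep_vars (\<lambda>_. borel) (case_sum b c) (R <+> R)"
    using gauss by (simp add: gaussian_coefficients_def)
  then have "distr M (PiM (R <+> R) (\<lambda>_. borel)) coeffs = PiM (R <+> R) (\<lambda>i. distr M borel (case_sum b c i))"
    unfolding coeffs_def[abs_def] by (subst (asm) indep_vars_iff_distr_eq_PiM'[OF ne coeff_measurable])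
  also have "\<dots> = gauss_space (R <+> R)"
  proof (rule PiM_cong[OF refl])
    fix i assume "i \<in> R <+> R"
    from distributed_distr_eq_density[OF distributed_coeff[OF this]]
    have "distr M lborel (case_sum b c i) = std_normal" .
    moreover have "distr M borel (case_sum b c i) = distr M lborel (case_sum b c i)"
      by (rule distr_cong) auto
    ultimately show "distr M borel (case_sum b c i) = std_normal" by simp
  qed
  finally show ?thesis .
qed

lemma nn_integral_coeffs:
  assumes F: "F \<in> borel_measurable (PiM (R <+> R) (\<lambda>_. borel))"
  shows "(\<integral>\<^sup>+\<omega>. F (coeffs \<omega>) \<partial>M) = (\<integral>\<^sup>+g. F g \<partial>gauss_space (R <+> R))"
  unfolding distr_coeffs[symmetric] by (rule nn_integral_distr[symmetric, OF coeffs_measurable]) (use F in simp)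

lemma nn_integral_rotated_coeffs:
  assumes F: "F \<in> borel_measurable (PiM (R <+> R) (\<lambda>_. borel))"
  shows "(\<integral>\<^sup>+\<omega>. F (rotate_pairs R \<theta> R (coeffs \<omega>)) \<partial>M) = (\<integral>\<^sup>+g. F g \<partial>gauss_space (R <+> R))"
  using nn_integral_coeffs[OF measurable_compose[OF rotate_pairs_measurable F], of \<theta> R]
    nn_integral_rotate_pairs[OF finite_R subset_refl F, of \<theta>] by simp

text \<open>Stated for arbitrary \<open>u\<close> and \<open>w\<close>, so that it covers both the
  projections of a product space and a fixed point x.\<close>

lemma wave_joint_measurable:
  assumes u: "u \<in> N \<rightarrow>\<^sub>M M" and w: "w \<in> N \<rightarrow>\<^sub>M borel"
  shows "(\<lambda>z. wave (u z) (w z)) \<in> borel_measurable N"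
  by (rule trig_poly_measurable[OF _ _ w]) (use measurable_compose[OF u] b_measurable c_measurable in blast)+

lemma jet_joint_measurable:
  assumes u: "u \<in> N \<rightarrow>\<^sub>M M" and w: "w \<in> N \<rightarrow>\<^sub>M borel"
  shows "(\<lambda>z. trig.jet \<Lambda> R (\<lambda>v. b v (u z)) (\<lambda>v. c v (u z)) (w z)) \<in> borel_measurable N"
proof -
  have bm: "(\<lambda>z. b v (u z)) \<in> borel_measurable N" and cm: "(\<lambda>z. c v (u z)) \<in> borel_measurable N"
    if "v \<in> R" for v
    using measurable_compose[OF u b_measurable[OF that]] measurable_compose[OF u c_measurable[OF that]] by auto
  have [measurable]: "(\<lambda>z. trig_grad \<Lambda> R (\<lambda>v. b v (u z)) (\<lambda>v. c v (u z)) i (w z)) \<in> borel_measurable N" for i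
    unfolding trig_grad_def
    by (rule trig_poly_measurable[OF _ _ w]) (intro borel_measurable_times borel_measurable_const bm cm, assumption)+
  have [measurable]: "(\<lambda>z. wave (u z) (w z)) \<in> borel_measurable N"
    by (rule wave_joint_measurable[OF u w])
  show ?thesis unfolding trig.jet_def by measurable
qed

lemma snd_torus_borel: "snd \<in> N \<Otimes>\<^sub>M torus_measure \<rightarrow>\<^sub>M (borel :: (real ^ 'n) measure)"
  by (rule measurable_compose[OF measurable_snd]) (rule borel_measurable_torus, simp)

lemma weight_joint_measurable:
  "(\<lambda>(\<omega>, x). weight CARD('n) (trig.jet \<Lambda> R (\<lambda>v. b v \<omega>) (\<lambda>v. c v \<omega>) x)) \<in> borel_measurable (M \<Otimes>\<^sub>M torus_measure)"
proof -
  note jet_joint_measurable[OF measurable_fst snd_torus_borel, measurable]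
  show ?thesis unfolding case_prod_beta' by measurable
qed

lemma energy_measurable [measurable]: "energy \<in> borel_measurable M"
  unfolding jet_energy_def
  by (rule sigma_finite_measure.borel_measurable_nn_integral
       [OF prob_space_imp_sigma_finite[OF prob_space_torus_measure] weight_joint_measurable])

lemma torus_pair: "pair_sigma_finite M (torus_measure :: (real ^ 'n) measure)"
  by (intro pair_sigma_finite.intro prob_space_imp_sigma_finite prob_space_torus_measure prob_space_axioms)

text \<open>After exchanging the integrals, the inner one does not depend on x: rotating the
  coefficients turns the jet at x into the jet at 0. The torus has mass 1, so the bound
  \<open>K\<close> carries over.\<close>

lemma energy_finite: "(\<integral>\<^sup>+\<omega>. energy \<omega> \<partial>M) < \<infinity>"
proof -
  interpret T: prob_space "torus_measure :: (real ^ 'n) measure" by (rule prob_space_torus_measure)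
  obtain K where K: "K < \<infinity>" "(\<integral>\<^sup>+g. weight CARD('n) (gauss_jet scale R g) \<partial>gauss_space (R <+> R)) \<le> K"
    using gauss_jet_weight_bound[OF finite_R card_R span_R sing_exp(1,2) scale_pos] by blast
  have "(\<integral>\<^sup>+\<omega>. energy \<omega> \<partial>M)
      = (\<integral>\<^sup>+x. \<integral>\<^sup>+\<omega>. weight CARD('n) (trig.jet \<Lambda> R (\<lambda>v. b v \<omega>) (\<lambda>v. c v \<omega>) x) \<partial>M \<partial>torus_measure)"
    unfolding jet_energy_def
    by (rule pair_sigma_finite.Fubini'[OF torus_pair weight_joint_measurable, symmetric])
  also have "\<dots> = (\<integral>\<^sup>+x. (\<integral>\<^sup>+g. weight CARD('n) (gauss_jet scale R g) \<partial>gauss_space (R <+> R)) \<partial>(torus_measure :: (real ^ 'n) measure))"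
  proof (rule nn_integral_cong)
    fix x :: "real ^ 'n"
    have "(\<integral>\<^sup>+\<omega>. weight CARD('n) (trig.jet \<Lambda> R (\<lambda>v. b v \<omega>) (\<lambda>v. c v \<omega>) x) \<partial>M)
        = (\<integral>\<^sup>+\<omega>. weight CARD('n) (gauss_jet scale R (rotate_pairs R (\<lambda>v. 2 * pi * freq_inner v x) R (coeffs \<omega>))) \<partial>M)"
      by (intro nn_integral_cong arg_cong[of _ _ "weight CARD('n)"] trig_jet_eq coeffs_simps)
    also have "\<dots> = (\<integral>\<^sup>+g. weight CARD('n) (gauss_jet scale R g) \<partial>gauss_space (R <+> R))"
      by (rule nn_integral_rotated_coeffs[where F = "\<lambda>g. weight CARD('n) (gauss_jet scale R g)"]) measurable
    finally show "(\<integral>\<^sup>+\<omega>. weight CARD('n) (trig.jet \<Lambda> R (\<lambda>v. b v \<omega>) (\<lambda>v. c v \<omega>) x) \<partial>M)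
        = (\<integral>\<^sup>+g. weight CARD('n) (gauss_jet scale R g) \<partial>gauss_space (R <+> R))" .
  qed
  also have "\<dots> \<le> K" using K(2) by (simp add: T.emeasure_space_1)
  finally show ?thesis using K(1) by (simp add: order_le_less_trans)
qed

lemma AE_energy_finite: "AE \<omega> in M. energy \<omega> < \<infinity>"
  using nn_integral_PInf_AE[OF energy_measurable] energy_finite by (auto simp: less_top)

lemma integrable_energy: "integrable M (\<lambda>\<omega>. enn2real (energy \<omega>))"
proof (rule integrableI_nonneg)
  have "(\<integral>\<^sup>+\<omega>. ennreal (enn2real (energy \<omega>)) \<partial>M) \<le> (\<integral>\<^sup>+\<omega>. energy \<omega> \<partial>M)"
    by (intro nn_integral_mono) (simp add: ennreal_enn2real_if)
  also have "\<dots> < \<infinity>" by (rule energy_finite)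
  finally show "(\<integral>\<^sup>+\<omega>. ennreal (enn2real (energy \<omega>)) \<partial>M) < \<infinity>" .
qed auto

lemma integrable_amplitude: "integrable M (\<lambda>\<omega>. (\<Sum>v\<in>R. \<bar>b v \<omega>\<bar> + \<bar>c v \<omega>\<bar>) ^ 5)"
proof -
  have "integrable M (\<lambda>\<omega>. (\<Sum>i\<in>R <+> R. \<bar>case_sum b c i \<omega>\<bar>) ^ 5)"
  proof (rule integrable_sum_power5[where Z = "\<lambda>i \<omega>. \<bar>case_sum b c i \<omega>\<bar>"])
    show "finite (R <+> R)" using finite_R by simp
    fix i assume i: "i \<in> R <+> R"
    show "(\<lambda>\<omega>. \<bar>case_sum b c i \<omega>\<bar>) \<in> borel_measurable M"
      using coeff_measurable[OF i] by measurable
    show "integrable M (\<lambda>\<omega>. \<bar>case_sum b c i \<omega>\<bar> ^ 5)"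
      using distributed_integrable[OF distributed_coeff[OF i], of "\<lambda>x. \<bar>x\<bar> ^ 5"]
        integrable_std_normal_moment_abs[of 5] by simp
  qed simp
  then show ?thesis by (simp add: sum.Plus finite_R sum.distrib)
qed

text \<open>The variable is f(0), a sum of independent centred Gaussians with total variance
  \<open>scale\<^sup>2 * card R\<close>, which is 1.\<close>

lemma distributed_sum: "distributed M lborel (\<lambda>\<omega>. scale * (\<Sum>v\<in>R. b v \<omega>)) (\<lambda>x. ennreal (std_normal_density x))"
proof -
  have ind: "indep_vars (\<lambda>_. borel) (\<lambda>i \<omega>. scale * case_sum b c i \<omega>) (Inl ` R)"
  proof (rule indep_vars_compose2[where X = "case_sum b c"])
    show "indep_vars (\<lambda>_. borel) (case_sum b c) (Inl ` R)"
      using gauss unfolding gaussian_coefficients_def by (auto elim: indep_vars_subset)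
  qed simp
  have "distributed M lborel (\<lambda>\<omega>. \<Sum>i\<in>Inl ` R. scale * case_sum b c i \<omega>)
      (\<lambda>x. ennreal (normal_density (\<Sum>i\<in>(Inl ` R :: (int ^ 'n + int ^ 'n) set). 0) (sqrt (\<Sum>i\<in>(Inl ` R :: (int ^ 'n + int ^ 'n) set). scale\<^sup>2)) x))"
  proof (rule sum_indep_normal[OF _ _ ind])
    show "finite (Inl ` R)" "Inl ` R \<noteq> {}" using finite_R card_R by auto
    show "0 < scale" by (rule scale_pos)
    fix i assume "i \<in> (Inl ` R :: (int ^ 'n + int ^ 'n) set)"
    then have "distributed M lborel (case_sum b c i) (\<lambda>x. ennreal (std_normal_density x))"
      by (intro distributed_coeff) auto
    from normal_density_affine[OF this, of scale 0]
    show "distributed M lborel (\<lambda>\<omega>. scale * case_sum b c i \<omega>) (\<lambda>x. ennreal (normal_density 0 scale x))"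
      using scale_pos by simp
  qed
  moreover have "(\<Sum>i\<in>(Inl ` R :: (int ^ 'n + int ^ 'n) set). scale\<^sup>2) = 1"
  proof -
    have "card (Inl ` R :: (int ^ 'n + int ^ 'n) set) = card R" by (rule card_image) simp
    then have "(\<Sum>i\<in>(Inl ` R :: (int ^ 'n + int ^ 'n) set). scale\<^sup>2) = real (card R) * scale\<^sup>2"
      by (simp only: sum_constant)
    then show ?thesis using scale_sq by (simp only: mult.commute)
  qed
  moreover have "(\<Sum>i\<in>Inl ` R. scale * case_sum b c i \<omega>) = scale * (\<Sum>v\<in>R. b v \<omega>)" for \<omega>
    by (subst sum.reindex) (simp_all add: sum_distrib_left)
  ultimately show ?thesis by simp
qed

text \<open>The probability of |f(0)| < \<epsilon>; by rotation invariance it is the same at every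
  other point.\<close>

definition small_ball :: "real \<Rightarrow> real" where
  "small_ball \<epsilon> = measure M {\<omega> \<in> space M. \<bar>scale * (\<Sum>v\<in>R. b v \<omega>)\<bar> < \<epsilon>}"

lemma emeasure_wave_small:
  "emeasure M {\<omega> \<in> space M. \<bar>wave \<omega> x\<bar> < \<epsilon>} = ennreal (small_ball \<epsilon>)"
proof -
  let ?F = "\<lambda>g. indicator {t. \<bar>t\<bar> < \<epsilon>} (scale * (\<Sum>v\<in>R. g (Inl v))) :: ennreal"
  have [measurable]: "(\<lambda>g. \<Sum>v\<in>R. g (Inl v)) \<in> borel_measurable (PiM (R <+> R) (\<lambda>_. borel :: real measure))"
    by (intro borel_measurable_sum measurable_component_singleton) auto
  have F: "?F \<in> borel_measurable (PiM (R <+> R) (\<lambda>_. borel))" by measurable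
  have wm[measurable]: "(\<lambda>\<omega>. wave \<omega> x) \<in> borel_measurable M"
    by (rule wave_joint_measurable) simp_all
  have sm[measurable]: "(\<lambda>\<omega>. \<Sum>v\<in>R. b v \<omega>) \<in> borel_measurable M"
    by (intro borel_measurable_sum b_measurable)
  have "emeasure M {\<omega> \<in> space M. \<bar>wave \<omega> x\<bar> < \<epsilon>} = (\<integral>\<^sup>+\<omega>. indicator {\<omega> \<in> space M. \<bar>wave \<omega> x\<bar> < \<epsilon>} \<omega> \<partial>M)"
    by (rule nn_integral_indicator[symmetric]) measurable
  also have "\<dots> = (\<integral>\<^sup>+\<omega>. ?F (rotate_pairs R (\<lambda>v. 2 * pi * freq_inner v x) R (coeffs \<omega>)) \<partial>M)"
  proof (rule nn_integral_cong)
    fix \<omega> assume w: "\<omega> \<in> space M"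
    show "indicator {\<omega> \<in> space M. \<bar>wave \<omega> x\<bar> < \<epsilon>} \<omega> = ?F (rotate_pairs R (\<lambda>v. 2 * pi * freq_inner v x) R (coeffs \<omega>))"
      using trig_poly_rotate[of R "coeffs \<omega>" "\<lambda>v. b v \<omega>" "\<lambda>v. c v \<omega>" \<Lambda> x, OF coeffs_simps] w
      by (simp add: indicator_def)
  qed
  also have "\<dots> = (\<integral>\<^sup>+g. ?F g \<partial>gauss_space (R <+> R))" by (rule nn_integral_rotated_coeffs[OF F])
  also have "\<dots> = (\<integral>\<^sup>+\<omega>. ?F (coeffs \<omega>) \<partial>M)" by (rule nn_integral_coeffs[OF F, symmetric])
  also have "\<dots> = (\<integral>\<^sup>+\<omega>. indicator {\<omega> \<in> space M. \<bar>scale * (\<Sum>v\<in>R. b v \<omega>)\<bar> < \<epsilon>} \<omega> \<partial>M)"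
  proof (rule nn_integral_cong)
    fix \<omega> assume w: "\<omega> \<in> space M"
    have "(\<Sum>v\<in>R. coeffs \<omega> (Inl v)) = (\<Sum>v\<in>R. b v \<omega>)" by (rule sum.cong) (simp_all add: coeffs_simps)
    then show "?F (coeffs \<omega>) = indicator {\<omega> \<in> space M. \<bar>scale * (\<Sum>v\<in>R. b v \<omega>)\<bar> < \<epsilon>} \<omega>"
      using w by (simp add: indicator_def)
  qed
  also have "\<dots> = emeasure M {\<omega> \<in> space M. \<bar>scale * (\<Sum>v\<in>R. b v \<omega>)\<bar> < \<epsilon>}"
    by (rule nn_integral_indicator) measurable
  finally show ?thesis by (simp add: small_ball_def emeasure_eq_measure)
qed

text \<open>On (-\<epsilon>, \<epsilon>) the normal density lies between its values at \<epsilon>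
  and at 0, which is enough to squeeze the limit.\<close>

lemma small_ball_bounds:
  assumes e: "\<epsilon> > 0"
  shows "std_normal_density \<epsilon> * (2 * \<epsilon>) \<le> small_ball \<epsilon>" "small_ball \<epsilon> \<le> std_normal_density 0 * (2 * \<epsilon>)"
proof -
  let ?I = "{- \<epsilon><..<\<epsilon>}"
  have len: "emeasure lborel ?I = ennreal (2 * \<epsilon>)" using e by simp
  have s: "{\<omega> \<in> space M. \<bar>scale * (\<Sum>v\<in>R. b v \<omega>)\<bar> < \<epsilon>} = (\<lambda>\<omega>. scale * (\<Sum>v\<in>R. b v \<omega>)) -` ?I \<inter> space M"
    by (auto simp: abs_less_iff)
  have eq: "ennreal (small_ball \<epsilon>) = (\<integral>\<^sup>+x. ennreal (std_normal_density x) * indicator ?I x \<partial>lborel)"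
    unfolding small_ball_def emeasure_eq_measure[symmetric] s
    by (rule distributed_emeasure[OF distributed_sum]) simp
  have mono: "std_normal_density s \<le> std_normal_density t" if "\<bar>t\<bar> \<le> \<bar>s\<bar>" for s t
  proof -
    have "t\<^sup>2 \<le> s\<^sup>2" using that by (simp add: abs_le_square_iff)
    then show ?thesis by (simp add: std_normal_density_def divide_right_mono)
  qed
  have "ennreal (std_normal_density \<epsilon> * (2 * \<epsilon>)) = (\<integral>\<^sup>+x. ennreal (std_normal_density \<epsilon>) * indicator ?I x \<partial>lborel)"
    using e by (simp add: nn_integral_cmult_indicator ennreal_mult)
  also have "\<dots> \<le> ennreal (small_ball \<epsilon>)"
    unfolding eq by (intro nn_integral_mono) (auto simp: indicator_def intro!: mono ennreal_leI)
  finally show "std_normal_density \<epsilon> * (2 * \<epsilon>) \<le> small_ball \<epsilon>"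
    by (simp add: ennreal_le_iff small_ball_def)
  have "ennreal (small_ball \<epsilon>) \<le> (\<integral>\<^sup>+x. ennreal (std_normal_density 0) * indicator ?I x \<partial>lborel)"
    unfolding eq by (intro nn_integral_mono) (auto simp: indicator_def intro!: mono ennreal_leI)
  also have "\<dots> = ennreal (std_normal_density 0 * (2 * \<epsilon>))"
    using e by (simp add: nn_integral_cmult_indicator ennreal_mult)
  finally show "small_ball \<epsilon> \<le> std_normal_density 0 * (2 * \<epsilon>)"
    using e by (simp add: ennreal_le_iff)
qed

section \<open>Measurability and expectation of the Leray quotient\<close>

lemma small_joint_measurable:
  "(\<lambda>(\<omega>, x). indicator {t. \<bar>t\<bar> < \<epsilon>} (wave \<omega> x)) \<in> borel_measurable (M \<Otimes>\<^sub>M torus_measure)"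
  for \<epsilon> :: real
proof -
  note wave_joint_measurable[OF measurable_fst snd_torus_borel, measurable]
  show ?thesis unfolding case_prod_beta' by measurable
qed

lemma wave_borel: "wave \<omega> \<in> borel_measurable borel"
  by (intro borel_measurable_continuous_onI continuous_trig_poly)

lemma measure_wave_small:
  "measure torus_measure {x \<in> space torus_measure. \<bar>wave \<omega> x\<bar> < \<epsilon>}
    = (\<integral>x. indicator {t. \<bar>t\<bar> < \<epsilon>} (wave \<omega> x) \<partial>torus_measure)"
proof -
  have "(\<integral>x. indicator {t. \<bar>t\<bar> < \<epsilon>} (wave \<omega> x) \<partial>torus_measure)
      = (\<integral>x. indicator {x. \<bar>wave \<omega> x\<bar> < \<epsilon>} x \<partial>torus_measure :: real)"
    by (rule Bochner_Integration.integral_cong) (auto simp: indicator_def)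
  then show ?thesis by (simp add: Int_def conj_commute)
qed

lemma leray_quotient_measurable [measurable]: "(\<lambda>\<omega>. leray_quotient (wave \<omega>) \<epsilon>) \<in> borel_measurable M"
proof -
  have "(\<lambda>\<omega>. (\<integral>x. indicator {t. \<bar>t\<bar> < \<epsilon>} (wave \<omega> x) \<partial>torus_measure) :: real) \<in> borel_measurable M"
    by (rule sigma_finite_measure.borel_measurable_lebesgue_integral
       [OF prob_space_imp_sigma_finite[OF prob_space_torus_measure] small_joint_measurable])
  then show ?thesis unfolding leray_quotient_def measure_wave_small by measurable
qed

text \<open>Fubini turns the expected volume of |f| < \<epsilon> into an average over x of
  probabilities that do not depend on x.\<close>

lemma expectation_leray_quotient:
  assumes e: "\<epsilon> > 0"
  shows "expectation (\<lambda>\<omega>. leray_quotient (wave \<omega>) \<epsilon>) = small_ball \<epsilon> / (2 * \<epsilon>)"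
proof -
  interpret T: prob_space "torus_measure :: (real ^ 'n) measure" by (rule prob_space_torus_measure)
  let ?m = "\<lambda>\<omega>. measure torus_measure {x \<in> space torus_measure. \<bar>wave \<omega> x\<bar> < \<epsilon>}"
  have wx: "(\<lambda>x. wave \<omega> x) \<in> borel_measurable torus_measure" for \<omega>
    by (rule borel_measurable_torus[OF wave_borel])
  have wm[measurable]: "(\<lambda>\<omega>. wave \<omega> x) \<in> borel_measurable M" for x
    by (rule wave_joint_measurable) simp_all
  have q: "leray_quotient (wave \<omega>) \<epsilon> = ?m \<omega> / (2 * \<epsilon>)" for \<omega> by (simp add: leray_quotient_def)
  have mm: "?m \<in> borel_measurable M"
  proof -
    have "?m = (\<lambda>\<omega>. 2 * \<epsilon> * leray_quotient (wave \<omega>) \<epsilon>)" using e by (simp add: q)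
    then show ?thesis by simp
  qed
  have "(\<integral>\<^sup>+\<omega>. ennreal (?m \<omega>) \<partial>M)
      = (\<integral>\<^sup>+\<omega>. \<integral>\<^sup>+x. indicator {t. \<bar>t\<bar> < \<epsilon>} (wave \<omega> x) \<partial>torus_measure \<partial>M)"
  proof (rule nn_integral_cong)
    fix \<omega>
    note wx[of \<omega>, measurable]
    have "ennreal (?m \<omega>) = emeasure torus_measure {x \<in> space torus_measure. \<bar>wave \<omega> x\<bar> < \<epsilon>}"
      by (simp add: T.emeasure_eq_measure)
    also have "\<dots> = (\<integral>\<^sup>+x. indicator {x \<in> space torus_measure. \<bar>wave \<omega> x\<bar> < \<epsilon>} x \<partial>torus_measure)"
      by (rule nn_integral_indicator[symmetric]) measurable
    also have "\<dots> = (\<integral>\<^sup>+x. indicator {t. \<bar>t\<bar> < \<epsilon>} (wave \<omega> x) \<partial>torus_measure)"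
      by (rule nn_integral_cong) (simp add: indicator_def)
    finally show "ennreal (?m \<omega>) = (\<integral>\<^sup>+x. indicator {t. \<bar>t\<bar> < \<epsilon>} (wave \<omega> x) \<partial>torus_measure)" .
  qed
  also have "\<dots> = (\<integral>\<^sup>+x. \<integral>\<^sup>+\<omega>. indicator {t. \<bar>t\<bar> < \<epsilon>} (wave \<omega> x) \<partial>M \<partial>torus_measure)"
    by (rule pair_sigma_finite.Fubini'[OF torus_pair small_joint_measurable, symmetric])
  also have "\<dots> = (\<integral>\<^sup>+x. ennreal (small_ball \<epsilon>) \<partial>(torus_measure :: (real ^ 'n) measure))"
  proof (rule nn_integral_cong)
    fix x :: "real ^ 'n"
    have "(\<integral>\<^sup>+\<omega>. indicator {t. \<bar>t\<bar> < \<epsilon>} (wave \<omega> x) \<partial>M)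
        = (\<integral>\<^sup>+\<omega>. indicator {\<omega> \<in> space M. \<bar>wave \<omega> x\<bar> < \<epsilon>} \<omega> \<partial>M)"
      by (rule nn_integral_cong) (simp add: indicator_def)
    also have "\<dots> = emeasure M {\<omega> \<in> space M. \<bar>wave \<omega> x\<bar> < \<epsilon>}"
      by (rule nn_integral_indicator) measurable
    finally show "(\<integral>\<^sup>+\<omega>. indicator {t. \<bar>t\<bar> < \<epsilon>} (wave \<omega> x) \<partial>M) = ennreal (small_ball \<epsilon>)"
      by (simp only: emeasure_wave_small)
  qed
  also have "\<dots> = ennreal (small_ball \<epsilon>)" by (simp add: T.emeasure_space_1)
  finally have "expectation ?m = small_ball \<epsilon>"
    using mm by (simp add: integral_eq_nn_integral small_ball_def)
  then show ?thesis unfolding q by simp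
qed

lemma small_ball_limit: "(\<lambda>n. small_ball (1 / real (Suc n)) / (2 * (1 / real (Suc n)))) \<longlonglongrightarrow> 1 / sqrt (2 * pi)"
proof (rule tendsto_sandwich)
  have e: "1 / real (Suc n) > 0" for n by simp
  show "eventually (\<lambda>n. std_normal_density (1 / real (Suc n)) \<le> small_ball (1 / real (Suc n)) / (2 * (1 / real (Suc n)))) sequentially"
    using small_ball_bounds(1)[OF e] by (intro always_eventually allI) (subst pos_le_divide_eq, auto)
  show "eventually (\<lambda>n. small_ball (1 / real (Suc n)) / (2 * (1 / real (Suc n))) \<le> std_normal_density 0) sequentially"
    using small_ball_bounds(2)[OF e] by (intro always_eventually allI) (subst pos_divide_le_eq, auto)
  have "(\<lambda>n. std_normal_density (1 / real (Suc n))) \<longlonglongrightarrow> 1 / sqrt (2 * pi) * exp (- 0\<^sup>2 / 2)"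
    unfolding std_normal_density_def by (intro tendsto_intros LIMSEQ_Suc[OF lim_1_over_n]) simp
  then show "(\<lambda>n. std_normal_density (1 / real (Suc n))) \<longlonglongrightarrow> 1 / sqrt (2 * pi)" by simp
  show "(\<lambda>n. std_normal_density 0) \<longlonglongrightarrow> 1 / sqrt (2 * pi)" by (simp add: std_normal_density_def)
qed

text \<open>\<open>Lim\<close> is the definite description of a limit, hence one fixed value wherever no limit exists;
  left continuity of the quotient reduces the existence of the limit to countably many conditions.\<close>

lemma leray_measure_measurable: "(\<lambda>\<omega>. leray_measure (wave \<omega>)) \<in> borel_measurable M"
proof -
  let ?q = "\<lambda>\<omega>. leray_quotient (wave \<omega>)"
  let ?P = "\<lambda>\<omega>. \<forall>k::nat. \<exists>m::nat. \<forall>p q :: rat. 0 < p \<and> of_rat p < 1 / real (Suc m) \<and> 0 < q \<and> of_rat q < 1 / real (Suc m)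
       \<longrightarrow> \<bar>?q \<omega> (of_rat p) - ?q \<omega> (of_rat q)\<bar> \<le> 1 / real (Suc k)"
  have P: "(\<exists>l. (?q \<omega> \<longlongrightarrow> l) (at_right 0)) \<longleftrightarrow> ?P \<omega>" for \<omega>
    by (rule left_continuous_limit_iff) (rule leray_quotient_left_continuous[OF wave_borel])
  have eq: "leray_measure (wave \<omega>) = (if ?P \<omega> then lim (\<lambda>n. ?q \<omega> (1 / real (Suc n))) else (THE l. False))" for \<omega>
  proof (cases "?P \<omega>")
    case True
    then obtain l where l: "(?q \<omega> \<longlongrightarrow> l) (at_right 0)" using P by blast
    have "filterlim (\<lambda>n. 1 / real (Suc n)) (at_right 0) sequentially"
      unfolding filterlim_at using LIMSEQ_Suc[OF lim_1_over_n] by (auto simp del: of_nat_Suc)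
    from filterlim_compose[OF l this] have "lim (\<lambda>n. ?q \<omega> (1 / real (Suc n))) = l"
      by (intro limI) simp
    moreover have "leray_measure (wave \<omega>) = l"
      unfolding leray_measure_def by (rule tendsto_Lim[OF _ l]) simp
    ultimately show ?thesis using True by simp
  next
    case False
    then have "\<not> (?q \<omega> \<longlongrightarrow> l) (at_right 0)" for l using P by blast
    then have "leray_measure (wave \<omega>) = (THE l. False)"
      unfolding leray_measure_def t2_space_class.Lim_def by simp
    with False show ?thesis by (simp only: if_False)
  qed
  have [measurable]: "Measurable.pred M ?P" by measurable
  show ?thesis unfolding eq by measurable
qed

text \<open>Along \<epsilon> = 1/(n + 1) the quotients converge almost surely and have a common
  integrable bound, so their explicit expectations converge to that of the limit.\<close>

lemma leray_expectation:
  "AE \<omega> in M. leray_defined (wave \<omega>)"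
  "integrable M (\<lambda>\<omega>. leray_measure (wave \<omega>))"
  "expectation (\<lambda>\<omega>. leray_measure (wave \<omega>)) = 1 / sqrt (2 * pi)"
proof -
  show def: "AE \<omega> in M. leray_defined (wave \<omega>)"
    using AE_energy_finite by eventually_elim (rule trig_leray_defined)
  obtain H where H: "H > 0" "\<And>\<beta> \<gamma> x. \<bar>trig_poly \<Lambda> R \<beta> \<gamma> x\<bar> \<le> H * (\<Sum>v\<in>R. \<bar>\<beta> v\<bar> + \<bar>\<gamma> v\<bar>)"
    "\<And>\<beta> \<gamma> i j x. \<bar>trig_hess \<Lambda> R \<beta> \<gamma> i j x\<bar> \<le> H * (\<Sum>v\<in>R. \<bar>\<beta> v\<bar> + \<bar>\<gamma> v\<bar>)"
    by (rule trig_hess_bound[OF finite_R, of \<Lambda>]) blast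
  define A where "A \<omega> = H * (\<Sum>v\<in>R. \<bar>b v \<omega>\<bar> + \<bar>c v \<omega>\<bar>)" for \<omega>
  have A0: "A \<omega> \<ge> 0" for \<omega> unfolding A_def using H(1) by (intro mult_nonneg_nonneg sum_nonneg) auto
  \<comment> \<open>The bound of \<open>trig_leray_bound\<close>, independent of \<open>n\<close>;
    it is integrable by the fifth Gaussian moments and by the finite expectation of the
    energy.\<close>
  define D where "D \<omega> = (1 + 5 * real CARD('n) ^ 2) * (A \<omega> ^ 5 + 1 + enn2real (energy \<omega>))" for \<omega>
  have Dint: "integrable M D"
    unfolding D_def A_def power_mult_distrib
    by (intro integrable_mult_right Bochner_Integration.integrable_add integrable_amplitude integrable_energy) simp
  let ?s = "\<lambda>n \<omega>. leray_quotient (wave \<omega>) (1 / real (Suc n))"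
  have lim: "AE \<omega> in M. (\<lambda>n. ?s n \<omega>) \<longlonglongrightarrow> leray_measure (wave \<omega>)"
    using def
  proof eventually_elim
    case (elim \<omega>)
    then obtain l where l: "(leray_quotient (wave \<omega>) \<longlongrightarrow> l) (at_right 0)" by (auto simp: leray_defined_def)
    have "leray_measure (wave \<omega>) = l"
      unfolding leray_measure_def by (rule tendsto_Lim[OF _ l]) simp
    moreover have "filterlim (\<lambda>n. 1 / real (Suc n)) (at_right 0) sequentially"
      unfolding filterlim_at using LIMSEQ_Suc[OF lim_1_over_n] by (auto simp del: of_nat_Suc)
    ultimately show ?case using filterlim_compose[OF l] by simp
  qed
  have dom: "AE \<omega> in M. norm (?s n \<omega>) \<le> D \<omega>" for n
    using AE_energy_finite
  proof eventually_elim
    case (elim \<omega>)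
    have "?s n \<omega> \<le> D \<omega>"
      unfolding D_def
    proof (rule trig_leray_bound[OF elim dim A0])
      show "\<bar>wave \<omega> x\<bar> \<le> A \<omega>" for x unfolding A_def by (rule H(2))
      show "\<bar>trig_hess \<Lambda> R (\<lambda>v. b v \<omega>) (\<lambda>v. c v \<omega>) i j x\<bar> \<le> A \<omega>" for x i j unfolding A_def by (rule H(3))
    qed simp
    moreover have "?s n \<omega> \<ge> 0" by (simp add: leray_quotient_def)
    ultimately show ?case by simp
  qed
  note hyps = leray_measure_measurable leray_quotient_measurable Dint lim dom
  show "integrable M (\<lambda>\<omega>. leray_measure (wave \<omega>))"
    by (rule integrable_dominated_convergence[OF hyps])
  have "(\<lambda>n. expectation (?s n)) \<longlonglongrightarrow> expectation (\<lambda>\<omega>. leray_measure (wave \<omega>))"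
    by (rule integral_dominated_convergence[OF hyps])
  moreover have "expectation (?s n) = small_ball (1 / real (Suc n)) / (2 * (1 / real (Suc n)))" for n
    by (rule expectation_leray_quotient) simp
  ultimately show "expectation (\<lambda>\<omega>. leray_measure (wave \<omega>)) = 1 / sqrt (2 * pi)"
    using LIMSEQ_unique small_ball_limit by (simp only:)
qed

end

theorem theorem4p1:
  fixes \<Lambda> R :: "(int ^ 'n::finite) set"
    and i1 i2 :: 'n
    and M :: "'a measure"
    and b c :: "int ^ 'n \<Rightarrow> 'a \<Rightarrow> real"
    and f :: "'a \<Rightarrow> real ^ 'n \<Rightarrow> real"
  assumes "CARD('n) \<ge> 2"
    and "symmetric_frequencies \<Lambda>"
    and "i1 \<noteq> i2"
    and "\<exists>v\<in>\<Lambda>. v $ i1 \<noteq> v $ i2 \<and> v $ i1 \<noteq> - (v $ i2) \<and> v $ i1 \<noteq> 0 \<and> v $ i2 \<noteq> 0"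
    and "sign_representatives \<Lambda> R"
    and "prob_space M"
    and "gaussian_coefficients M R b c"
    and "\<And>\<omega>. f \<omega> = trig_poly \<Lambda> R (\<lambda>v. b v \<omega>) (\<lambda>v. c v \<omega>)"
  shows "(AE \<omega> in M. leray_defined (f \<omega>)) \<and>
         integrable M (\<lambda>\<omega>. leray_measure (f \<omega>)) \<and>
         (\<integral>\<omega>. leray_measure (f \<omega>) \<partial>M) = 1 / sqrt (2 * pi)"
proof -
  \<comment> \<open>The nonzero coordinate of \<open>v\<close> is the input from which
    \<open>span_freq_vec\<close> generates every unit vector.\<close>
  obtain v where v: "v \<in> \<Lambda>" "v $ i1 \<noteq> 0" using assms(4) by blast
  interpret gaussian_wave M \<Lambda> R b c
    by (intro gaussian_wave.intro gaussian_wave_axioms.intro assms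
        card_sign_representatives[OF assms(2,5)] span_freq_vec[OF assms(2,5) v])
  show ?thesis unfolding assms(8) using leray_expectation by blast
qed

end
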